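(* Let $\mathbb{X}$ be a computable type and let $F:\mathbb{X}\to\mathcal{P}(\mathbb{X})$ be a (simple) Markov process. Then for every $n\in\mathbb{N}$, given $F$ and a probability distribution $\mu_0\in\mathcal{P}(\mathbb{X})$ of the initial state $x_0$, the probability distribution $\mu_n\in\mathcal{P}(\mathbb{X})$ of the state $x_n$ at time $n$, and the joint probability distribution $\gamma_n\in\mathcal{P}(\mathbb{X}^{n+1})$ of the states $(x_0,\ldots,x_n)$ up to time $n$, are computable.
   Context: Computability is in the sense of type-two effectivity (TTE): a computable type is a quotient of a countably-based (QCB) space together with an equivalence class of admissible quotient representations, i.e. suitable partial surjections from $\Sigma^\omega$ whose arguments are called names; an object is computable from given data if there is a type-two Turing machine transforming any names of the data into a name of the object. For types $\mathbb{A},\mathbb{B}$, $\mathbb{A}\to\mathbb{B}$ is the exponential type of continuous functions (computable types form a cartesian closed category). $\mathbb{H}$ is $[0,\infty]$ with the topology of lower convergence (open sets $(a,\infty]$, together with $\emptyset$ and $[0,\infty]$), a name encoding an increasing sequence of rationals converging to the element; $0\times\infty=\infty\times0=0$. $\mathcal{P}(\mathbb{X})$ is the type of probability distributions on $\mathbb{X}$: the subtype of $(\mathbb{X}\to\mathbb{H})\to\mathbb{H}$ of continuous linear functionals $\mu$ (so $\mu(a_1\psi_1+a_2\psi_2)=a_1\mu(\psi_1)+a_2\mu(\psi_2)$ for $a_i\in\mathbb{H}$) with $\mu(1)=1$; equivalently, via the lower integral, of valuations of total mass $1$ on open sets. A simple Markov process on $\mathbb{X}$ is an element $F$ of $\mathbb{X}\to\mathcal{P}(\mathbb{X})$;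 $F(x)$ is the distribution of the next state when the current state is $x$. Accordingly $\mu_n(\psi)=\mu_{n-1}(\lambda x.\,F(x)(\psi))$ for $\psi:\mathbb{X}\to\mathbb{H}$, and $\gamma_0=\mu_0$, $\gamma_n(\psi)=\gamma_{n-1}\bigl(\lambda(x_0,\ldots,x_{n-1}).\,F(x_{n-1})(\lambda x_n.\,\psi(x_0,\ldots,x_n))\bigr)$ for $\psi:\mathbb{X}^{n+1}\to\mathbb{H}$. *)

theory Defs
  imports "HOL-Analysis.Analysis" "HOL-Library.Nat_Bijection"
begin

section \<open>Type-two Turing machines\<close>

text \<open>
  The alphabet is \<open>{0,1}\<close>, rendered as \<^typ>\<open>bool\<close>, so \<open>nat \<Rightarrow> bool\<close> is the space of infinite words.
\<close>

type_synonym iword = "nat \<Rightarrow> bool"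

datatype move = MoveLeft | Stay | MoveRight

fun displace :: "move \<Rightarrow> int \<Rightarrow> int" where
  "displace MoveLeft h = h - 1"
| "displace Stay h = h"
| "displace MoveRight h = h + 1"

text \<open>
  A machine has finitely many one-way read-only input tapes, finitely many two-way infinite work
  tapes and one one-way write-only output tape.  States are the numbers below \<open>num_states\<close> (\<open>0\<close> is
  initial), work symbols the numbers below \<open>num_symbols\<close> (\<open>0\<close> is the blank).  Given the state, the
  scanned input letters and the scanned work symbols, \<open>delta\<close> yields the new state, for every input
  tape whether its head advances, for every work tape the symbol to write and the head movement,
  and possibly a letter to append to the output.  Only the restriction of \<open>delta\<close> to these finite
  ranges matters.  A machine that stops is one that idles for ever.
\<close>

record machine =
  num_states :: nat
  num_symbols :: nat
  num_tapes :: nat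
  delta :: "nat \<Rightarrow> bool list \<Rightarrow> nat list \<Rightarrow> nat \<times> bool list \<times> (nat \<times> move) list \<times> bool option"

definition is_machine :: "nat \<Rightarrow> machine \<Rightarrow> bool" where
  "is_machine k M \<longleftrightarrow> 0 < num_states M \<and> 0 < num_symbols M \<and>
     (\<forall>s as ws. s < num_states M \<longrightarrow> length as = k \<longrightarrow> length ws = num_tapes M \<longrightarrow>
        set ws \<subseteq> {..<num_symbols M} \<longrightarrow>
        (case delta M s as ws of (s', adv, acts, out) \<Rightarrow>
           s' < num_states M \<and> length adv = k \<and> length acts = num_tapes M \<and>
           fst ` set acts \<subseteq> {..<num_symbols M}))"

record config =
  cur_state :: nat
  in_heads :: "nat list"
  work_tapes :: "((int \<Rightarrow> nat) \<times> int) list"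
  written :: "bool list"

definition init_config :: "nat \<Rightarrow> machine \<Rightarrow> config" where
  "init_config k M =
     \<lparr>cur_state = 0, in_heads = replicate k 0,
      work_tapes = replicate (num_tapes M) (\<lambda>_. 0, 0), written = []\<rparr>"

definition step :: "machine \<Rightarrow> iword list \<Rightarrow> config \<Rightarrow> config" where
  "step M ps c =
     (case delta M (cur_state c) (map2 (\<lambda>p h. p h) ps (in_heads c))
             (map (\<lambda>(t, h). t h) (work_tapes c)) of
        (s', adv, acts, out) \<Rightarrow>
          \<lparr>cur_state = s',
           in_heads = map2 (\<lambda>a h. if a then Suc h else h) adv (in_heads c),
           work_tapes = map2 (\<lambda>(g, d) (t, h). (t(h := g), displace d h)) acts (work_tapes c),
           written = written c @ (case out of None \<Rightarrow> [] | Some b \<Rightarrow> [b])\<rparr>)"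

definition output_after :: "machine \<Rightarrow> iword list \<Rightarrow> nat \<Rightarrow> bool list" where
  "output_after M ps t = written ((step M ps ^^ t) (init_config (length ps) M))"

definition computes :: "machine \<Rightarrow> iword list \<Rightarrow> iword \<Rightarrow> bool" where
  "computes M ps q \<longleftrightarrow>
     (\<forall>n. \<exists>t. n \<le> length (output_after M ps t)) \<and>
     (\<forall>t. \<forall>i<length (output_after M ps t). output_after M ps t ! i = q i)"


section \<open>Computable types\<close>

definition cantor :: "iword topology" where
  "cantor = product_topology (\<lambda>_. discrete_topology UNIV) UNIV"

text \<open>
  The members of a type are the points of \<open>top_of\<close>; \<open>rep_of\<close> is the partial map sending a name to
  the point it names.  One representation is chosen from its equivalence class; computability does
  not depend on the choice.
\<close>

record 'a ctype =
  top_of :: "'a topology"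
  rep_of :: "iword \<Rightarrow> 'a option"

abbreviation members :: "'a ctype \<Rightarrow> 'a set" where
  "members X \<equiv> topspace (top_of X)"

definition admissible :: "'a ctype \<Rightarrow> bool" where
  "admissible X \<longleftrightarrow>
     (\<forall>D \<phi>. continuous_map (subtopology cantor D) (top_of X) \<phi> \<longrightarrow>
        (\<exists>G. continuous_map (subtopology cantor D) (subtopology cantor (dom (rep_of X))) G \<and>
             (\<forall>p\<in>D. rep_of X (G p) = Some (\<phi> p))))"

text \<open>
  As a quotient of a subspace of the Cantor space, the space of a computable type is automatically
  a quotient of a countably-based space.
\<close>

definition computable_type :: "'a ctype \<Rightarrow> bool" where
  "computable_type X \<longleftrightarrow>
     quotient_map (subtopology cantor (dom (rep_of X))) (top_of X) (\<lambda>p. the (rep_of X p)) \<and>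
     admissible X"

text \<open>
  An operation is computable if a single machine transforms any names of the arguments into a
  name of the result.
\<close>

definition computable_op2 ::
    "'a ctype \<Rightarrow> 'b ctype \<Rightarrow> 'c ctype \<Rightarrow> ('a \<Rightarrow> 'b \<Rightarrow> 'c) \<Rightarrow> bool" where
  "computable_op2 A B C f \<longleftrightarrow>
     (\<forall>x\<in>members A. \<forall>y\<in>members B. f x y \<in> members C) \<and>
     (\<exists>M. is_machine 2 M \<and>
        (\<forall>p q x y. rep_of A p = Some x \<longrightarrow> rep_of B q = Some y \<longrightarrow>
           (\<exists>r. computes M [p, q] r \<and> rep_of C r = Some (f x y))))"

text \<open>
  The quotient topology of a representation, used for constructed types: in the category of QCB
  spaces, exponentials, subtypes and products carry the sequentialisation of the usual topology,
  which is the quotient topology of the constructed representation.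
\<close>

definition rep_topology :: "'a set \<Rightarrow> (iword \<Rightarrow> 'a option) \<Rightarrow> 'a topology" where
  "rep_topology C \<delta> =
     topology (\<lambda>U. U \<subseteq> C \<and> openin (subtopology cantor (dom \<delta>)) {p \<in> dom \<delta>. the (\<delta> p) \<in> U})"

lemma openin_rep_topology:
  "openin (rep_topology C \<delta>) U \<longleftrightarrow>
     U \<subseteq> C \<and> openin (subtopology cantor (dom \<delta>)) {p \<in> dom \<delta>. the (\<delta> p) \<in> U}"
proof -
  let ?V = "\<lambda>U. {p \<in> dom \<delta>. the (\<delta> p) \<in> U}"
  have "?V (S \<inter> T) = ?V S \<inter> ?V T" "?V (\<Union>K) = (\<Union>S\<in>K. ?V S)" for S T K
    by auto
  then have "istopology (\<lambda>U. U \<subseteq> C \<and> openin (subtopology cantor (dom \<delta>)) (?V U))"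
    unfolding istopology_def by (auto intro!: openin_Union)
  then show ?thesis
    by (simp add: rep_topology_def topology_inverse')
qed

lemma topspace_rep_topology:
  assumes "ran \<delta> \<subseteq> C"
  shows "topspace (rep_topology C \<delta>) = C"
proof -
  have "{p \<in> dom \<delta>. the (\<delta> p) \<in> C} = dom \<delta>"
    using assms by (auto simp: ran_def)
  moreover have "openin (subtopology cantor (dom \<delta>)) (dom \<delta>)"
    using openin_topspace[of "subtopology cantor (dom \<delta>)"] by (simp add: cantor_def)
  ultimately have "openin (rep_topology C \<delta>) C"
    by (simp add: openin_rep_topology)
  then show ?thesis
    by (meson openin_rep_topology openin_subset openin_topspace subset_antisym)
qed


subsection \<open>The type of non-negative extended reals with lower convergence\<close>

definition lower_topology :: "ennreal topology" where
  "lower_topology = topology (\<lambda>U. U = {} \<or> U = UNIV \<or> (\<exists>a. U = {a<..}))"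

lemma openin_lower_topology:
  "openin lower_topology U \<longleftrightarrow> U = {} \<or> U = UNIV \<or> (\<exists>a. U = {a<..})"
proof -
  let ?L = "\<lambda>U::ennreal set. U = {} \<or> U = UNIV \<or> (\<exists>a. U = {a<..})"
  have int: "?L (S \<inter> T)" if "?L S" "?L T" for S T
  proof -
    have "{a<..} \<inter> {b<..} = {max a b<..}" for a b :: ennreal
      by auto
    with that show ?thesis by auto
  qed
  have un: "?L (\<Union>K)" if "\<forall>S\<in>K. ?L S" for K
  proof (cases "UNIV \<in> K")
    case True
    then show ?thesis by auto
  next
    case False
    define A where "A = {a. {a<..} \<in> K}"
    have "\<Union>K = (\<Union>a\<in>A. {a<..})"
      using that False unfolding A_def by blast
    also have "\<dots> = {Inf A<..}"
      by (auto simp: Inf_less_iff)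
    finally show ?thesis by blast
  qed
  have "istopology ?L"
    unfolding istopology_def using int un by blast
  then show ?thesis
    by (simp add: lower_topology_def topology_inverse')
qed

text \<open>
  A word of the form \<open>1 \<dots> 1 0 1 \<dots> 1 0 \<dots>\<close> with infinitely many zeros encodes the sequence of the
  lengths of its blocks of ones (which may be empty); consecutive block lengths \<open>a\<close>, \<open>b\<close> encode the
  rational \<open>a / (b + 1)\<close>.  Sequences are increasing in the weak sense, as \<open>0\<close> needs a name.
\<close>

primrec block :: "iword \<Rightarrow> nat \<Rightarrow> nat" where
  "block p 0 = (LEAST i. \<not> p i)"
| "block p (Suc k) = block (\<lambda>i. p (i + Suc (LEAST j. \<not> p j))) k"

definition lower_approx :: "iword \<Rightarrow> nat \<Rightarrow> ennreal" where
  "lower_approx p k = of_nat (block p (2 * k)) / of_nat (Suc (block p (2 * k + 1)))"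

definition lower_reals :: "ennreal ctype" where
  "lower_reals =
     \<lparr>top_of = lower_topology,
      rep_of = (\<lambda>p. if infinite {i. \<not> p i} \<and> incseq (lower_approx p)
                    then Some (SUP k. lower_approx p k) else None)\<rparr>"


subsection \<open>Exponentials\<close>

text \<open>
  A word \<open>p\<close> encodes a partial continuous function on infinite words, in the manner of a Kleene
  associate: \<open>p (assoc_index j b u)\<close> states that on every input extending the finite word \<open>u\<close>, the
  \<open>j\<close>-th output letter is \<open>b\<close>.  The function is defined at \<open>q\<close> if every output letter is determined
  consistently by the finite prefixes of \<open>q\<close>.
\<close>

definition assoc_index :: "nat \<Rightarrow> bool \<Rightarrow> bool list \<Rightarrow> nat" where
  "assoc_index j b u = list_encode (j # of_bool b # map of_bool u)"

definition determines :: "iword \<Rightarrow> iword \<Rightarrow> nat \<Rightarrow> bool \<Rightarrow> bool" where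
  "determines p q j b \<longleftrightarrow> (\<exists>n. p (assoc_index j b (map q [0..<n])))"

definition apply_name :: "iword \<Rightarrow> iword \<Rightarrow> iword option" where
  "apply_name p q =
     (if \<forall>j. \<exists>!b. determines p q j b then Some (\<lambda>j. determines p q j True) else None)"

definition realizes :: "'a ctype \<Rightarrow> 'b ctype \<Rightarrow> iword \<Rightarrow> ('a \<Rightarrow> 'b) \<Rightarrow> bool" where
  "realizes X Y p f \<longleftrightarrow>
     (\<forall>q x. rep_of X q = Some x \<longrightarrow>
        (\<exists>r. apply_name p q = Some r \<and> rep_of Y r = Some (f x)))"

text \<open>
  Functions are normalised outside the members of the domain, so that equality is equality on
  members.
\<close>

definition cont_funs :: "'a ctype \<Rightarrow> 'b ctype \<Rightarrow> ('a \<Rightarrow> 'b) set" where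
  "cont_funs X Y = {f \<in> extensional (members X). continuous_map (top_of X) (top_of Y) f}"

text \<open>
  If the representation of \<open>X\<close> is surjective, a word realizes at most one member of \<open>cont_funs X Y\<close>.
\<close>

definition exp_rep :: "'a ctype \<Rightarrow> 'b ctype \<Rightarrow> iword \<Rightarrow> ('a \<Rightarrow> 'b) option" where
  "exp_rep X Y p =
     (if \<exists>!f. f \<in> cont_funs X Y \<and> realizes X Y p f
      then Some (THE f. f \<in> cont_funs X Y \<and> realizes X Y p f) else None)"

definition exp_type :: "'a ctype \<Rightarrow> 'b ctype \<Rightarrow> ('a \<Rightarrow> 'b) ctype" where
  "exp_type X Y =
     \<lparr>top_of = rep_topology (cont_funs X Y) (exp_rep X Y), rep_of = exp_rep X Y\<rparr>"

lemma members_exp_type: "members (exp_type X Y) = cont_funs X Y"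
proof -
  have "f \<in> cont_funs X Y" if "exp_rep X Y p = Some f" for p f
    using that theI'[of "\<lambda>f. f \<in> cont_funs X Y \<and> realizes X Y p f"]
    by (simp add: exp_rep_def split: if_splits)
  then have "ran (exp_rep X Y) \<subseteq> cont_funs X Y"
    by (auto simp: ran_def)
  then show ?thesis
    by (simp add: exp_type_def topspace_rep_topology)
qed


subsection \<open>Subtypes and powers\<close>

definition sub_rep :: "'a ctype \<Rightarrow> 'a set \<Rightarrow> iword \<Rightarrow> 'a option" where
  "sub_rep X S p =
     (case rep_of X p of None \<Rightarrow> None | Some x \<Rightarrow> if x \<in> S then Some x else None)"

definition subtype :: "'a ctype \<Rightarrow> 'a set \<Rightarrow> 'a ctype" where
  "subtype X S = \<lparr>top_of = rep_topology (members X \<inter> S) (sub_rep X S), rep_of = sub_rep X S\<rparr>"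

text \<open>
  An \<open>m\<close>-tuple is a function on \<open>{..<m}\<close>; a name of it interleaves names of its components.
\<close>

definition component :: "nat \<Rightarrow> nat \<Rightarrow> iword \<Rightarrow> iword" where
  "component m i p = (\<lambda>j. p (m * j + i))"

definition tuples :: "'a ctype \<Rightarrow> nat \<Rightarrow> (nat \<Rightarrow> 'a) set" where
  "tuples X m = {..<m} \<rightarrow>\<^sub>E members X"

definition power_rep :: "'a ctype \<Rightarrow> nat \<Rightarrow> iword \<Rightarrow> (nat \<Rightarrow> 'a) option" where
  "power_rep X m p =
     (if \<forall>i<m. component m i p \<in> dom (rep_of X)
      then Some (\<lambda>i\<in>{..<m}. the (rep_of X (component m i p))) else None)"

definition power_type :: "'a ctype \<Rightarrow> nat \<Rightarrow> (nat \<Rightarrow> 'a) ctype" where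
  "power_type X m = \<lparr>top_of = rep_topology (tuples X m) (power_rep X m), rep_of = power_rep X m\<rparr>"


section \<open>Probability distributions and Markov processes\<close>

abbreviation observables :: "'a ctype \<Rightarrow> ('a \<Rightarrow> ennreal) set" where
  "observables X \<equiv> members (exp_type X lower_reals)"

definition linear_functional :: "'a ctype \<Rightarrow> (('a \<Rightarrow> ennreal) \<Rightarrow> ennreal) \<Rightarrow> bool" where
  "linear_functional X \<mu> \<longleftrightarrow>
     (\<forall>a1 a2. \<forall>\<psi>1\<in>observables X. \<forall>\<psi>2\<in>observables X.
        \<mu> (\<lambda>x\<in>members X. a1 * \<psi>1 x + a2 * \<psi>2 x) = a1 * \<mu> \<psi>1 + a2 * \<mu> \<psi>2)"

definition prob_type :: "'a ctype \<Rightarrow> (('a \<Rightarrow> ennreal) \<Rightarrow> ennreal) ctype" where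
  "prob_type X =
     subtype (exp_type (exp_type X lower_reals) lower_reals)
       {\<mu>. linear_functional X \<mu> \<and> \<mu> (\<lambda>x\<in>members X. 1) = 1}"

text \<open>A simple Markov process on \<open>X\<close> is a member of \<open>markov_type X\<close>.\<close>

abbreviation markov_type :: "'a ctype \<Rightarrow> ('a \<Rightarrow> ('a \<Rightarrow> ennreal) \<Rightarrow> ennreal) ctype" where
  "markov_type X \<equiv> exp_type X (prob_type X)"

primrec state_distribution ::
    "'a ctype \<Rightarrow> ('a \<Rightarrow> ('a \<Rightarrow> ennreal) \<Rightarrow> ennreal) \<Rightarrow> (('a \<Rightarrow> ennreal) \<Rightarrow> ennreal) \<Rightarrow> nat \<Rightarrow>
     (('a \<Rightarrow> ennreal) \<Rightarrow> ennreal)" where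
  "state_distribution X F \<mu>0 0 = \<mu>0"
| "state_distribution X F \<mu>0 (Suc n) =
     (\<lambda>\<psi>\<in>observables X. state_distribution X F \<mu>0 n (\<lambda>x\<in>members X. F x \<psi>))"

text \<open>
  The state history up to time \<open>n\<close> is an \<open>(n + 1)\<close>-tuple; in particular the initial joint
  distribution is \<open>\<mu>0\<close> transported along the identification of a state with a \<open>1\<close>-tuple.
\<close>

primrec joint_distribution ::
    "'a ctype \<Rightarrow> ('a \<Rightarrow> ('a \<Rightarrow> ennreal) \<Rightarrow> ennreal) \<Rightarrow> (('a \<Rightarrow> ennreal) \<Rightarrow> ennreal) \<Rightarrow> nat \<Rightarrow>
     (((nat \<Rightarrow> 'a) \<Rightarrow> ennreal) \<Rightarrow> ennreal)" where
  "joint_distribution X F \<mu>0 0 =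
     (\<lambda>\<psi>\<in>observables (power_type X 1). \<mu>0 (\<lambda>x\<in>members X. \<psi> (\<lambda>i\<in>{..<1}. x)))"
| "joint_distribution X F \<mu>0 (Suc n) =
     (\<lambda>\<psi>\<in>observables (power_type X (Suc (Suc n))).
        joint_distribution X F \<mu>0 n
          (\<lambda>x\<in>members (power_type X (Suc n)). F (x n) (\<lambda>y\<in>members X. \<psi> (x(Suc n := y)))))"

end

theory Submission
  imports Defs
begin

text \<open>
  Names of functions are associates, so the operations on distributions become operations on words.
  If \<open>p\<close> names \<open>F\<close> and \<open>r\<close> names \<open>\<gamma>\<^sub>n\<close>, a name of \<open>\<gamma>\<^sub>n\<^sub>+\<^sub>1\<close> is obtained from \<open>p\<close> and \<open>r\<close> letter by letter:
  since an associate only has to determine each output letter by some prefix of the input, no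
  unbounded search is needed and every letter is a primitive recursive functional of \<open>p\<close> and \<open>r\<close>.
  Primitive recursive functionals are compiled to register programs, whose registers are the head
  positions of a Turing machine.  That the results lie in the constructed types rests on
  every member of \<open>markov_type X\<close> and \<open>prob_type X\<close> having a name, which comes down to lower
  semicontinuous functions on subspaces of the Cantor space having continuous realizers.
\<close>

section \<open>Register programs on Turing machines\<close>

text \<open>Names get nested: a name of an observable is an input of a name of a functional, which
  is consulted inside a further associate. To avoid computing moduli of continuity, the operations
  on these inputs are non-expansive: \<open>N\<close> input letters fix \<open>N\<close> output
  letters. A finite prefix may then be padded to a full word, so every inner word is coded by a
  number and only the two given names remain as oracles. Witnesses (how much of an inner word is
  used) are packed into the length of the prefix. The time \<open>n\<close> is fixed throughout;
  each \<open>n\<close> has its own machine.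

  \<open>computable_op2\<close> also demands that members are sent to members. Members of an
  exponential are all continuous functions, while the proof works on names, so the representations
  involved must be surjective. The hard case is a continuous kernel \<open>F\<close>: its values are
  functionals, topologized by a quotient, so that joint semicontinuity of \<open>F x \<psi>\<close>
  in names is not immediate. It is obtained from open sets attached to convergent sequences; the
  resulting real-valued function is then realized and curried back.\<close>

type_synonym store = "nat \<Rightarrow> nat"

datatype instr = Inc nat | Dec nat | Jz nat nat | Jf nat nat | Jb nat | Out nat

fun instr_reg :: "instr \<Rightarrow> nat" where
  "instr_reg (Inc r) = r" | "instr_reg (Dec r) = r" | "instr_reg (Jz r d) = r"
| "instr_reg (Jf r d) = r" | "instr_reg (Jb d) = 0" | "instr_reg (Out r) = r"

type_synonym aconfig = "nat \<times> store \<times> bool list"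

fun exec_instr :: "(nat \<Rightarrow> iword) \<Rightarrow> instr \<Rightarrow> aconfig \<Rightarrow> aconfig" where
  "exec_instr Q (Inc r) (pc, s, w) = (Suc pc, s(r := Suc (s r)), w)"
| "exec_instr Q (Dec r) (pc, s, w) = (Suc pc, s(r := s r - 1), w)"
| "exec_instr Q (Jz r d) (pc, s, w) = (if s r = 0 then pc + d else Suc pc, s, w)"
| "exec_instr Q (Jf r d) (pc, s, w) = (if 0 < s r \<and> Q r (s r - 1) then Suc pc else pc + d, s, w)"
| "exec_instr Q (Jb d) (pc, s, w) = (pc - d, s, w)"
| "exec_instr Q (Out r) (pc, s, w) = (Suc pc, s, w @ [s r \<noteq> 0])"

definition astep :: "instr list \<Rightarrow> (nat \<Rightarrow> iword) \<Rightarrow> aconfig \<Rightarrow> aconfig" where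
  "astep P Q c = (if fst c < length P then exec_instr Q (P ! fst c) c else c)"

text \<open>
  Registers are head positions on work tapes whose cell \<open>0\<close> carries the mark \<open>1\<close>.  Work tape
  \<open>i < k\<close> also buffers the \<open>i\<close>-th input: cell \<open>j + 1\<close> receives \<open>2\<close> or \<open>3\<close> for its \<open>j\<close>-th letter, at the
  first visit of that cell.
\<close>

fun instr_state :: "instr \<Rightarrow> nat \<Rightarrow> nat list \<Rightarrow> nat" where
  "instr_state (Jz r d) pc ws = (if ws ! r = 1 then pc + d else Suc pc)"
| "instr_state (Jf r d) pc ws = (if ws ! r = 3 then Suc pc else pc + d)"
| "instr_state (Jb d) pc ws = pc - d"
| "instr_state _ pc ws = Suc pc"

fun instr_move :: "instr \<Rightarrow> nat \<Rightarrow> nat \<Rightarrow> move" where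
  "instr_move (Inc r) i a = (if i = r then MoveRight else Stay)"
| "instr_move (Dec r) i a = (if i = r \<and> a \<noteq> 1 then MoveLeft else Stay)"
| "instr_move _ i a = Stay"

fun instr_out :: "instr \<Rightarrow> nat list \<Rightarrow> bool option" where
  "instr_out (Out r) ws = Some (ws ! r \<noteq> 1)"
| "instr_out _ ws = None"

text \<open>State \<open>0\<close> only writes the marks; state \<open>q > 0\<close> stands for
  program counter \<open>q - 1\<close>, and \<open>length P + 1\<close> for a program that has
  stopped. A blank scanned on a buffering tape means that the letter has not been fetched yet, so
  fetching takes precedence over the instruction and keeps the state.\<close>

definition asm_delta ::
    "nat \<Rightarrow> nat \<Rightarrow> instr list \<Rightarrow> nat \<Rightarrow> bool list \<Rightarrow> nat list \<Rightarrow>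
     nat \<times> bool list \<times> (nat \<times> move) list \<times> bool option" where
  "asm_delta k T P q as ws =
     (if q = 0 then (1, replicate k False, replicate T (1, Stay), None)
      else if \<exists>i<k. ws ! i = 0 then
        (q, map (\<lambda>i. ws ! i = 0) [0..<k],
         map (\<lambda>i. (if i < k \<and> ws ! i = 0 then 2 + of_bool (as ! i) else ws ! i, Stay)) [0..<T],
         None)
      else if q \<le> length P then
        (Suc (min (instr_state (P ! (q - 1)) (q - 1) ws) (length P)), replicate k False,
         map (\<lambda>i. (ws ! i, instr_move (P ! (q - 1)) i (ws ! i))) [0..<T],
         instr_out (P ! (q - 1)) ws)
      else (q, replicate k False, map (\<lambda>i. (ws ! i, Stay)) [0..<T], None))"

definition asm_machine :: "nat \<Rightarrow> nat \<Rightarrow> instr list \<Rightarrow> machine" where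
  "asm_machine k T P =
     \<lparr>num_states = length P + 2, num_symbols = 4, num_tapes = T, delta = asm_delta k T P\<rparr>"

lemma is_machine_asm:
  assumes "k \<le> T"
  shows "is_machine k (asm_machine k T P)"
  unfolding is_machine_def asm_machine_def
  using assms by (auto simp: asm_delta_def split: if_splits dest!: nth_mem)

text \<open>The input heads count the buffered letters. The last conjunct says that a buffering head
  stands at most on the first unfilled cell, so a single fetching step always catches up.\<close>

definition sim :: "iword list \<Rightarrow> nat \<Rightarrow> instr list \<Rightarrow> aconfig \<Rightarrow> config \<Rightarrow> bool" where
  "sim ps T P a c \<longleftrightarrow> (case a of (pc, s, w) \<Rightarrow>
     cur_state c = Suc (min pc (length P)) \<and> written c = w \<and>
     length (in_heads c) = length ps \<and> length (work_tapes c) = T \<and>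
     (\<forall>r<T. snd (work_tapes c ! r) = int (s r) \<and> fst (work_tapes c ! r) 0 = 1 \<and>
        (\<forall>j. fst (work_tapes c ! r) (1 + int j) =
           (if r < length ps \<and> j < in_heads c ! r then 2 + of_bool ((ps ! r) j) else 0))) \<and>
     (\<forall>r<length ps. s r \<le> Suc (in_heads c ! r)))"

lemma sim_scan:
  assumes "sim ps T P (pc, s, w) c" "r < T"
  shows "map (\<lambda>(t, h). t h) (work_tapes c) ! r =
    (if s r = 0 then 1 else if r < length ps \<and> s r \<le> in_heads c ! r
     then 2 + of_bool ((ps ! r) (s r - 1)) else 0)"
proof -
  obtain t h where th: "work_tapes c ! r = (t, h)" by force
  have *: "h = int (s r)" "t 0 = 1" "\<And>j. t (1 + int j) =
           (if r < length ps \<and> j < in_heads c ! r then 2 + of_bool ((ps ! r) j) else 0)"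
      and l: "length (work_tapes c) = T"
    using assms th by (auto simp: sim_def)
  show ?thesis
  proof (cases "s r")
    case 0
    then show ?thesis using * l th assms(2) by simp
  next
    case (Suc j)
    then show ?thesis using * l th assms(2) *(3)[of j] by simp
  qed
qed

lemma step_fields:
  assumes "delta M (cur_state c) (map2 (\<lambda>p h. p h) ps (in_heads c))
             (map (\<lambda>(t, h). t h) (work_tapes c)) = (q, adv, acts, out)"
  shows "cur_state (step M ps c) = q"
    "in_heads (step M ps c) = map2 (\<lambda>a h. if a then Suc h else h) adv (in_heads c)"
    "work_tapes (step M ps c) = map2 (\<lambda>(g, d) (t, h). (t(h := g), displace d h)) acts (work_tapes c)"
    "written (step M ps c) = written c @ (case out of None \<Rightarrow> [] | Some b \<Rightarrow> [b])"
  by (simp_all add: step_def assms)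

lemma sim_init:
  assumes "length ps \<le> T"
  shows "sim ps T P (0, \<lambda>_. 0, []) (step (asm_machine (length ps) T P) ps
           (init_config (length ps) (asm_machine (length ps) T P)))"
  using assms by (simp add: sim_def step_def init_config_def asm_machine_def asm_delta_def)

lemma sim_fill:
  assumes sim: "sim ps T P (pc, s, w) c" and T: "length ps \<le> T"
    and blank: "\<exists>i<length ps. in_heads c ! i < s i"
  defines "c' \<equiv> step (asm_machine (length ps) T P) ps c"
  shows "sim ps T P (pc, s, w) c'" "\<forall>i<length ps. s i \<le> in_heads c' ! i"
proof -
  let ?ws = "map (\<lambda>(t, h). t h) (work_tapes c)"
  let ?as = "map2 (\<lambda>p h. p h) ps (in_heads c)"
  have len: "length (in_heads c) = length ps" "length (work_tapes c) = T"
    and st: "cur_state c = Suc (min pc (length P))" and wr: "written c = w"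
    and bd: "\<And>r. r < length ps \<Longrightarrow> s r \<le> Suc (in_heads c ! r)"
    using sim by (auto simp: sim_def)
  have scan0: "?ws ! i = 0 \<longleftrightarrow> in_heads c ! i < s i" if "i < length ps" for i
    using sim_scan[OF sim, of i] that T by auto
  have as: "?as ! i = (ps ! i) (in_heads c ! i)" if "i < length ps" for i
    using that len by simp
  have "\<exists>i<length ps. ?ws ! i = 0" using blank scan0 by blast
  then have d: "delta (asm_machine (length ps) T P) (cur_state c) ?as ?ws =
    (cur_state c, map (\<lambda>i. ?ws ! i = 0) [0..<length ps],
         map (\<lambda>i. (if i < length ps \<and> ?ws ! i = 0 then 2 + of_bool (?as ! i) else ?ws ! i, Stay)) [0..<T],
         None)"
    using st by (simp add: asm_machine_def asm_delta_def)
  note f = step_fields[OF d, folded c'_def]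
  have ih: "in_heads c' ! i = (if in_heads c ! i < s i then Suc (in_heads c ! i) else in_heads c ! i)"
    if "i < length ps" for i
    using that len scan0 by (simp add: f(2))
  have lens: "length (in_heads c') = length ps" "length (work_tapes c') = T"
    using len by (simp_all add: f(2,3))
  show fin: "\<forall>i<length ps. s i \<le> in_heads c' ! i"
    using ih bd by (auto simp: Suc_le_eq)
  have wt: "snd (work_tapes c' ! r) = int (s r) \<and> fst (work_tapes c' ! r) 0 = 1 \<and>
        (\<forall>j. fst (work_tapes c' ! r) (1 + int j) =
           (if r < length ps \<and> j < in_heads c' ! r then 2 + of_bool ((ps ! r) j) else 0))" if r: "r < T" for r
  proof -
    obtain t h where th: "work_tapes c ! r = (t, h)" by force
    have *: "h = int (s r)" "t 0 = 1" "\<And>j. t (1 + int j) =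
           (if r < length ps \<and> j < in_heads c ! r then 2 + of_bool ((ps ! r) j) else 0)"
      using sim r th by (auto simp: sim_def)
    have w: "?ws ! r = t h" using th len r by simp
    have "work_tapes c' ! r = (t(h := (if r < length ps \<and> ?ws ! r = 0 then 2 + of_bool (?as ! r) else ?ws ! r)), h)"
      using r len th by (simp add: f(3))
    also have "\<dots> = (if r < length ps \<and> in_heads c ! r < s r
        then (t(h := 2 + of_bool ((ps ! r) (in_heads c ! r))), h) else (t, h))"
      using scan0[of r] as[of r] w by auto
    finally have eq: "work_tapes c' ! r = \<dots>" .
    show ?thesis
    proof (cases "r < length ps \<and> in_heads c ! r < s r")
      case True
      \<comment> \<open>The blank cell under the head is exactly the next one to be filled.\<close>
      then have "s r = Suc (in_heads c ! r)" using bd[of r] by simp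
      then show ?thesis using True eq * ih[of r] by auto
    next
      case False
      then show ?thesis using eq * ih[of r] by auto
    qed
  qed
  then show "sim ps T P (pc, s, w) c'"
    using f(1,4) lens st wr fin by (auto simp: sim_def intro: le_SucI)
qed

lemma sim_exec:
  assumes sim: "sim ps T P (pc, s, w) c" and T: "length ps \<le> T"
    and full: "\<forall>i<length ps. s i \<le> in_heads c ! i"
    and regs: "\<forall>i\<in>set P. instr_reg i < T"
    and jf: "\<forall>r d. Jf r d \<in> set P \<longrightarrow> r < length ps"
  defines "c' \<equiv> step (asm_machine (length ps) T P) ps c"
  shows "sim ps T P (astep P ((!) ps) (pc, s, w)) c'"
proof -
  let ?ws = "map (\<lambda>(t, h). t h) (work_tapes c)"
  let ?as = "map2 (\<lambda>p h. p h) ps (in_heads c)"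
  have len: "length (in_heads c) = length ps" "length (work_tapes c) = T"
    and st: "cur_state c = Suc (min pc (length P))" and wr: "written c = w"
    using sim by (auto simp: sim_def)
  have scan: "?ws ! r = (if s r = 0 then 1 else if r < length ps
     then 2 + of_bool ((ps ! r) (s r - 1)) else 0)" if "r < T" for r
    using sim_scan[OF sim that] full by auto
  have nb: "\<not> (\<exists>i<length ps. ?ws ! i = 0)"
    using scan T by auto
  have old: "snd (work_tapes c ! r) = int (s r)" "fst (work_tapes c ! r) 0 = 1"
    "fst (work_tapes c ! r) (1 + int j) =
           (if r < length ps \<and> j < in_heads c ! r then 2 + of_bool ((ps ! r) j) else 0)"
    if "r < T" for r j using sim that by (auto simp: sim_def)
  have w: "?ws ! r = fst (work_tapes c ! r) (snd (work_tapes c ! r))" if "r < T" for r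
    using that len by (simp add: case_prod_unfold)
  \<comment> \<open>Every instruction has this shape: the scanned symbols are rewritten unchanged
    and the input heads rest. Registers grow by at most one, so together with \<open>full\<close>
    the bound on buffering heads survives.\<close>
  have main: "sim ps T P (pc', s', w @ (case out of None \<Rightarrow> [] | Some b \<Rightarrow> [b])) c'"
    if d: "delta (asm_machine (length ps) T P) (cur_state c) ?as ?ws =
      (Suc (min pc' (length P)), replicate (length ps) False, map (\<lambda>i. (?ws ! i, mv i)) [0..<T], out)"
     and mv: "\<And>r. r < T \<Longrightarrow> displace (mv r) (int (s r)) = int (s' r)"
     and le: "\<And>r. s' r \<le> Suc (s r)"
    for pc' s' mv out
  proof -
    note f = step_fields[OF d, folded c'_def]
    have ih: "in_heads c' = in_heads c"
      using len by (auto simp: f(2) intro!: nth_equalityI)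
    have "work_tapes c' ! r = (fst (work_tapes c ! r), int (s' r))" if "r < T" for r
      using that len w[of r] mv[OF that] old[of r] by (simp add: f(3) case_prod_unfold)
    then show ?thesis
      using old f len le full wr ih unfolding sim_def
      by (auto simp: f intro: order_trans[OF le])
  qed
  show ?thesis
  proof (cases "pc < length P")
    case False
    have "sim ps T P (pc, s, w @ (case None of None \<Rightarrow> [] | Some b \<Rightarrow> [b])) c'"
      by (rule main[where mv = "\<lambda>_. Stay"]) (use False nb st in \<open>auto simp: asm_machine_def asm_delta_def\<close>)
    then show ?thesis using False by (simp add: astep_def)
  next
    case True
    define I where "I = P ! pc"
    have I: "instr_reg I < T" "\<And>r d. I = Jf r d \<Longrightarrow> r < length ps"
      using True regs jf nth_mem[OF True] unfolding I_def by metis+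
    have st': "cur_state c = Suc pc" using st True by simp
    have d: "delta (asm_machine (length ps) T P) (cur_state c) ?as ?ws =
      (Suc (min (instr_state I pc ?ws) (length P)), replicate (length ps) False,
       map (\<lambda>i. (?ws ! i, instr_move I i (?ws ! i))) [0..<T], instr_out I ?ws)"
      using True nb unfolding st' by (auto simp: asm_machine_def asm_delta_def I_def)
    have a: "astep P ((!) ps) (pc, s, w) = exec_instr ((!) ps) I (pc, s, w)"
      using True by (simp add: astep_def I_def)
    define s' where "s' = fst (snd (exec_instr ((!) ps) I (pc, s, w)))"
    have s': "s' r \<le> Suc (s r)" for r
      unfolding s'_def by (cases I) auto
    have mv: "displace (instr_move I r (?ws ! r)) (int (s r)) = int (s' r)" if "r < T" for r
      unfolding s'_def using scan[OF that] by (cases I) (auto simp: of_nat_diff)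
    have e: "exec_instr ((!) ps) I (pc, s, w) =
      (instr_state I pc ?ws, s', w @ (case instr_out I ?ws of None \<Rightarrow> [] | Some b \<Rightarrow> [b]))"
      unfolding s'_def using scan[OF I(1)] I(2) by (cases I) auto
    show ?thesis unfolding a e by (rule main[OF d mv s'])
  qed
qed

lemma sim_step:
  assumes sim: "sim ps T P a c" and T: "length ps \<le> T"
    and regs: "\<forall>i\<in>set P. instr_reg i < T"
    and jf: "\<forall>r d. Jf r d \<in> set P \<longrightarrow> r < length ps"
  shows "\<exists>n>0. sim ps T P (astep P ((!) ps) a) ((step (asm_machine (length ps) T P) ps ^^ n) c)"
proof -
  let ?st = "step (asm_machine (length ps) T P) ps"
  obtain pc s w where a: "a = (pc, s, w)" by (cases a)
  show ?thesis
  proof (cases "\<forall>i<length ps. s i \<le> in_heads c ! i")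
    case True
    then have "sim ps T P (astep P ((!) ps) a) ((?st ^^ 1) c)"
      using sim_exec[OF _ T _ regs jf] sim a by simp
    then show ?thesis by blast
  next
    case False
    then have b: "\<exists>i<length ps. in_heads c ! i < s i" by (auto simp: not_le)
    have "sim ps T P (astep P ((!) ps) a) ((?st ^^ 2) c)"
      using sim_exec[OF sim_fill(1)[OF sim[unfolded a] T b] T sim_fill(2)[OF sim[unfolded a] T b] regs jf] a
      by (simp add: eval_nat_numeral)
    then show ?thesis by (metis zero_less_numeral)
  qed
qed

lemma output_after_mono:
  assumes "t \<le> t'"
  shows "\<exists>w. output_after M ps t' = output_after M ps t @ w"
  using assms
proof (induction rule: dec_induct)
  case (step n)
  have "\<exists>w. written (Defs.step M ps c) = written c @ w" for c
    by (auto simp: step_def split: prod.split)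
  then have "\<exists>w. output_after M ps (Suc n) = output_after M ps n @ w"
    by (simp add: output_after_def)
  then show ?case using step.IH by auto
qed simp

text \<open>The bound \<open>m \<ge> n\<close> in \<open>out\<close> supplies arbitrarily late
  checkpoints. Every machine time precedes one of them, since a program step takes at least one
  machine step; as output only grows, whatever has been written is a prefix of
  \<open>r\<close>.\<close>

lemma asm_machine_computes:
  assumes T: "length ps \<le> T" and regs: "\<forall>i\<in>set P. instr_reg i < T"
    and jf: "\<forall>r d. Jf r d \<in> set P \<longrightarrow> r < length ps"
    and out: "\<And>n. \<exists>m\<ge>n. snd (snd ((astep P ((!) ps) ^^ m) (0, \<lambda>_. 0, []))) = map r [0..<n]"
  shows "computes (asm_machine (length ps) T P) ps r"
proof -
  let ?M = "asm_machine (length ps) T P"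
  let ?a = "\<lambda>m. (astep P ((!) ps) ^^ m) (0, \<lambda>_. 0, [])"
  have ex: "\<exists>t\<ge>m. sim ps T P (?a m) ((step ?M ps ^^ t) (init_config (length ps) ?M))" for m
  proof (induction m)
    case 0
    show ?case using sim_init[OF T, of P] by (intro exI[of _ 1]) simp
  next
    case (Suc m)
    then obtain t where t: "m \<le> t" "sim ps T P (?a m) ((step ?M ps ^^ t) (init_config (length ps) ?M))"
      by blast
    obtain n where "n > 0" "sim ps T P (astep P ((!) ps) (?a m))
        ((step ?M ps ^^ n) ((step ?M ps ^^ t) (init_config (length ps) ?M)))"
      using sim_step[OF t(2) T regs jf] by blast
    then show ?case using t(1)
      by (intro exI[of _ "n + t"]) (auto simp: funpow_add)
  qed
  have outp: "\<exists>t\<ge>m. output_after ?M ps t = snd (snd (?a m))" for m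
    using ex[of m] by (fastforce simp: sim_def output_after_def split: prod.splits)
  show ?thesis
    unfolding computes_def
  proof (intro conjI allI impI)
    fix n
    obtain m where "snd (snd (?a m)) = map r [0..<n]" using out by blast
    then show "\<exists>t. n \<le> length (output_after ?M ps t)"
      using outp[of m] by (metis le_refl length_map length_upt minus_nat.diff_0)
  next
    fix t i assume i: "i < length (output_after ?M ps t)"
    obtain m where m: "m \<ge> t" "snd (snd (?a m)) = map r [0..<t]" using out by blast
    then obtain t' where t': "t' \<ge> t" "output_after ?M ps t' = map r [0..<t]"
      using outp[of m] order_trans[OF m(1)] by auto
    obtain w where "map r [0..<t] = output_after ?M ps t @ w"
      using output_after_mono[OF t'(1)] t'(2) by metis
    with i show "output_after ?M ps t ! i = r i"
      by (metis (no_types, lifting) add_cancel_right_left diff_zero length_append length_map length_upt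
          nth_append nth_map nth_upt trans_less_add1)
  qed
qed


section \<open>Primitive recursive functionals\<close>

definition reach :: "instr list \<Rightarrow> (nat \<Rightarrow> iword) \<Rightarrow> aconfig \<Rightarrow> aconfig \<Rightarrow> bool" where
  "reach P Q a b \<longleftrightarrow> (\<exists>n. (astep P Q ^^ n) a = b)"

lemma reach_refl: "reach P Q a a"
  unfolding reach_def by (rule exI[of _ 0]) simp

lemma reach_trans: "reach P Q a b \<Longrightarrow> reach P Q b c \<Longrightarrow> reach P Q a c"
  unfolding reach_def by (metis comp_apply funpow_add)

lemma reach_step: "astep P Q a = b \<Longrightarrow> reach P Q b c \<Longrightarrow> reach P Q a c"
  by (rule reach_trans) (auto simp: reach_def intro!: exI[of _ 1])

text \<open>Jumps are relative, so code behaves alike inside any surrounding program; quantifying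
  over \<open>xs\<close> and \<open>ys\<close> is what allows concatenation and nesting.\<close>

definition runs ::
    "instr list \<Rightarrow> (nat \<Rightarrow> iword) \<Rightarrow> store \<Rightarrow> bool list \<Rightarrow> store \<Rightarrow> bool" where
  "runs c Q s w s' \<longleftrightarrow> (\<forall>xs ys v.
     reach (xs @ c @ ys) Q (length xs, s, v) (length xs + length c, s', v @ w))"

lemma runs_Nil: "runs [] Q s [] s"
  by (simp add: runs_def reach_refl)

lemma runs_append:
  assumes "runs c1 Q s w1 s1" "runs c2 Q s1 w2 s2"
  shows "runs (c1 @ c2) Q s (w1 @ w2) s2"
  unfolding runs_def
proof (intro allI)
  fix xs ys v
  have "reach (xs @ (c1 @ c2) @ ys) Q (length xs, s, v) (length xs + length c1, s1, v @ w1)"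
    using assms(1)[unfolded runs_def, rule_format, of xs "c2 @ ys" v] by simp
  moreover have "reach (xs @ (c1 @ c2) @ ys) Q (length xs + length c1, s1, v @ w1)
      (length xs + length (c1 @ c2), s2, v @ w1 @ w2)"
    using assms(2)[unfolded runs_def, rule_format, of "xs @ c1" ys "v @ w1"]
    by (simp add: add.assoc)
  ultimately show "reach (xs @ (c1 @ c2) @ ys) Q (length xs, s, v)
      (length xs + length (c1 @ c2), s2, v @ w1 @ w2)"
    by (rule reach_trans)
qed

lemma runs_silent_append:
  "runs c1 Q s [] s1 \<Longrightarrow> runs c2 Q s1 w s2 \<Longrightarrow> runs (c1 @ c2) Q s w s2"
  using runs_append[of c1 Q s "[]"] by simp

lemma runs_Inc: "runs [Inc r] Q s [] (s(r := Suc (s r)))"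
  unfolding runs_def
  by (intro allI, rule reach_step[OF _ reach_refl]) (simp add: astep_def)

lemma runs_Out: "runs [Out r] Q s [s r \<noteq> 0] s"
  unfolding runs_def
  by (intro allI, rule reach_step[OF _ reach_refl]) (simp add: astep_def)

definition loop :: "nat \<Rightarrow> instr list \<Rightarrow> instr list" where
  "loop r c = [Jz r (length c + 3), Dec r] @ c @ [Jb (length c + 2)]"

text \<open>\<open>S i\<close> is the store at the head of pass \<open>i\<close>. The counter is
  decremented before the body runs, which explains the store in the second assumption.\<close>

lemma runs_loop:
  assumes "\<And>i. i \<le> n \<Longrightarrow> S i r = n - i"
    and "\<And>i. i < n \<Longrightarrow> runs c Q ((S i)(r := n - Suc i)) [] (S (Suc i))"
  shows "runs (loop r c) Q (S 0) [] (S n)"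
  using assms
proof (induction n arbitrary: S)
  case 0
  then have "S 0 r = 0" by simp
  then show ?case
    unfolding runs_def
    by (intro allI, intro reach_step[OF _ reach_refl]) (simp add: astep_def loop_def)
next
  case (Suc n)
  have IH: "runs (loop r c) Q (S 1) [] (S (Suc n))"
    using Suc.IH[of "\<lambda>i. S (Suc i)"] Suc.prems(1)[of "Suc _"] Suc.prems(2)[of "Suc _"] by simp
  have r: "S 0 r = Suc n" using Suc.prems(1)[of 0] by simp
  have c: "runs c Q ((S 0)(r := n)) [] (S 1)" using Suc.prems(2)[OF zero_less_Suc] by (simp only: One_nat_def diff_Suc_Suc diff_zero)
  show ?case
    unfolding runs_def
  proof (intro allI)
    fix xs ys :: "instr list" and v
    let ?P = "xs @ loop r c @ ys" and ?l = "length xs"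
    have s1: "astep ?P Q (?l, S 0, v) = (Suc ?l, S 0, v)"
      using r by (simp add: astep_def loop_def)
    have s2: "astep ?P Q (Suc ?l, S 0, v) = (Suc (Suc ?l), (S 0)(r := n), v)"
      using r by (simp add: astep_def loop_def nth_append)
    have "reach ?P Q (Suc (Suc ?l), (S 0)(r := n), v) (Suc (Suc ?l) + length c, S 1, v)"
      using c[unfolded runs_def, rule_format, of "xs @ [Jz r (length c + 3), Dec r]" "[Jb (length c + 2)] @ ys" v]
      by (simp add: loop_def)
    note 1 = this
    have s3: "astep ?P Q (Suc (Suc ?l) + length c, S 1, v) = (?l, S 1, v)"
      by (simp add: astep_def loop_def nth_append)
    have "reach ?P Q (?l, S 1, v) (?l + length (loop r c), S (Suc n), v @ [])"
      using IH unfolding runs_def by blast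
    then show "reach ?P Q (?l, S 0, v) (?l + length (loop r c), S (Suc n), v @ [])"
      by (intro reach_step[OF s1] reach_step[OF s2] reach_trans[OF 1] reach_step[OF s3])
  qed
qed

lemma runs_clear: "runs (loop r []) Q s [] (s(r := 0))"
  using runs_loop[of "s r" "\<lambda>i. s(r := s r - i)" r "[]" Q] by (simp add: runs_Nil)

lemma runs_move:
  assumes "r \<noteq> t"
  shows "runs (loop r [Inc t]) Q s [] (s(r := 0, t := s t + s r))"
proof -
  let ?S = "\<lambda>i. s(r := s r - i, t := s t + i)"
  have "runs (loop r [Inc t]) Q (?S 0) [] (?S (s r))"
  proof (rule runs_loop)
    fix i assume "i < s r"
    have "((?S i)(r := s r - Suc i))(t := Suc (((?S i)(r := s r - Suc i)) t)) = ?S (Suc i)"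
      using assms by (auto simp: fun_eq_iff)
    then show "runs [Inc t] Q ((?S i)(r := s r - Suc i)) [] (?S (Suc i))"
      using runs_Inc by metis
  qed (use assms in auto)
  then show ?thesis by simp
qed

text \<open>Reading a register by counting it down destroys it; the scratch register
  \<open>u\<close> serves to restore it.\<close>

definition copy :: "nat \<Rightarrow> nat \<Rightarrow> nat \<Rightarrow> instr list" where
  "copy r t u = loop r [Inc t, Inc u] @ loop u [Inc r]"

lemma runs_copy:
  assumes "r \<noteq> t" "r \<noteq> u" "t \<noteq> u" "s t = 0" "s u = 0"
  shows "runs (copy r t u) Q s [] (s(t := s r))"
proof -
  let ?S = "\<lambda>i. s(r := s r - i, t := i, u := i)"
  have "runs (loop r [Inc t, Inc u]) Q (?S 0) [] (?S (s r))"
  proof (rule runs_loop)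
    fix i assume "i < s r"
    let ?s = "(?S i)(r := s r - Suc i)"
    have "runs ([Inc t] @ [Inc u]) Q ?s [] ((?s(t := Suc (?s t)))(u := Suc ((?s(t := Suc (?s t))) u)))"
      by (rule runs_silent_append[OF runs_Inc runs_Inc])
    moreover have "(?s(t := Suc (?s t)))(u := Suc ((?s(t := Suc (?s t))) u)) = ?S (Suc i)"
      using assms by (auto simp: fun_eq_iff)
    ultimately show "runs [Inc t, Inc u] Q ?s [] (?S (Suc i))" by simp
  qed (use assms in auto)
  moreover have "?S 0 = s" using assms by (auto simp: fun_eq_iff)
  ultimately have "runs (loop r [Inc t, Inc u]) Q s [] (?S (s r))" by simp
  from runs_silent_append[OF this runs_move[of u r]] assms
  have "runs (copy r t u) Q s [] ((?S (s r))(u := 0, r := ?S (s r) r + ?S (s r) u))"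
    by (simp add: copy_def)
  moreover have "(?S (s r))(u := 0, r := ?S (s r) r + ?S (s r) u) = s(t := s r)"
    using assms by (auto simp: fun_eq_iff)
  ultimately show ?thesis by simp
qed

definition queries_below :: "nat \<Rightarrow> instr list \<Rightarrow> bool" where
  "queries_below k c \<longleftrightarrow> (\<forall>r d. Jf r d \<in> set c \<longrightarrow> r < k)"

lemma queries_below_simps [simp]:
  "queries_below k []"
  "queries_below k (i # c) \<longleftrightarrow> (\<forall>r d. i = Jf r d \<longrightarrow> r < k) \<and> queries_below k c"
  "queries_below k (c @ c') \<longleftrightarrow> queries_below k c \<and> queries_below k c'"
  "queries_below k (loop r c) \<longleftrightarrow> queries_below k c"
  by (auto simp: queries_below_def loop_def)

text \<open>
  Instead of an inductive class of primitive recursive functionals, \<open>pr\<close> is the class of those that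
  have register code.  The registers below \<open>k\<close> are reserved for the queries, the registers \<open>\<rho> i\<close>
  hold the environment, and those above the result register \<open>d\<close> are scratch space.
\<close>

definition pr :: "nat \<Rightarrow> ((nat \<Rightarrow> iword) \<Rightarrow> (nat \<Rightarrow> nat) \<Rightarrow> nat) \<Rightarrow> bool" where
  "pr k f \<longleftrightarrow> (\<forall>\<rho> d. (\<forall>i. k \<le> \<rho> i \<and> \<rho> i < d) \<longrightarrow>
     (\<exists>c. queries_below k c \<and>
       (\<forall>Q s. (\<forall>i. i < k \<or> d \<le> i \<longrightarrow> s i = 0) \<longrightarrow>
          runs c Q s [] (s(d := f Q (\<lambda>i. s (\<rho> i)))))))"

lemma prD:
  assumes "pr k f" "\<forall>i. k \<le> \<rho> i \<and> \<rho> i < d"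
  shows "\<exists>c. queries_below k c \<and> (\<forall>Q s. (\<forall>i. i < k \<or> d \<le> i \<longrightarrow> s i = 0) \<longrightarrow>
          runs c Q s [] (s(d := f Q (\<lambda>i. s (\<rho> i)))))"
  using assms unfolding pr_def by blast

section \<open>Closure properties of \<open>pr\<close>: variables, binding, recursion and oracle
  queries\<close>

lemma pr_rename:
  assumes pr: "pr k f"
  shows "pr k (\<lambda>Q e. f Q (\<lambda>i. e (\<pi> i)))"
  unfolding pr_def
proof (intro allI impI)
  fix \<rho> :: "nat \<Rightarrow> nat" and d
  assume "\<forall>i. k \<le> \<rho> i \<and> \<rho> i < (d::nat)"
  then have "\<forall>i. k \<le> \<rho> (\<pi> i) \<and> \<rho> (\<pi> i) < d" by blast
  from prD[OF pr this]
  show "\<exists>c. queries_below k c \<and> (\<forall>Q s. (\<forall>i. i < k \<or> d \<le> i \<longrightarrow> s i = 0) \<longrightarrow>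
          runs c Q s [] (s(d := f Q (\<lambda>i. s (\<rho> (\<pi> i))))))" .
qed

lemma pr_zero: "pr k (\<lambda>Q e. 0)"
  unfolding pr_def
proof (intro allI impI exI conjI)
  fix \<rho> :: "nat \<Rightarrow> nat" and d Q and s :: store
  assume "\<forall>i. i < k \<or> d \<le> i \<longrightarrow> s i = 0"
  then have "s(d := 0) = s" by (auto simp: fun_eq_iff)
  then show "runs [] Q s [] (s(d := 0))" by (simp add: runs_Nil)
qed simp

lemma pr_var: "pr k (\<lambda>Q e. e i)"
  unfolding pr_def
proof (intro allI impI exI conjI)
  fix \<rho> :: "nat \<Rightarrow> nat" and d Q and s :: store
  assume "\<forall>i. k \<le> \<rho> i \<and> \<rho> i < d" "\<forall>i. i < k \<or> d \<le> i \<longrightarrow> s i = 0"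
  then show "runs (copy (\<rho> i) d (Suc d)) Q s [] (s(d := s (\<rho> i)))"
    by (intro runs_copy) (auto simp: less_imp_neq less_SucI)
qed (simp add: copy_def)

lemma pr_Suc:
  assumes "pr k f"
  shows "pr k (\<lambda>Q e. Suc (f Q e))"
  unfolding pr_def
proof (intro allI impI)
  fix \<rho> :: "nat \<Rightarrow> nat" and d assume \<rho>: "\<forall>i. k \<le> \<rho> i \<and> \<rho> i < (d::nat)"
  then obtain c where c: "queries_below k c"
    "\<forall>Q s. (\<forall>i. i < k \<or> d \<le> i \<longrightarrow> s i = 0) \<longrightarrow>
       runs c Q s [] (s(d := f Q (\<lambda>i. s (\<rho> i))))"
    using prD[OF assms \<rho>] by blast
  show "\<exists>c. queries_below k c \<and> (\<forall>Q s. (\<forall>i. i < k \<or> d \<le> i \<longrightarrow> s i = 0) \<longrightarrow>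
          runs c Q s [] (s(d := Suc (f Q (\<lambda>i. s (\<rho> i))))))"
  proof (intro exI[of _ "c @ [Inc d]"] conjI allI impI)
    fix Q and s :: store assume "\<forall>i. i < k \<or> d \<le> i \<longrightarrow> s i = 0"
    then have "runs c Q s [] (s(d := f Q (\<lambda>i. s (\<rho> i))))" using c(2) by blast
    from runs_silent_append[OF this runs_Inc[of d]]
    show "runs (c @ [Inc d]) Q s [] (s(d := Suc (f Q (\<lambda>i. s (\<rho> i)))))" by simp
  qed (use c(1) in simp)
qed

text \<open>The value of \<open>g\<close> is left in \<open>d\<close>, which becomes variable
  \<open>0\<close> for \<open>f\<close>; its result, in \<open>Suc d\<close>, is finally moved down
  to \<open>d\<close>.\<close>

lemma pr_let:
  assumes "pr k g" "pr k f"
  shows "pr k (\<lambda>Q e. f Q (case_nat (g Q e) e))"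
  unfolding pr_def
proof (intro allI impI)
  fix \<rho> :: "nat \<Rightarrow> nat" and d assume \<rho>: "\<forall>i. k \<le> \<rho> i \<and> \<rho> i < (d::nat)"
  then have "k < d" by (meson le_less_trans)
  obtain c where c: "queries_below k c"
    "\<forall>Q s. (\<forall>i. i < k \<or> d \<le> i \<longrightarrow> s i = 0) \<longrightarrow>
       runs c Q s [] (s(d := g Q (\<lambda>i. s (\<rho> i))))"
    using prD[OF assms(1) \<rho>] by blast
  have \<rho>1: "\<forall>i. k \<le> case_nat d \<rho> i \<and> case_nat d \<rho> i < Suc d"
    using \<rho> \<open>k < d\<close> by (simp add: less_SucI split: nat.split)
  obtain c' where c': "queries_below k c'"
    "\<forall>Q s. (\<forall>i. i < k \<or> Suc d \<le> i \<longrightarrow> s i = 0) \<longrightarrow>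
       runs c' Q s [] (s(Suc d := f Q (\<lambda>i. s (case_nat d \<rho> i))))"
    using prD[OF assms(2), of "case_nat d \<rho>" "Suc d"] \<rho>1 by blast
  show "\<exists>c. queries_below k c \<and> (\<forall>Q s. (\<forall>i. i < k \<or> d \<le> i \<longrightarrow> s i = 0) \<longrightarrow>
          runs c Q s [] (s(d := f Q (case_nat (g Q (\<lambda>i. s (\<rho> i))) (\<lambda>i. s (\<rho> i))))))"
  proof (intro exI[of _ "c @ c' @ loop d [] @ loop (Suc d) [Inc d]"] conjI allI impI)
    fix Q and s :: store assume s: "\<forall>i. i < k \<or> d \<le> i \<longrightarrow> s i = 0"
    define s1 where "s1 = s(d := g Q (\<lambda>i. s (\<rho> i)))"
    define v where "v = f Q (case_nat (g Q (\<lambda>i. s (\<rho> i))) (\<lambda>i. s (\<rho> i)))"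
    have "(\<lambda>i. s1 (case_nat d \<rho> i)) = case_nat (g Q (\<lambda>i. s (\<rho> i))) (\<lambda>i. s (\<rho> i))"
      using \<rho> by (auto simp: s1_def fun_eq_iff less_imp_neq split: nat.split)
    moreover have "\<forall>i. i < k \<or> Suc d \<le> i \<longrightarrow> s1 i = 0"
      using s \<open>k < d\<close> by (simp add: s1_def)
    from c'(2)[THEN spec, THEN spec, THEN mp, OF this, of Q]
    have "runs c' Q s1 [] (s1(Suc d := f Q (\<lambda>i. s1 (case_nat d \<rho> i))))" .
    ultimately have r2: "runs c' Q s1 [] (s1(Suc d := v))"
      by (simp only: v_def)
    have r1: "runs c Q s [] s1" using c(2) s unfolding s1_def by blast
    have "(s1(Suc d := v, d := 0))(Suc d := 0, d := (s1(Suc d := v, d := 0)) d + (s1(Suc d := v, d := 0)) (Suc d))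
        = s(d := v)"
      using s by (auto simp: s1_def fun_eq_iff)
    then have r3: "runs (loop (Suc d) [Inc d]) Q (s1(Suc d := v, d := 0)) [] (s(d := v))"
      using runs_move[of "Suc d" d Q "s1(Suc d := v, d := 0)"] by simp
    show "runs (c @ c' @ loop d [] @ loop (Suc d) [Inc d]) Q s [] (s(d := v))"
      by (intro runs_silent_append[OF r1] runs_silent_append[OF r2] runs_silent_append[OF runs_clear r3])
  qed (use c(1) c'(1) in simp)
qed

text \<open>Register \<open>d\<close> counts the remaining passes down, \<open>d+1\<close> holds the
  recursion index, \<open>d+2\<close> the accumulator and \<open>d+3\<close> the fresh value of the
  step function.\<close>

lemma pr_rec_env:
  assumes "pr k b" "pr k h" "pr k n"
  shows "pr k (\<lambda>Q e. rec_nat (b Q e) (\<lambda>i a. h Q (case_nat i (case_nat a e))) (n Q e))"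
  unfolding pr_def
proof (intro allI impI)
  fix \<rho> :: "nat \<Rightarrow> nat" and d assume \<rho>: "\<forall>i. k \<le> \<rho> i \<and> \<rho> i < (d::nat)"
  then have "k < d" by (meson le_less_trans)
  obtain cn where cn: "queries_below k cn"
    "\<forall>Q s. (\<forall>i. i < k \<or> d \<le> i \<longrightarrow> s i = 0) \<longrightarrow>
       runs cn Q s [] (s(d := n Q (\<lambda>i. s (\<rho> i))))"
    using prD[OF assms(3) \<rho>] by blast
  have \<rho>2: "\<forall>i. k \<le> \<rho> i \<and> \<rho> i < d + 2"
    using \<rho> trans_less_add1 by blast
  have \<rho>3: "\<forall>i. k \<le> case_nat (d+1) (case_nat (d+2) \<rho>) i \<and>
      case_nat (d+1) (case_nat (d+2) \<rho>) i < d + 3"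
    using \<rho> \<open>k < d\<close> by (simp add: trans_less_add1 split: nat.split)
  obtain cb where cb: "queries_below k cb"
    "\<forall>Q s. (\<forall>i. i < k \<or> d+2 \<le> i \<longrightarrow> s i = 0) \<longrightarrow>
       runs cb Q s [] (s(d+2 := b Q (\<lambda>i. s (\<rho> i))))"
    using prD[OF assms(1) \<rho>2] by blast
  obtain ch where ch: "queries_below k ch"
    "\<forall>Q s. (\<forall>i. i < k \<or> d+3 \<le> i \<longrightarrow> s i = 0) \<longrightarrow>
       runs ch Q s [] (s(d+3 := h Q (\<lambda>i. s (case_nat (d+1) (case_nat (d+2) \<rho>) i))))"
    using prD[OF assms(2) \<rho>3] by blast
  define body where "body = ch @ loop (d+2) [] @ loop (d+3) [Inc (d+2)] @ [Inc (d+1)]"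
  show "\<exists>c. queries_below k c \<and> (\<forall>Q s. (\<forall>i. i < k \<or> d \<le> i \<longrightarrow> s i = 0) \<longrightarrow>
          runs c Q s [] (s(d := rec_nat (b Q (\<lambda>i. s (\<rho> i)))
             (\<lambda>i a. h Q (case_nat i (case_nat a (\<lambda>i. s (\<rho> i))))) (n Q (\<lambda>i. s (\<rho> i))))))"
  proof (intro exI[of _ "cn @ cb @ loop d body @ loop (d+1) [] @ loop (d+2) [Inc d]"] conjI allI impI)
    fix Q and s :: store assume s: "\<forall>i. i < k \<or> d \<le> i \<longrightarrow> s i = 0"
    define e where "e = (\<lambda>i. s (\<rho> i))"
    define N where "N = n Q e"
    define R where "R = rec_nat (b Q e) (\<lambda>i a. h Q (case_nat i (case_nat a e)))"
    define S where "S = (\<lambda>j. s(d := N - j, d+1 := j, d+2 := R j))"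
    have e: "(\<lambda>i. s' (\<rho> i)) = e" if "\<And>i. i < d \<Longrightarrow> s' i = s i" for s'
      using \<rho> that by (simp add: e_def)
    have ne: "\<rho> i \<noteq> d + m" for i m
      using \<rho> by (metis not_add_less1)
    have r1: "runs cn Q s [] (s(d := N))"
      using cn(2) s unfolding N_def e_def by blast
    have S0: "(s(d := N))(d+2 := b Q e) = S 0"
      using s by (auto simp: S_def R_def fun_eq_iff)
    have "\<forall>i. i < k \<or> d + 2 \<le> i \<longrightarrow> (s(d := N)) i = 0"
      using s \<open>k < d\<close> by simp
    from cb(2)[THEN spec, THEN spec, THEN mp, OF this, of Q] e[of "s(d := N)"]
    have r2: "runs cb Q (s(d := N)) [] (S 0)"
      by (simp only: S0 fun_upd_other less_irrefl_nat refl simp_thms)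
    have r3: "runs (loop d body) Q (S 0) [] (S N)"
    proof (rule runs_loop)
      fix j assume "j < N"
      let ?s = "(S j)(d := N - Suc j)"
      have "(\<lambda>i. ?s (case_nat (d+1) (case_nat (d+2) \<rho>) i)) = case_nat j (case_nat (R j) e)"
        using ne[of _ 0] ne[of _ 1] ne[of _ 2] by (auto simp: S_def fun_eq_iff e_def split: nat.split)
      moreover have "\<forall>i. i < k \<or> d + 3 \<le> i \<longrightarrow> ?s i = 0"
        using s \<open>k < d\<close> by (simp add: S_def)
      from ch(2)[THEN spec, THEN spec, THEN mp, OF this, of Q]
      have "runs ch Q ?s [] (?s(d+3 := h Q (\<lambda>i. ?s (case_nat (d+1) (case_nat (d+2) \<rho>) i))))" .
      moreover have "R (Suc j) = h Q (case_nat j (case_nat (R j) e))"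
        by (simp add: R_def)
      ultimately have 1: "runs ch Q ?s [] (?s(d+3 := R (Suc j)))"
        by (simp only:)
      let ?t = "(?s(d+3 := R (Suc j)))(d+2 := 0)"
      let ?u = "?t(d+3 := 0, d+2 := ?t (d+2) + ?t (d+3))"
      have 2: "runs (loop (d+3) [Inc (d+2)]) Q ?t [] ?u"
        by (rule runs_move) simp
      have 3: "runs [Inc (d+1)] Q ?u [] (?u(d+1 := Suc (?u (d+1))))" by (rule runs_Inc)
      have "?u(d+1 := Suc (?u (d+1))) = S (Suc j)"
        using s by (auto simp: S_def fun_eq_iff)
      with 3 have 3: "runs [Inc (d+1)] Q ?u [] (S (Suc j))" by simp
      show "runs body Q ?s [] (S (Suc j))"
        unfolding body_def
        by (intro runs_silent_append[OF 1] runs_silent_append[OF runs_clear] runs_silent_append[OF 2] 3)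
    qed (simp add: S_def)
    let ?t = "(S N)(d+1 := 0)"
    have 4: "runs (loop (d+2) [Inc d]) Q ?t [] (?t(d+2 := 0, d := ?t d + ?t (d+2)))"
      by (rule runs_move) simp
    have "?t(d+2 := 0, d := ?t d + ?t (d+2)) = s(d := R N)"
      using s by (auto simp: S_def fun_eq_iff)
    with 4 have 4: "runs (loop (d+2) [Inc d]) Q ?t [] (s(d := R N))" by simp
    show "runs (cn @ cb @ loop d body @ loop (d+1) [] @ loop (d+2) [Inc d]) Q s []
       (s(d := rec_nat (b Q (\<lambda>i. s (\<rho> i)))
             (\<lambda>i a. h Q (case_nat i (case_nat a (\<lambda>i. s (\<rho> i))))) (n Q (\<lambda>i. s (\<rho> i)))))"
      unfolding e_def[symmetric] N_def[symmetric] R_def[symmetric]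
      by (intro runs_silent_append[OF r1] runs_silent_append[OF r2] runs_silent_append[OF r3]
            runs_silent_append[OF runs_clear 4])
  qed (use cn(1) cb(1) ch(1) in \<open>simp add: body_def\<close>)
qed

text \<open>The argument is moved to the head position on the buffering tape. Letter
  \<open>j\<close> sits in cell \<open>j + 1\<close>, hence the additional \<open>Inc r\<close>; the
  last loop clears the query register again, as \<open>pr\<close> requires.\<close>

lemma pr_query:
  assumes "pr k f" "r < k"
  shows "pr k (\<lambda>Q e. of_bool (Q r (f Q e)))"
  unfolding pr_def
proof (intro allI impI)
  fix \<rho> :: "nat \<Rightarrow> nat" and d assume \<rho>: "\<forall>i. k \<le> \<rho> i \<and> \<rho> i < (d::nat)"
  then have "k < d" by (meson le_less_trans)
  obtain c where c: "queries_below k c"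
    "\<forall>Q s. (\<forall>i. i < k \<or> d \<le> i \<longrightarrow> s i = 0) \<longrightarrow>
       runs c Q s [] (s(d := f Q (\<lambda>i. s (\<rho> i))))"
    using prD[OF assms(1) \<rho>] by blast
  show "\<exists>c. queries_below k c \<and> (\<forall>Q s. (\<forall>i. i < k \<or> d \<le> i \<longrightarrow> s i = 0) \<longrightarrow>
          runs c Q s [] (s(d := of_bool (Q r (f Q (\<lambda>i. s (\<rho> i)))))))"
  proof (intro exI[of _ "c @ loop d [Inc r] @ [Inc r] @ [Jf r 2, Inc d] @ loop r []"] conjI allI impI)
    fix Q and s :: store assume s: "\<forall>i. i < k \<or> d \<le> i \<longrightarrow> s i = 0"
    define v where "v = f Q (\<lambda>i. s (\<rho> i))"
    have r1: "runs c Q s [] (s(d := v))" using c(2) s unfolding v_def by blast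
    have "runs (loop d [Inc r]) Q (s(d := v)) [] ((s(d := v))(d := 0, r := (s(d := v)) r + (s(d := v)) d))"
      by (rule runs_move) (use assms \<open>k < d\<close> in auto)
    moreover have "(s(d := v))(d := 0, r := (s(d := v)) r + (s(d := v)) d) = s(r := v)"
      using s assms \<open>k < d\<close> by (auto simp: fun_eq_iff)
    ultimately have r2: "runs (loop d [Inc r]) Q (s(d := v)) [] (s(r := v))" by simp
    have r3: "runs [Inc r] Q (s(r := v)) [] (s(r := Suc v))"
      using runs_Inc[of r Q "s(r := v)"] by simp
    let ?t = "s(r := Suc v, d := of_bool (Q r v))"
    have r4: "runs [Jf r 2, Inc d] Q (s(r := Suc v)) [] ?t"
      unfolding runs_def
    proof (intro allI)
      fix xs ys :: "instr list" and w
      have z: "s d = 0" "d \<noteq> r" using s assms \<open>k < d\<close> by auto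
      show "reach (xs @ [Jf r 2, Inc d] @ ys) Q (length xs, s(r := Suc v), w)
          (length xs + length [Jf r 2, Inc d], ?t, w @ [])"
      proof (cases "Q r v")
        case True
        show ?thesis
          by (rule reach_step[OF refl], rule reach_step[OF _ reach_refl])
            (use True z in \<open>simp add: astep_def nth_append\<close>)
      next
        case False
        have "s(r := Suc v) = ?t" using z False by (auto simp: fun_eq_iff)
        then show ?thesis
          by (intro reach_step[OF _ reach_refl]) (use False in \<open>simp add: astep_def\<close>)
      qed
    qed
    have r5: "runs (loop r []) Q ?t [] (s(d := of_bool (Q r v)))"
    proof -
      have "?t(r := 0) = s(d := of_bool (Q r v))"
        using s assms \<open>k < d\<close> by (auto simp: fun_eq_iff)
      then show ?thesis using runs_clear[of r Q ?t] by simp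
    qed
    show "runs (c @ loop d [Inc r] @ [Inc r] @ [Jf r 2, Inc d] @ loop r []) Q s []
            (s(d := of_bool (Q r (f Q (\<lambda>i. s (\<rho> i))))))"
      unfolding v_def[symmetric]
      by (intro runs_silent_append[OF r1] runs_silent_append[OF r2] runs_silent_append[OF r3]
            runs_silent_append[OF r4] r5)
  qed (use c(1) assms(2) in simp)
qed

text \<open>All variables are placed in register \<open>k\<close>, which counts the letters already
  written, so \<open>e 0\<close> is the index of the next one.\<close>

theorem pr_machine:
  assumes "pr k (\<lambda>Q e. of_bool (f Q (e 0)))"
  shows "\<exists>M. is_machine k M \<and> (\<forall>ps. length ps = k \<longrightarrow> computes M ps (f ((!) ps)))"
proof -
  obtain c where c: "queries_below k c"
    "\<forall>Q s. (\<forall>i. i < k \<or> Suc k \<le> i \<longrightarrow> s i = 0) \<longrightarrow>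
       runs c Q s [] (s(Suc k := of_bool (f Q (s k))))"
    using prD[OF assms, of "\<lambda>_. k" "Suc k"] by auto
  define B where "B = c @ [Out (Suc k)] @ loop (Suc k) [] @ [Inc k]"
  define P where "P = B @ [Jb (length B)]"
  define T where "T = k + Suc (Max (insert 0 (instr_reg ` set P)))"
  have T: "\<forall>i\<in>set P. instr_reg i < T"
    unfolding T_def by (auto simp: less_Suc_eq_le trans_le_add2)
  have jf: "\<forall>r d. Jf r d \<in> set P \<longrightarrow> r < k"
  proof -
    have "queries_below k P" using c(1) by (simp add: P_def B_def)
    then show ?thesis by (simp add: queries_below_def)
  qed
  have "computes (asm_machine k T P) ps (f ((!) ps))" if ps: "length ps = k" for ps
  proof -
    let ?Q = "(!) ps" and ?S = "\<lambda>i. (\<lambda>_. 0)(k := i) :: store"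
    have "runs B ?Q (?S i) [f ?Q i] (?S (Suc i))" for i
    proof -
      have 1: "runs c ?Q (?S i) [] ((?S i)(Suc k := of_bool (f ?Q i)))" (is "runs _ _ _ _ ?t")
      proof -
        have "\<forall>j. j < k \<or> Suc k \<le> j \<longrightarrow> ?S i j = 0" by simp
        from c(2)[THEN spec[of _ ?Q], THEN spec[of _ "?S i"], THEN mp, OF this] show ?thesis by simp
      qed
      have 2: "runs [Out (Suc k)] ?Q ?t [f ?Q i] ?t"
        using runs_Out[of "Suc k" ?Q ?t] by simp
      have "?t(Suc k := 0) = ?S i" by (auto simp: fun_eq_iff)
      then have 3: "runs (loop (Suc k) []) ?Q ?t [] (?S i)" using runs_clear[of "Suc k" ?Q ?t] by simp
      have 4: "runs [Inc k] ?Q (?S i) [] (?S (Suc i))" using runs_Inc[of k ?Q "?S i"] by simp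
      show ?thesis unfolding B_def
        using runs_silent_append[OF 1 runs_append[OF 2 runs_append[OF 3 4]]] by simp
    qed
    then have B: "reach P ?Q (0, ?S i, w) (length B, ?S (Suc i), w @ [f ?Q i])" for i w
      unfolding runs_def P_def by (metis add_0 append_Nil list.size(3))
    have J: "astep P ?Q (length B, s, w) = (0, s, w)" for s w
      by (simp add: astep_def P_def)
    have "\<exists>m\<ge>n. (astep P ?Q ^^ m) (0, \<lambda>_. 0, []) = (0, ?S n, map (f ?Q) [0..<n])" for n
    proof (induction n)
      case 0
      show ?case by (intro exI[of _ 0]) (simp add: fun_eq_iff)
    next
      case (Suc n)
      then obtain m where m: "m \<ge> n" "(astep P ?Q ^^ m) (0, \<lambda>_. 0, []) = (0, ?S n, map (f ?Q) [0..<n])"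
        by blast
      obtain l where l: "(astep P ?Q ^^ l) (0, ?S n, map (f ?Q) [0..<n]) =
          (length B, ?S (Suc n), map (f ?Q) [0..<n] @ [f ?Q n])"
        using B unfolding reach_def by blast
      have "(astep P ?Q ^^ (Suc (l + m))) (0, \<lambda>_. 0, []) = (0, ?S (Suc n), map (f ?Q) [0..<Suc n])"
        using m(2) l J by (simp add: funpow_add)
      moreover have "Suc n \<le> Suc (l + m)" using m(1) by simp
      ultimately show ?case by blast
    qed
    then have "\<exists>m\<ge>n. snd (snd ((astep P ?Q ^^ m) (0, \<lambda>_. 0, []))) = map (f ?Q) [0..<n]" for n
      by (metis snd_conv)
    then show ?thesis
      using asm_machine_computes[of ps T P] T jf ps by (simp add: T_def)
  qed
  moreover have "is_machine k (asm_machine k T P)" by (rule is_machine_asm) (simp add: T_def)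
  ultimately show ?thesis by blast
qed

text \<open>Variants of binding and recursion with curried functionals, a form that unification can
  match when closure rules are chained.\<close>

lemma pr_bind:
  assumes "pr k (\<lambda>Q e. h Q (\<lambda>i. e (Suc i)) (e 0))" "pr k f"
  shows "pr k (\<lambda>Q e. h Q e (f Q e))"
  using pr_let[OF assms(2,1)] by simp

lemma pr_rec:
  assumes "pr k b" "pr k (\<lambda>Q e. g Q (\<lambda>i. e (Suc (Suc i))) (e 0) (e (Suc 0)))" "pr k n"
  shows "pr k (\<lambda>Q e. rec_nat (b Q e) (g Q e) (n Q e))"
  using pr_rec_env[OF assms(1,2,3)] by simp

section \<open>Arithmetic and Cantor pairing\<close>

lemma pr_const: "pr k (\<lambda>Q e. c)"
  by (induction c) (auto intro: pr_zero pr_Suc)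

lemma pr_add:
  assumes "pr k f" "pr k g"
  shows "pr k (\<lambda>Q e. f Q e + g Q e)"
proof -
  have "x + y = rec_nat x (\<lambda>_. Suc) y" for x y by (induction y) auto
  then show ?thesis by (simp only:) (intro pr_rec pr_Suc pr_var assms)
qed

lemma pr_mult:
  assumes "pr k f" "pr k g"
  shows "pr k (\<lambda>Q e. f Q e * g Q e)"
proof -
  have "x * y = rec_nat 0 (\<lambda>_ a. a + x) y" for x y :: nat by (induction y) auto
  then show ?thesis by (simp only:) (intro pr_rec pr_add pr_rename[OF assms(1)] pr_zero pr_var assms)
qed

lemma pr_diff:
  assumes "pr k f" "pr k g"
  shows "pr k (\<lambda>Q e. f Q e - g Q e)"
proof -
  have pred: "rec_nat 0 (\<lambda>i _. i) a = a - 1" for a :: nat by (cases a) auto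
  have "x - y = rec_nat x (\<lambda>_. rec_nat 0 (\<lambda>i _. i)) y" for x y :: nat
    by (induction y) (auto simp: pred)
  then show ?thesis by (simp only:) (intro pr_rec pr_zero pr_var assms)
qed

lemma pr_le:
  assumes "pr k f" "pr k g"
  shows "pr k (\<lambda>Q e. of_bool (f Q e \<le> g Q e))"
proof -
  have "of_bool (x \<le> y) = 1 - (x - y)" for x y :: nat by auto
  then show ?thesis by (simp only:) (intro pr_diff pr_const assms)
qed

lemma pr_less:
  assumes "pr k f" "pr k g"
  shows "pr k (\<lambda>Q e. of_bool (f Q e < g Q e))"
  unfolding less_eq_Suc_le by (intro pr_le pr_Suc assms)

lemma pr_conj:
  assumes "pr k (\<lambda>Q e. of_bool (A Q e))" "pr k (\<lambda>Q e. of_bool (B Q e))"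
  shows "pr k (\<lambda>Q e. of_bool (A Q e \<and> B Q e))"
  unfolding of_bool_conj by (intro pr_mult assms)

lemma pr_eq:
  assumes "pr k f" "pr k g"
  shows "pr k (\<lambda>Q e. of_bool (f Q e = g Q e))"
  unfolding eq_iff by (intro pr_conj pr_le assms)

lemma pr_not:
  assumes "pr k (\<lambda>Q e. of_bool (A Q e))"
  shows "pr k (\<lambda>Q e. of_bool (\<not> A Q e))"
proof -
  have "of_bool (\<not> A) = 1 - (of_bool A :: nat)" for A by auto
  then show ?thesis by (simp only:) (intro pr_diff pr_const assms)
qed

lemma pr_if:
  assumes "pr k (\<lambda>Q e. of_bool (A Q e))" "pr k f" "pr k g"
  shows "pr k (\<lambda>Q e. if A Q e then f Q e else g Q e)"
proof -
  have "(if A then x else y) = of_bool A * x + of_bool (\<not> A) * y" for A and x y :: nat by auto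
  then show ?thesis by (simp only:) (intro pr_add pr_mult pr_not assms)
qed

lemma pr_triangle:
  assumes "pr k f"
  shows "pr k (\<lambda>Q e. triangle (f Q e))"
proof -
  have "triangle x = rec_nat 0 (\<lambda>i a. a + Suc i) x" for x by (induction x) auto
  then show ?thesis by (simp only:) (intro pr_rec pr_add pr_Suc pr_var pr_zero assms)
qed

lemma pr_prod_encode:
  assumes "pr k f" "pr k g"
  shows "pr k (\<lambda>Q e. prod_encode (f Q e, g Q e))"
  unfolding prod_encode_def by simp (intro pr_add pr_triangle assms)

text \<open>The diagonal on which \<open>n\<close> lies in the Cantor enumeration. Recursion
  replaces a search: the value advances exactly when the next triangular number is reached.\<close>

definition triangle_root :: "nat \<Rightarrow> nat" where
  "triangle_root n = rec_nat 0 (\<lambda>i a. if Suc i = triangle (Suc a) then Suc a else a) n"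

lemma triangle_root:
  "triangle (triangle_root n) \<le> n \<and> n < triangle (Suc (triangle_root n))"
  by (induction n) (auto simp: triangle_root_def)

lemma prod_decode_triangle_root:
  "prod_decode n =
     (n - triangle (triangle_root n), triangle_root n - (n - triangle (triangle_root n)))"
proof -
  let ?t = "triangle_root n" and ?x = "n - triangle (triangle_root n)"
  have "triangle ?t \<le> n" "?x \<le> ?t" using triangle_root[of n] by auto
  then have "prod_encode (?x, ?t - ?x) = n" by (simp add: prod_encode_def)
  then show ?thesis by (metis prod_encode_inverse)
qed

lemma pr_triangle_root:
  assumes "pr k f"
  shows "pr k (\<lambda>Q e. triangle_root (f Q e))"
  unfolding triangle_root_def
  by (intro pr_rec pr_if pr_eq pr_Suc pr_triangle pr_var pr_zero assms)

lemma pr_prod_decode: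
  assumes "pr k f"
  shows "pr k (\<lambda>Q e. fst (prod_decode (f Q e)))" "pr k (\<lambda>Q e. snd (prod_decode (f Q e)))"
  unfolding prod_decode_triangle_root fst_conv snd_conv
  by (intro pr_diff pr_triangle pr_triangle_root assms)+

lemma fst_prod_decode_le: "fst (prod_decode n) \<le> n"
  by (metis le_prod_encode_1 prod.collapse prod_decode_inverse)

lemma snd_prod_decode_le: "snd (prod_decode n) \<le> n"
  by (metis le_prod_encode_2 prod.collapse prod_decode_inverse)

lemma pr_div:
  assumes "pr k f"
  shows "pr k (\<lambda>Q e. f Q e div Suc m)"
proof -
  \<comment> \<open>The quotient is a counter that advances at each new multiple of
    \<open>Suc m\<close>.\<close>
  have "x div Suc m = rec_nat 0 (\<lambda>i a. if Suc i = Suc m * Suc a then Suc a else a) x" for x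
  proof (induction x)
    case (Suc x)
    have "Suc x div Suc m = (if Suc x = Suc m * Suc (x div Suc m) then Suc (x div Suc m) else x div Suc m)"
      by (metis div_Suc mod_0_imp_dvd dvd_mult_div_cancel dvd_imp_mod_0 dvd_triv_left)
    then show ?case by (simp only: nat.rec Suc)
  qed simp
  then show ?thesis by (simp only:) (intro pr_rec pr_if pr_eq pr_mult pr_Suc pr_const pr_var assms)
qed

lemma pr_mod:
  assumes "pr k f"
  shows "pr k (\<lambda>Q e. f Q e mod Suc m)"
  unfolding modulo_nat_def by (intro pr_diff pr_mult pr_div pr_const assms)

section \<open>List codes, and finite words coded by numbers\<close>

definition consc :: "nat \<Rightarrow> nat \<Rightarrow> nat" where "consc x c = Suc (prod_encode (x, c))"
definition hdc :: "nat \<Rightarrow> nat" where "hdc c = fst (prod_decode (c - 1))"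
definition tlc :: "nat \<Rightarrow> nat" where "tlc c = snd (prod_decode (c - 1))"
definition lenc :: "nat \<Rightarrow> nat" where "lenc c = length (list_decode c)"

text \<open>Beyond the end of the list the code is \<open>0\<close>, whose head is \<open>0\<close>,
  so the finite word is padded with \<open>False\<close>.\<close>

definition wordc :: "nat \<Rightarrow> iword" where
  "wordc c i \<longleftrightarrow> hdc ((tlc ^^ i) c) = 1"

definition prefixc :: "iword \<Rightarrow> nat \<Rightarrow> nat" where
  "prefixc w n = list_encode (map (\<lambda>i. of_bool (w i)) [0..<n])"

lemma prod_decode_0: "prod_decode 0 = (0, 0)"
  using prod_decode_aux.simps[of 0 0] by (simp add: prod_decode_def)

lemma consc_list_encode: "consc x (list_encode xs) = list_encode (x # xs)"
  by (simp add: consc_def)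

lemma hdc_list_encode: "hdc (list_encode (x # xs)) = x"
  by (simp add: hdc_def)

lemma tlc_list_encode: "tlc (list_encode xs) = list_encode (tl xs)"
  by (cases xs) (simp_all add: tlc_def prod_decode_0)

lemma tlc_funpow_list_encode: "(tlc ^^ i) (list_encode xs) = list_encode (drop i xs)"
  by (induction i) (simp_all add: tlc_list_encode tl_drop drop_Suc)

lemma lenc_list_encode: "lenc (list_encode xs) = length xs"
  by (simp add: lenc_def)

lemma length_le_list_encode: "length xs \<le> list_encode xs"
  by (induction xs) (auto intro: order_trans[OF _ le_prod_encode_2])

lemma lenc_le: "lenc c \<le> c"
  using length_le_list_encode[of "list_decode c"] by (simp add: lenc_def)

lemma tlc_le: "tlc c \<le> c"
  using snd_prod_decode_le[of "c - 1"] by (simp add: tlc_def)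

text \<open>The code of a list is at least its length, so \<open>c\<close> itself bounds the number
  of tails to inspect; only the empty list has code \<open>0\<close>.\<close>

lemma lenc_eq_rec: "lenc c = rec_nat 0 (\<lambda>i a. a + of_bool ((tlc ^^ i) c \<noteq> 0)) c"
proof -
  define xs where "xs = list_decode c"
  have c: "c = list_encode xs" by (simp add: xs_def)
  have "list_encode ys = 0 \<longleftrightarrow> ys = []" for ys by (cases ys) auto
  then have "rec_nat 0 (\<lambda>i a. a + of_bool ((tlc ^^ i) c \<noteq> 0)) n = min n (length xs)" for n
    unfolding c tlc_funpow_list_encode by (induction n) auto
  then show ?thesis
    using length_le_list_encode[of xs] by (simp add: lenc_def c)
qed

lemma wordc_list_encode: "wordc (list_encode (map of_bool u)) i \<longleftrightarrow> i < length u \<and> u ! i"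
proof -
  have "hdc (list_encode []) = 0"
    by (simp add: hdc_def prod_decode_0)
  then show ?thesis
    unfolding wordc_def tlc_funpow_list_encode
    by (cases "i < length u")
      (auto simp: drop_map hdc_list_encode Cons_nth_drop_Suc[symmetric] simp del: list_encode.simps)
qed

text \<open>\<open>consc\<close> adds at the front, so the prefix is assembled from its last letter
  backwards.\<close>

lemma prefixc_eq_rec:
  "prefixc w n = rec_nat 0 (\<lambda>i a. consc (of_bool (w (n - Suc i))) a) n"
proof -
  have "rec_nat 0 (\<lambda>i a. consc (of_bool (w (n - Suc i))) a) m =
      list_encode (map (\<lambda>i. of_bool (w i)) [n - m..<n])" if "m \<le> n" for m
    using that
  proof (induction m)
    case (Suc m)
    have "[n - Suc m..<n] = (n - Suc m) # [n - m..<n]"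
      using Suc.prems by (simp add: upt_conv_Cons Suc_diff_Suc)
    then show ?case using Suc by (simp add: consc_def)
  qed simp
  from this[of n] show ?thesis by (simp add: prefixc_def)
qed

lemma pr_consc:
  assumes "pr k f" "pr k g"
  shows "pr k (\<lambda>Q e. consc (f Q e) (g Q e))"
  unfolding consc_def by (intro pr_Suc pr_prod_encode assms)

lemma pr_hdc: "pr k f \<Longrightarrow> pr k (\<lambda>Q e. hdc (f Q e))"
  unfolding hdc_def by (intro pr_prod_decode pr_diff pr_const)

lemma pr_tlc: "pr k f \<Longrightarrow> pr k (\<lambda>Q e. tlc (f Q e))"
  unfolding tlc_def by (intro pr_prod_decode pr_diff pr_const)

lemma pr_tlc_funpow:
  assumes "pr k f" "pr k n"
  shows "pr k (\<lambda>Q e. (tlc ^^ n Q e) (f Q e))"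
proof -
  have "(tlc ^^ i) c = rec_nat c (\<lambda>_ a. tlc a) i" for i c by (induction i) auto
  then show ?thesis by (simp only:) (intro pr_rec pr_tlc pr_var assms)
qed

lemma pr_lenc:
  assumes "pr k f"
  shows "pr k (\<lambda>Q e. lenc (f Q e))"
  unfolding lenc_eq_rec
  by (intro pr_rec pr_add pr_not pr_eq pr_tlc_funpow pr_rename[OF assms] pr_var pr_zero assms)

text \<open>A word-valued functional is handled by making the letter index a new variable
  \<open>0\<close> and shifting the environment.\<close>

definition word_pr :: "nat \<Rightarrow> ((nat \<Rightarrow> iword) \<Rightarrow> (nat \<Rightarrow> nat) \<Rightarrow> iword) \<Rightarrow> bool" where
  "word_pr k W \<longleftrightarrow> pr k (\<lambda>Q e. of_bool (W Q (\<lambda>i. e (Suc i)) (e 0)))"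

lemma pr_word:
  assumes "word_pr k W" "pr k f"
  shows "pr k (\<lambda>Q e. of_bool (W Q e (f Q e)))"
  using assms(1)[unfolded word_pr_def] by (rule pr_bind) (rule assms(2))

lemma word_pr_rename:
  assumes "word_pr k W"
  shows "word_pr k (\<lambda>Q e. W Q (\<lambda>i. e (\<pi> i)))"
  using pr_rename[OF assms[unfolded word_pr_def], of "case_nat 0 (\<lambda>i. Suc (\<pi> i))"]
  by (simp add: word_pr_def)

text \<open>Index and substituted argument both claim variable \<open>0\<close>; the proof is an
  exchange of the first two variables.\<close>

lemma word_pr_arg:
  assumes "word_pr k (\<lambda>Q e. E Q (\<lambda>i. e (Suc i)) (e 0))" "pr k f"
  shows "word_pr k (\<lambda>Q e. E Q e (f Q e))"
  unfolding word_pr_def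
proof (rule pr_bind[where h = "\<lambda>Q e u. of_bool (E Q (\<lambda>i. e (Suc i)) u (e 0))"])
  show "pr k (\<lambda>Q e. f Q (\<lambda>i. e (Suc i)))" by (rule pr_rename[OF assms(2)])
  show "pr k (\<lambda>Q e. of_bool (E Q (\<lambda>i. e (Suc (Suc i))) (e 0) (e (Suc 0))))"
    using pr_rename[OF assms(1)[unfolded word_pr_def], of "case_nat (Suc 0) (case_nat 0 (\<lambda>i. Suc (Suc i)))"]
    by simp
qed

lemma word_pr_query: "i < k \<Longrightarrow> word_pr k (\<lambda>Q e. Q i)"
  unfolding word_pr_def by (intro pr_query pr_var)

lemma word_pr_wordc:
  assumes "pr k f"
  shows "word_pr k (\<lambda>Q e. wordc (f Q e))"
  unfolding word_pr_def wordc_def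
  by (intro pr_eq pr_hdc pr_tlc_funpow pr_rename[OF assms] pr_var pr_const)

lemma word_pr_component:
  assumes "word_pr k W"
  shows "word_pr k (\<lambda>Q e. component m i (W Q e))"
  unfolding word_pr_def component_def
  by (intro pr_word[OF word_pr_rename[OF assms]] pr_add pr_mult pr_const pr_var)

lemma pr_prefixc:
  assumes "word_pr k W" "pr k n"
  shows "pr k (\<lambda>Q e. prefixc (W Q e) (n Q e))"
  unfolding prefixc_eq_rec
  by (intro pr_rec pr_consc pr_word[OF word_pr_rename[OF assms(1)]] pr_diff
      pr_rename[OF assms(2)] pr_Suc pr_var pr_zero assms)


section \<open>Composition of associates\<close>

definition agree :: "nat \<Rightarrow> iword \<Rightarrow> iword \<Rightarrow> bool" where
  "agree n s s' \<longleftrightarrow> (\<forall>i<n. s i = s' i)"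

text \<open>The identity is a modulus of continuity: applied to a padded prefix of length
  \<open>N\<close>, such an operator still yields \<open>N\<close> correct letters.\<close>

definition nonexpansive :: "(iword \<Rightarrow> iword) \<Rightarrow> bool" where
  "nonexpansive G \<longleftrightarrow> (\<forall>n s s'. agree n s s' \<longrightarrow> agree n (G s) (G s'))"

lemma agree_refl: "agree n s s"
  by (simp add: agree_def)

lemma agree_sym: "agree n s s' \<Longrightarrow> agree n s' s"
  by (simp add: agree_def)

lemma agree_trans: "agree n s s' \<Longrightarrow> agree n s' s'' \<Longrightarrow> agree n s s''"
  by (simp add: agree_def)

lemma agree_mono: "agree n s s' \<Longrightarrow> m \<le> n \<Longrightarrow> agree m s s'"
  by (simp add: agree_def)

lemma agree_map: "agree n s s' \<Longrightarrow> map s [0..<n] = map s' [0..<n]"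
  by (simp add: agree_def)

text \<open>
  A name of the composite of the function named by \<open>r\<close> with \<open>G\<close>.  The length \<open>N\<close> of a finite input
  is read as a pair; its first component says how much of the output of \<open>G\<close> is used.  The guard
  \<open>idx < N\<close> makes \<open>dpre\<close> non-expansive in \<open>r\<close>.
\<close>

definition dpre :: "iword \<Rightarrow> (iword \<Rightarrow> iword) \<Rightarrow> iword" where
  "dpre r G k = (let u = tlc (tlc k); N = lenc u;
       idx = consc (hdc k) (consc (hdc (tlc k)) (prefixc (G (wordc u)) (fst (prod_decode N))))
     in idx < N \<and> r idx)"

text \<open>
  A name of \<open>x \<mapsto> (p \<cdot> x\<^sub>i) \<cdot> E x\<close>, where \<open>\<cdot>\<close> is \<open>apply_name\<close> and \<open>x\<^sub>i\<close> is the \<open>i\<close>-th component of \<open>x\<close>.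
\<close>

definition bindw :: "iword \<Rightarrow> nat \<Rightarrow> nat \<Rightarrow> (iword \<Rightarrow> iword) \<Rightarrow> iword" where
  "bindw p m i E k = (let x = tlc (tlc k); N = lenc x; a = fst (prod_decode N);
       b = fst (prod_decode (snd (prod_decode N)))
     in m * b \<le> N \<and>
        p (consc (consc (hdc k) (consc (hdc (tlc k)) (prefixc (E (wordc x)) a)))
          (consc 1 (prefixc (component m i (wordc x)) b))))"

lemma consc_assoc_index:
  "consc j (consc (of_bool b) (prefixc w n)) = assoc_index j b (map w [0..<n])"
  by (simp add: prefixc_def consc_list_encode assoc_index_def del: list_encode.simps) (simp add: comp_def)

lemma assoc_index_decode:
  "hdc (assoc_index j b u) = j" "hdc (tlc (assoc_index j b u)) = of_bool b"
  "tlc (tlc (assoc_index j b u)) = list_encode (map of_bool u)"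
  by (simp_all add: assoc_index_def hdc_list_encode tlc_list_encode del: list_encode.simps)

lemma agree_wordc: "agree n (wordc (list_encode (map of_bool (map s [0..<n])))) s"
  by (simp add: agree_def wordc_list_encode del: map_map)

lemma agree_component:
  assumes "agree (m * n) s s'" "i < m"
  shows "agree n (component m i s) (component m i s')"
  unfolding agree_def component_def
proof (intro allI impI)
  fix j assume "j < n"
  then have "m * j + i < m * Suc j" "m * Suc j \<le> m * n"
    using assms(2) by (simp, intro mult_le_mono2, simp)
  then have "m * j + i < m * n" by simp
  then show "s (m * j + i) = s' (m * j + i)" using assms(1) by (simp add: agree_def)
qed

lemma dpre_assoc_index:
  assumes "nonexpansive G"
  shows "dpre r G (assoc_index j b (map s [0..<N])) \<longleftrightarrow>
    (let idx = assoc_index j b (map (G s) [0..<fst (prod_decode N)]) in idx < N \<and> r idx)"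
proof -
  let ?w = "wordc (list_encode (map of_bool (map s [0..<N])))"
  have "agree N (G ?w) (G s)"
    using assms agree_wordc unfolding nonexpansive_def by blast
  then have "map (G ?w) [0..<fst (prod_decode N)] = map (G s) [0..<fst (prod_decode N)]"
    by (intro agree_map agree_mono[OF _ fst_prod_decode_le])
  then show ?thesis
    by (simp only: dpre_def assoc_index_decode consc_assoc_index lenc_list_encode Let_def
        length_map length_upt diff_zero)
qed

text \<open>An associate may answer at any prefix length, so the existential over lengths absorbs
  both the number of letters of \<open>G s\<close> and the guard.\<close>

lemma determines_dpre:
  assumes "nonexpansive G"
  shows "determines (dpre r G) s j b \<longleftrightarrow> determines r (G s) j b"
proof
  assume "determines (dpre r G) s j b"
  then show "determines r (G s) j b"
    unfolding determines_def dpre_assoc_index[OF assms] Let_def by blast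
next
  assume "determines r (G s) j b"
  then obtain n where n: "r (assoc_index j b (map (G s) [0..<n]))" by (auto simp: determines_def)
  \<comment> \<open>The first component requests \<open>n\<close> letters of \<open>G s\<close>; the
    second lifts \<open>N\<close> above the index, as the guard demands.\<close>
  define N where "N = prod_encode (n, Suc (assoc_index j b (map (G s) [0..<n])))"
  have "assoc_index j b (map (G s) [0..<n]) < N"
    unfolding N_def using le_prod_encode_2 Suc_le_lessD by blast
  then show "determines (dpre r G) s j b"
    unfolding determines_def dpre_assoc_index[OF assms] Let_def
    using n by (intro exI[of _ N]) (simp add: N_def)
qed

lemma apply_name_dpre:
  "nonexpansive G \<Longrightarrow> apply_name (dpre r G) s = apply_name r (G s)"
  by (simp add: apply_name_def determines_dpre)

lemma apply_name_SomeD: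
  "apply_name p x = Some y \<Longrightarrow> y j = b \<longleftrightarrow> determines p x j b"
  unfolding apply_name_def by (cases b; auto split: if_splits; metis (full_types))

lemma bindw_assoc_index:
  assumes "nonexpansive E" "i < m"
  shows "bindw p m i E (assoc_index j b (map x [0..<N])) \<longleftrightarrow>
    (let a = fst (prod_decode N); c = fst (prod_decode (snd (prod_decode N)))
     in m * c \<le> N \<and> p (assoc_index (assoc_index j b (map (E x) [0..<a])) True
                            (map (component m i x) [0..<c])))"
proof -
  let ?w = "wordc (list_encode (map of_bool (map x [0..<N])))"
  have "agree N (E ?w) (E x)"
    using assms agree_wordc unfolding nonexpansive_def by blast
  then have 1: "map (E ?w) [0..<fst (prod_decode N)] = map (E x) [0..<fst (prod_decode N)]"
    by (intro agree_map agree_mono[OF _ fst_prod_decode_le])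
  have 2: "map (component m i ?w) [0..<c] = map (component m i x) [0..<c]" if "m * c \<le> N" for c
    by (intro agree_map agree_component[OF _ assms(2)] agree_mono[OF agree_wordc that])
  have 3: "consc j (consc 1 (prefixc w n)) = assoc_index j True (map w [0..<n])" for j w n
    using consc_assoc_index[of j True] by simp
  show ?thesis
    by (simp only: bindw_def assoc_index_decode consc_assoc_index lenc_list_encode Let_def
        length_map length_upt diff_zero 1 2 3 cong: conj_cong)
qed

text \<open>Letter \<open>k\<close> of \<open>y\<close> is true iff \<open>p\<close> lists
  \<open>True\<close> for it at some prefix of the component. The two existentials, over prefixes of
  \<open>E x\<close> and of the component, merge into one over \<open>N\<close>.\<close>

lemma determines_bindw:
  assumes "nonexpansive E" "i < m" "apply_name p (component m i x) = Some y"
  shows "determines (bindw p m i E) x j b \<longleftrightarrow> determines y (E x) j b"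
proof -
  have y: "y k \<longleftrightarrow> (\<exists>n. p (assoc_index k True (map (component m i x) [0..<n])))" for k
    using apply_name_SomeD[OF assms(3), of k True] by (simp add: determines_def)
  show ?thesis
  proof
    assume "determines (bindw p m i E) x j b"
    then show "determines y (E x) j b"
      unfolding determines_def bindw_assoc_index[OF assms(1,2)] Let_def y by blast
  next
    assume "determines y (E x) j b"
    then obtain a c where ac: "p (assoc_index (assoc_index j b (map (E x) [0..<a])) True
        (map (component m i x) [0..<c]))"
      unfolding determines_def y by blast
    \<comment> \<open>Reading \<open>c\<close> letters of one component takes at most
      \<open>m * c\<close> letters of \<open>x\<close>; the third entry makes the prefix that
      long.\<close>
    define N where "N = prod_encode (a, prod_encode (c, m * c))"
    have "m * c \<le> N"
      unfolding N_def using le_prod_encode_2 order_trans by blast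
    then show "determines (bindw p m i E) x j b"
      unfolding determines_def bindw_assoc_index[OF assms(1,2)] Let_def
      using ac by (intro exI[of _ N]) (simp add: N_def)
  qed
qed

lemma apply_name_bindw:
  assumes "nonexpansive E" "i < m" "apply_name p (component m i x) = Some y"
  shows "apply_name (bindw p m i E) x = apply_name y (E x)"
  by (simp add: apply_name_def determines_bindw[OF assms])

definition nonexpansive2 :: "(iword \<Rightarrow> iword \<Rightarrow> iword) \<Rightarrow> bool" where
  "nonexpansive2 J \<longleftrightarrow> (\<forall>n x x' y y'. agree n x x' \<longrightarrow> agree n y y' \<longrightarrow> agree n (J x y) (J x' y'))"

lemma lenc_tail_le: "lenc (tlc (tlc k)) \<le> k"
  by (meson lenc_le order_trans tlc_le)

text \<open>A letter \<open>k < n\<close> refers to a prefix of length at most \<open>k\<close>. The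
  guard keeps the position read in \<open>s\<close> below that length, and no more letters than that
  are taken from \<open>G\<close>.\<close>

lemma agree_dpre:
  assumes "agree n s s'" "\<And>y. agree n (G y) (G' y)"
  shows "agree n (dpre s G) (dpre s' G')"
  unfolding agree_def
proof (intro allI impI)
  fix k assume "k < n"
  let ?u = "tlc (tlc k)"
  have "fst (prod_decode (lenc ?u)) \<le> n" "lenc ?u \<le> n"
    using fst_prod_decode_le[of "lenc ?u"] lenc_tail_le[of k] \<open>k < n\<close> by auto
  then have "prefixc (G (wordc ?u)) (fst (prod_decode (lenc ?u))) =
      prefixc (G' (wordc ?u)) (fst (prod_decode (lenc ?u)))"
    using assms(2) unfolding prefixc_def agree_def by (auto intro!: arg_cong[where f = list_encode])
  then show "dpre s G k = dpre s' G' k"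
    using assms(1) \<open>lenc ?u \<le> n\<close> by (auto simp: dpre_def Let_def agree_def)
qed

text \<open>Only \<open>E\<close> varies; \<open>p\<close> is the same on both sides, so the
  position at which it is read may exceed \<open>k\<close>.\<close>

lemma agree_bindw:
  assumes "\<And>y. agree n (E y) (E' y)"
  shows "agree n (bindw p m i E) (bindw p m i E')"
  unfolding agree_def
proof (intro allI impI)
  fix k assume "k < n"
  let ?u = "tlc (tlc k)"
  have "fst (prod_decode (lenc ?u)) \<le> n"
    using fst_prod_decode_le[of "lenc ?u"] lenc_tail_le[of k] \<open>k < n\<close> by auto
  then have "prefixc (E (wordc ?u)) (fst (prod_decode (lenc ?u))) =
      prefixc (E' (wordc ?u)) (fst (prod_decode (lenc ?u)))"
    using assms unfolding prefixc_def agree_def by (auto intro!: arg_cong[where f = list_encode])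
  then show "bindw p m i E k = bindw p m i E' k"
    by (simp add: bindw_def Let_def)
qed

text \<open>
  If \<open>r\<close> names a distribution \<open>\<gamma>\<close> of \<open>x\<close>, \<open>p\<close> names a kernel \<open>F\<close> and \<open>J\<close> combines names of \<open>x\<close> and \<open>y\<close>
  into a name of \<open>e x y\<close>, this names \<open>\<psi> \<mapsto> \<gamma> (\<lambda>x. F x\<^sub>i (\<lambda>y. \<psi> (e x y)))\<close>.
\<close>

definition kernel_word ::
    "nat \<Rightarrow> nat \<Rightarrow> (iword \<Rightarrow> iword \<Rightarrow> iword) \<Rightarrow> iword \<Rightarrow> iword \<Rightarrow> iword" where
  "kernel_word m i J p r = dpre r (\<lambda>s. bindw p m i (\<lambda>x. dpre s (J x)))"

lemma nonexpansive_kernel_arg: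
  assumes "nonexpansive2 J"
  shows "nonexpansive (J x)" "nonexpansive (\<lambda>x. dpre s (J x))"
    "nonexpansive (\<lambda>s. bindw p m i (\<lambda>x. dpre s (J x)))"
  using assms unfolding nonexpansive_def nonexpansive2_def
  by (blast intro: agree_refl agree_dpre agree_bindw)+

text \<open>Appends to a name \<open>x\<close> of an \<open>m\<close>-tuple a name \<open>y\<close>
  of a further entry: the period grows from \<open>m\<close> to \<open>Suc m\<close>, and residue
  \<open>m\<close> carries \<open>y\<close>.\<close>

definition interleave :: "nat \<Rightarrow> iword \<Rightarrow> iword \<Rightarrow> iword" where
  "interleave m x y j =
     (if j mod Suc m < m then x (m * (j div Suc m) + j mod Suc m) else y (j div Suc m))"

lemma nonexpansive2_interleave: "nonexpansive2 (interleave m)"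
proof -
  \<comment> \<open>Letters are never moved towards the front.\<close>
  have "m * (j div Suc m) + j mod Suc m \<le> j" for j
  proof -
    have "m * (j div Suc m) + j mod Suc m \<le> Suc m * (j div Suc m) + j mod Suc m" by simp
    then show ?thesis by (simp only: mult_div_mod_eq)
  qed
  then show ?thesis
    unfolding nonexpansive2_def agree_def interleave_def
    by (auto intro: le_less_trans le_less_trans[OF div_le_dividend])
qed

lemma component_interleave:
  "i < m \<Longrightarrow> component (Suc m) i (interleave m x y) = component m i x"
  "component (Suc m) m (interleave m x y) = y"
  unfolding component_def interleave_def fun_eq_iff
  by (simp_all only: mod_mult_self4 div_mult_self4 mod_less div_less less_SucI lessI) auto

section \<open>The word operations are primitive recursive\<close>

lemma word_pr_dpre:
  assumes "word_pr k R" "word_pr k (\<lambda>Q e. G Q (\<lambda>i. e (Suc i)) (wordc (e 0)))"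
  shows "word_pr k (\<lambda>Q e. dpre (R Q e) (G Q e))"
proof -
  have G: "word_pr k (\<lambda>Q e. G Q (\<lambda>i. e (Suc (Suc i))) (wordc (e 0)))"
    using word_pr_rename[OF assms(2), of "case_nat 0 (\<lambda>i. Suc (Suc i))"] by simp
  have arg: "word_pr k (\<lambda>Q e. G Q (\<lambda>i. e (Suc i)) (wordc (tlc (tlc (e 0)))))"
    using word_pr_arg[where E = "\<lambda>Q e u. G Q (\<lambda>i. e (Suc i)) (wordc u)", OF G, of "\<lambda>Q e. tlc (tlc (e 0))"]
    by (simp add: pr_tlc pr_var)
  show ?thesis
    unfolding word_pr_def dpre_def Let_def
    by (intro pr_conj pr_less pr_consc pr_hdc pr_tlc pr_lenc pr_var pr_prod_decode
        pr_prefixc[OF arg] pr_word[OF word_pr_rename[OF assms(1)]])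
qed

text \<open>As for \<open>dpre\<close>, the operator is only ever applied to a word decoded from a
  number. Its word argument thus becomes the numerical variable \<open>0\<close>, and no further
  oracle is introduced.\<close>

lemma word_pr_bindw:
  assumes "word_pr k R" "word_pr k (\<lambda>Q e. E Q (\<lambda>i. e (Suc i)) (wordc (e 0)))"
  shows "word_pr k (\<lambda>Q e. bindw (R Q e) m i (E Q e))"
proof -
  have E: "word_pr k (\<lambda>Q e. E Q (\<lambda>i. e (Suc (Suc i))) (wordc (e 0)))"
    using word_pr_rename[OF assms(2), of "case_nat 0 (\<lambda>i. Suc (Suc i))"] by simp
  have arg: "word_pr k (\<lambda>Q e. E Q (\<lambda>i. e (Suc i)) (wordc (tlc (tlc (e 0)))))"
    using word_pr_arg[where E = "\<lambda>Q e u. E Q (\<lambda>i. e (Suc i)) (wordc u)", OF E, of "\<lambda>Q e. tlc (tlc (e 0))"]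
    by (simp add: pr_tlc pr_var)
  show ?thesis
    unfolding word_pr_def bindw_def Let_def
    by (intro pr_conj pr_le pr_mult pr_prod_decode pr_consc pr_hdc pr_tlc pr_lenc pr_var pr_const
        pr_prefixc[OF arg] pr_prefixc[OF word_pr_component] word_pr_wordc pr_word[OF word_pr_rename[OF assms(1)]])
qed

lemma word_pr_kernel_word:
  assumes "word_pr k P" "word_pr k R"
    and J: "word_pr k (\<lambda>Q e. J (wordc (e 0)) (wordc (e (Suc 0))))"
  shows "word_pr k (\<lambda>Q e. kernel_word m i J (P Q e) (R Q e))"
  unfolding kernel_word_def
proof (rule word_pr_dpre[OF assms(2)], rule word_pr_bindw[OF word_pr_rename[OF assms(1)]],
    rule word_pr_dpre[where G = "\<lambda>Q e. J (wordc (e 0))"])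
  show "word_pr k (\<lambda>Q e. wordc (e (Suc 0)))"
    by (intro word_pr_wordc pr_var)
  show "word_pr k (\<lambda>Q e. J (wordc (e (Suc 0))) (wordc (e 0)))"
    using word_pr_rename[OF J, of "case_nat (Suc 0) (\<lambda>_. 0)"] by simp
qed

lemma word_pr_interleave:
  assumes "word_pr k A" "word_pr k B"
  shows "word_pr k (\<lambda>Q e. interleave m (A Q e) (B Q e))"
  unfolding word_pr_def interleave_def of_bool_def[symmetric] if_distrib[of of_bool]
  by (intro pr_if pr_less pr_const pr_mod pr_div pr_add pr_mult pr_var
      pr_word[OF word_pr_rename[OF assms(1)]] pr_word[OF word_pr_rename[OF assms(2)]])

text \<open>At step \<open>n\<close> the current state is component \<open>m n\<close> of a tuple of
  length \<open>Suc (m n)\<close>: \<open>m n = 0\<close> when the past is forgotten,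
  \<open>m n = n\<close> for histories.\<close>

primrec kernel_iterate ::
    "(nat \<Rightarrow> nat) \<Rightarrow> (nat \<Rightarrow> iword \<Rightarrow> iword \<Rightarrow> iword) \<Rightarrow> iword \<Rightarrow> iword \<Rightarrow> nat \<Rightarrow> iword" where
  "kernel_iterate m J p r 0 = r"
| "kernel_iterate m J p r (Suc n) = kernel_word (Suc (m n)) (m n) (J n) p (kernel_iterate m J p r n)"

lemma kernel_iterate_machine:
  assumes J: "\<And>n. word_pr 2 (\<lambda>Q e. J n (wordc (e 0)) (wordc (e (Suc 0))))"
    and R: "word_pr 2 (\<lambda>Q e. R (Q 1))"
  shows "\<exists>M. is_machine 2 M \<and> (\<forall>p q. computes M [p, q] (kernel_iterate m J p (R q) n))"
proof -
  have "word_pr 2 (\<lambda>Q e. kernel_iterate m J (Q 0) (R (Q 1)) n)"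
  proof (induction n)
    case 0
    show ?case using R by simp
  next
    case (Suc n)
    show ?case
      by (simp only: kernel_iterate.simps) (intro word_pr_kernel_word Suc J word_pr_query, simp)
  qed
  then have "pr 2 (\<lambda>Q e. of_bool (kernel_iterate m J (Q 0) (R (Q 1)) n (e 0)))"
    by (simp add: word_pr_def)
  from pr_machine[OF this] obtain M where M: "is_machine 2 M"
    "\<And>ps. length ps = 2 \<Longrightarrow> computes M ps (kernel_iterate m J (ps ! 0) (R (ps ! 1)) n)"
    by blast
  have "computes M [p, q] (kernel_iterate m J p (R q) n)" for p q
    using M(2)[of "[p, q]"] by simp
  with M(1) show ?thesis by blast
qed


section \<open>Topology of represented spaces\<close>

lemma topspace_cantor [simp]: "topspace cantor = UNIV"
  by (simp add: cantor_def)

lemma openin_cantor: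
  "openin cantor V \<longleftrightarrow> (\<forall>p\<in>V. \<exists>n. \<forall>q. agree n p q \<longrightarrow> q \<in> V)"
proof
  assume V: "openin cantor V"
  show "\<forall>p\<in>V. \<exists>n. \<forall>q. agree n p q \<longrightarrow> q \<in> V"
  proof
    fix p assume "p \<in> V"
    then obtain U where U: "finite {i. U i \<noteq> (UNIV::bool set)}" "p \<in> Pi\<^sub>E UNIV U" "Pi\<^sub>E UNIV U \<subseteq> V"
      using V unfolding cantor_def openin_product_topology_alt by auto
    obtain n where n: "\<And>i. U i \<noteq> UNIV \<Longrightarrow> i < n"
      using U(1) by (metis (mono_tags, lifting) finite_nat_set_iff_bounded mem_Collect_eq)
    have "q \<in> V" if "agree n p q" for q
    proof -
      have "q i \<in> U i" for i
        using PiE_mem[OF U(2), of i] n[of i] that by (cases "U i = UNIV") (auto simp: agree_def)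
      then show ?thesis using U(3) by blast
    qed
    then show "\<exists>n. \<forall>q. agree n p q \<longrightarrow> q \<in> V" by blast
  qed
next
  assume V: "\<forall>p\<in>V. \<exists>n. \<forall>q. agree n p q \<longrightarrow> q \<in> V"
  show "openin cantor V"
    unfolding cantor_def openin_product_topology_alt
  proof
    fix p assume "p \<in> V"
    then obtain n where n: "\<And>q. agree n p q \<Longrightarrow> q \<in> V" using V by blast
    let ?U = "\<lambda>i. if i < n then {p i} else UNIV"
    have "{i. ?U i \<noteq> UNIV} \<subseteq> {..<n}" by auto
    then have "finite {i \<in> UNIV. ?U i \<noteq> topspace (discrete_topology UNIV)}"
      by (simp add: finite_subset)
    moreover have "Pi\<^sub>E UNIV ?U \<subseteq> V"
    proof
      fix q assume q: "q \<in> Pi\<^sub>E UNIV ?U"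
      have "q i = p i" if "i < n" for i
        using PiE_mem[OF q, of i] that by simp
      then show "q \<in> V" by (intro n) (simp add: agree_def)
    qed
    ultimately show "\<exists>U. finite {i \<in> UNIV. U i \<noteq> topspace (discrete_topology UNIV)} \<and>
         (\<forall>i\<in>UNIV. openin (discrete_topology UNIV) (U i)) \<and> p \<in> Pi\<^sub>E UNIV U \<and> Pi\<^sub>E UNIV U \<subseteq> V"
      by (intro exI[of _ ?U]) auto
  qed
qed

lemma openin_subtopology_cantor:
  "openin (subtopology cantor D) U \<longleftrightarrow>
     U \<subseteq> D \<and> (\<forall>p\<in>U. \<exists>n. \<forall>q\<in>D. agree n p q \<longrightarrow> q \<in> U)"
proof
  assume "openin (subtopology cantor D) U"
  then obtain V where V: "openin cantor V" and U: "U = V \<inter> D"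
    unfolding openin_subtopology by blast
  show "U \<subseteq> D \<and> (\<forall>p\<in>U. \<exists>n. \<forall>q\<in>D. agree n p q \<longrightarrow> q \<in> U)"
    using V[unfolded openin_cantor] unfolding U by (metis IntD1 IntI inf.cobounded2)
next
  assume U: "U \<subseteq> D \<and> (\<forall>p\<in>U. \<exists>n. \<forall>q\<in>D. agree n p q \<longrightarrow> q \<in> U)"
  then obtain n where n: "\<And>p q. p \<in> U \<Longrightarrow> q \<in> D \<Longrightarrow> agree (n p) p q \<Longrightarrow> q \<in> U" by metis
  define V where "V = {q. \<exists>p\<in>U. agree (n p) p q}"
  have "openin cantor V"
    unfolding openin_cantor
  proof
    fix q assume "q \<in> V"
    then obtain p where "p \<in> U" "agree (n p) p q" by (auto simp: V_def)
    then have "q' \<in> V" if "agree (n p) q q'" for q'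
      using agree_trans[OF _ that] by (auto simp: V_def)
    then show "\<exists>n. \<forall>q'. agree n q q' \<longrightarrow> q' \<in> V" by blast
  qed
  moreover have "U = V \<inter> D"
    using U n agree_refl unfolding V_def by fast
  ultimately show "openin (subtopology cantor D) U"
    unfolding openin_subtopology by blast
qed

lemma continuous_map_cantor:
  "continuous_map (subtopology cantor D) Y f \<longleftrightarrow>
     f ` D \<subseteq> topspace Y \<and>
     (\<forall>U p. openin Y U \<longrightarrow> p \<in> D \<longrightarrow> f p \<in> U \<longrightarrow> (\<exists>n. \<forall>q\<in>D. agree n p q \<longrightarrow> f q \<in> U))"
  unfolding continuous_map_def openin_subtopology_cantor by (auto simp: Pi_iff image_subset_iff)

lemma continuous_map_cantorD:
  assumes "continuous_map (subtopology cantor D) Y f" "p \<in> D"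
  shows "f p \<in> topspace Y" "openin Y U \<Longrightarrow> f p \<in> U \<Longrightarrow> \<exists>n. \<forall>q\<in>D. agree n p q \<longrightarrow> f q \<in> U"
  using assms unfolding continuous_map_cantor by blast+

lemma continuous_map_lower:
  "continuous_map X lower_topology f \<longleftrightarrow> (\<forall>a. openin X {x \<in> topspace X. a < f x})"
proof -
  have "openin lower_topology UNIV" by (simp add: openin_lower_topology)
  then have top: "topspace lower_topology = UNIV" using openin_subset by blast
  show ?thesis
  proof
    assume f: "continuous_map X lower_topology f"
    have "openin lower_topology {a<..}" for a
      by (auto simp: openin_lower_topology)
    from openin_continuous_map_preimage[OF f this]
    show "\<forall>a. openin X {x \<in> topspace X. a < f x}" by (simp add: greaterThan_def)
  next
    assume f: "\<forall>a. openin X {x \<in> topspace X. a < f x}"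
    show "continuous_map X lower_topology f"
      unfolding continuous_map_def top
    proof (intro conjI allI impI)
      fix U assume "openin lower_topology U"
      then consider "U = {}" | "U = UNIV" | a where "U = {a<..}"
        by (auto simp: openin_lower_topology)
      then show "openin X {x \<in> topspace X. f x \<in> U}"
        by cases (use f in simp_all)
    qed simp
  qed
qed

lemma lower_lsc:
  assumes "continuous_map (subtopology cantor D) lower_topology f" "p \<in> D" "a < f p"
  shows "\<exists>n. \<forall>q\<in>D. agree n p q \<longrightarrow> a < f q"
proof -
  have "openin (subtopology cantor D) {x \<in> D. a < f x}"
    using assms(1) by (simp add: continuous_map_lower)
  then have "\<forall>p\<in>{x \<in> D. a < f x}. \<exists>n. \<forall>q\<in>D. agree n p q \<longrightarrow> q \<in> {x \<in> D. a < f x}"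
    unfolding openin_subtopology_cantor by (rule conjunct2)
  with assms(2,3) show ?thesis by simp
qed

lemma Least_false_eq: "\<not> r i \<Longrightarrow> (\<And>j. j < i \<Longrightarrow> r j) \<Longrightarrow> (LEAST i. \<not> r i) = (i::nat)"
  by (rule Least_equality) (auto intro: leI)

text \<open>Block \<open>k\<close> ends at a definite zero, which exists as there are infinitely
  many; nothing behind it matters.\<close>

lemma block_agree:
  assumes "infinite {i. \<not> r i}"
  shows "\<exists>n. \<forall>r'. agree n r r' \<longrightarrow> block r' k = block r k"
  using assms
proof (induction k arbitrary: r)
  case 0
  define i where "i = (LEAST i. \<not> r i)"
  have "\<exists>i. \<not> r i" using infinite_imp_nonempty[OF 0] by simp
  then have "\<not> r i" "\<And>j. j < i \<Longrightarrow> r j"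
    unfolding i_def by (rule LeastI_ex, auto dest: not_less_Least)
  then have "block r' 0 = i" if "agree (Suc i) r r'" for r'
    using that by (auto simp: agree_def intro!: Least_false_eq)
  then show ?case using i_def by auto
next
  case (Suc k)
  define i where "i = (LEAST i. \<not> r i)"
  have "\<exists>i. \<not> r i" using infinite_imp_nonempty[OF Suc.prems] by simp
  then have i: "\<not> r i" "\<And>j. j < i \<Longrightarrow> r j"
    unfolding i_def by (rule LeastI_ex, auto dest: not_less_Least)
  have "infinite {j. \<not> r (j + Suc i)}"
    unfolding infinite_nat_iff_unbounded_le
  proof
    fix m
    obtain n where "n \<ge> m + Suc i" "\<not> r n"
      using Suc.prems unfolding infinite_nat_iff_unbounded_le by blast
    then show "\<exists>n\<ge>m. n \<in> {j. \<not> r (j + Suc i)}"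
      by (intro exI[of _ "n - Suc i"]) auto
  qed
  from Suc.IH[OF this] obtain n where
    n: "\<And>r'. agree n (\<lambda>j. r (j + Suc i)) r' \<Longrightarrow> block r' k = block (\<lambda>j. r (j + Suc i)) k" by blast
  have "block r' (Suc k) = block r (Suc k)" if a: "agree (n + Suc i) r r'" for r'
  proof -
    have "(LEAST i. \<not> r' i) = i" using i a by (auto simp: agree_def intro!: Least_false_eq)
    moreover have "agree n (\<lambda>j. r (j + Suc i)) (\<lambda>j. r' (j + Suc i))"
      using a by (simp add: agree_def)
    ultimately show ?thesis using n by (simp add: i_def[symmetric])
  qed
  then show ?case by blast
qed

text \<open>A strict lower bound is witnessed by a single approximant, that is, by two blocks; any
  name sharing them has the same approximant below its supremum.\<close>

lemma lower_rep_lsc: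
  assumes "rep_of lower_reals r = Some v" "a < v"
  shows "\<exists>n. \<forall>r' v'. agree n r r' \<longrightarrow> rep_of lower_reals r' = Some v' \<longrightarrow> a < v'"
proof -
  have inf: "infinite {i. \<not> r i}" and v: "v = (SUP k. lower_approx r k)"
    using assms(1) by (auto simp: lower_reals_def split: if_splits)
  obtain k where k: "a < lower_approx r k" using assms(2) v by (auto simp: less_SUP_iff)
  obtain n1 where n1: "\<And>r'. agree n1 r r' \<Longrightarrow> block r' (2 * k) = block r (2 * k)"
    using block_agree[OF inf, of "2 * k"] by blast
  obtain n2 where n2: "\<And>r'. agree n2 r r' \<Longrightarrow> block r' (2 * k + 1) = block r (2 * k + 1)"
    using block_agree[OF inf, of "2 * k + 1"] by blast
  have "a < v'" if "agree (max n1 n2) r r'" "rep_of lower_reals r' = Some v'" for r' v'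
  proof -
    have "agree n1 r r'" "agree n2 r r'" by (rule agree_mono[OF that(1)], simp)+
    from n1[OF this(1)] n2[OF this(2)] have "lower_approx r' k = lower_approx r k"
      by (simp add: lower_approx_def)
    moreover have "v' = (SUP k. lower_approx r' k)"
      using that(2) by (auto simp: lower_reals_def split: if_splits)
    ultimately show ?thesis using k by (auto simp: less_SUP_iff intro!: exI[of _ k])
  qed
  then show ?thesis by blast
qed

section \<open>Representations as continuous maps and as quotient maps\<close>

definition continuous_rep :: "'a ctype \<Rightarrow> bool" where
  "continuous_rep Y \<longleftrightarrow>
     continuous_map (subtopology cantor (dom (rep_of Y))) (top_of Y) (\<lambda>p. the (rep_of Y p))"

text \<open>Sources of exponentials use this stronger property, to obtain names of points and to
  test continuity on names; targets use \<open>continuous_rep\<close>.\<close>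

definition quotient_rep :: "'a ctype \<Rightarrow> bool" where
  "quotient_rep Y \<longleftrightarrow>
     quotient_map (subtopology cantor (dom (rep_of Y))) (top_of Y) (\<lambda>p. the (rep_of Y p))"

lemma quotient_rep_continuous: "quotient_rep Y \<Longrightarrow> continuous_rep Y"
  by (simp add: quotient_rep_def continuous_rep_def quotient_imp_continuous_map)

lemma continuous_rep_members:
  assumes "continuous_rep Y" "rep_of Y p = Some y"
  shows "y \<in> members Y"
proof -
  have "(\<lambda>p. the (rep_of Y p)) ` dom (rep_of Y) \<subseteq> members Y"
    using assms(1) unfolding continuous_rep_def continuous_map_cantor by (rule conjunct1)
  moreover have "p \<in> dom (rep_of Y)" using assms(2) by auto
  ultimately have "the (rep_of Y p) \<in> members Y" by blast
  then show ?thesis using assms(2) by simp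
qed

lemma quotient_rep_members: "quotient_rep Y \<Longrightarrow> rep_of Y p = Some y \<Longrightarrow> y \<in> members Y"
  by (intro continuous_rep_members quotient_rep_continuous)

lemma quotient_rep_surj:
  assumes "quotient_rep Y" "y \<in> members Y"
  shows "\<exists>p. rep_of Y p = Some y"
proof -
  have "y \<in> (\<lambda>p. the (rep_of Y p)) ` dom (rep_of Y)"
    using assms by (auto simp: quotient_rep_def quotient_map_def)
  then obtain p where "p \<in> dom (rep_of Y)" "y = the (rep_of Y p)" by blast
  then show ?thesis by auto
qed

lemma continuous_rep_lower: "continuous_rep lower_reals"
proof -
  have "\<exists>n. \<forall>q\<in>dom (rep_of lower_reals). agree n p q \<longrightarrow> a < the (rep_of lower_reals q)"
    if p: "p \<in> dom (rep_of lower_reals)" "a < the (rep_of lower_reals p)" for p a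
  proof -
    obtain v where v: "rep_of lower_reals p = Some v" using domD[OF p(1)] by blast
    then obtain n where "\<forall>r' v'. agree n p r' \<longrightarrow> rep_of lower_reals r' = Some v' \<longrightarrow> a < v'"
      using lower_rep_lsc[of p v a] p(2) by auto
    then show ?thesis by (intro exI[of _ n]) auto
  qed
  then show ?thesis
    unfolding continuous_rep_def
    by (simp add: lower_reals_def continuous_map_lower openin_subtopology_cantor)
qed

text \<open>For constructed types the topology is the quotient one by definition, so what remains is
  that every point has a name.\<close>

lemma quotient_rep_topology:
  assumes "ran (rep_of Y) = C" "top_of Y = rep_topology C (rep_of Y)"
  shows "quotient_rep Y"
proof -
  have t: "topspace (rep_topology C (rep_of Y)) = C"
    using assms(1) by (simp add: topspace_rep_topology)
  have "(\<lambda>p. the (rep_of Y p)) ` dom (rep_of Y) = C"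
    unfolding assms(1)[symmetric] by (force simp: ran_def image_iff)
  then show ?thesis
    unfolding quotient_rep_def quotient_map_def assms(2) t by (simp add: openin_rep_topology)
qed

text \<open>Joint continuity of application: each output letter is caused by one true entry of
  \<open>p\<close> at one prefix of \<open>q\<close>, and finitely many letters involve only
  finitely many of these.\<close>

lemma apply_name_agree:
  assumes "apply_name p q = Some r"
  shows "\<exists>N. \<forall>p' q' r'. agree N p p' \<longrightarrow> agree N q q' \<longrightarrow> apply_name p' q' = Some r' \<longrightarrow> agree n r r'"
proof -
  have "\<exists>N. \<forall>p' q' r'. agree N p p' \<longrightarrow> agree N q q' \<longrightarrow> apply_name p' q' = Some r' \<longrightarrow> r j = r' j" for j
  proof -
    have "determines p q j (r j)" using apply_name_SomeD[OF assms, of j "r j"] by simp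
    then obtain n where n: "p (assoc_index j (r j) (map q [0..<n]))" by (auto simp: determines_def)
    let ?N = "max n (Suc (assoc_index j (r j) (map q [0..<n])))"
    have "r j = r' j" if "agree ?N p p'" "agree ?N q q'" "apply_name p' q' = Some r'" for p' q' r'
    proof -
      have "map q [0..<n] = map q' [0..<n]"
        by (intro agree_map agree_mono[OF that(2)]) simp
      moreover have "p' (assoc_index j (r j) (map q [0..<n]))"
        using n that(1)[unfolded agree_def, rule_format, of "assoc_index j (r j) (map q [0..<n])"] by simp
      ultimately have "determines p' q' j (r j)"
        unfolding determines_def by metis
      then show ?thesis using apply_name_SomeD[OF that(3), of j "r j"] by simp
    qed
    then show ?thesis by blast
  qed
  then obtain N where N: "\<And>j p' q' r'. agree (N j) p p' \<Longrightarrow> agree (N j) q q' \<Longrightarrow>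
      apply_name p' q' = Some r' \<Longrightarrow> r j = r' j" by metis
  let ?N = "Max (N ` {..<n})"
  have "agree n r r'" if "agree ?N p p'" "agree ?N q q'" "apply_name p' q' = Some r'" for p' q' r'
    unfolding agree_def
  proof (intro allI impI)
    fix j assume "j < n"
    then have "N j \<le> ?N" by simp
    then show "r j = r' j" by (intro N[OF _ _ that(3)] agree_mono[OF that(1)] agree_mono[OF that(2)])
  qed
  then show ?thesis by blast
qed

lemma apply_nameI:
  assumes "\<And>j b. determines p q j b \<longleftrightarrow> r j = b"
  shows "apply_name p q = Some r"
  using assms by (simp add: apply_name_def)

lemma assoc_index_eq_iff:
  "assoc_index j b u = assoc_index j' b' u' \<longleftrightarrow> j = j' \<and> b = b' \<and> u = u'"
proof -
  have "inj (of_bool :: bool \<Rightarrow> nat)" by (simp add: inj_def)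
  then show ?thesis
    by (auto simp: assoc_index_def list_encode_eq inj_map_eq_map simp del: list_encode.simps)
qed

lemma length_le_assoc_index: "length u \<le> assoc_index j b u"
  using length_le_list_encode[of "j # of_bool b # map of_bool u"]
  by (simp add: assoc_index_def del: list_encode.simps)

lemma agree_iff_map: "agree n p q \<longleftrightarrow> map q [0..<n] = map p [0..<n]"
  by (auto simp: agree_def)

text \<open>The largest associate compatible with \<open>G\<close> on \<open>D\<close> works. At
  prefixes without extension in \<open>D\<close> it may list both letters, but no point of
  \<open>D\<close> consults these entries.\<close>

lemma exists_associate:
  assumes "\<And>d n. d \<in> D \<Longrightarrow> \<exists>N. \<forall>d'\<in>D. agree N d d' \<longrightarrow> agree n (G d) (G d')"
  shows "\<exists>p. \<forall>d\<in>D. apply_name p d = Some (G d)"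
proof -
  define p where "p k \<longleftrightarrow> (\<exists>j b u. k = assoc_index j b u \<and>
      (\<forall>d\<in>D. map d [0..<length u] = u \<longrightarrow> G d j = b))" for k
  have p: "p (assoc_index j b u) \<longleftrightarrow> (\<forall>d\<in>D. map d [0..<length u] = u \<longrightarrow> G d j = b)" for j b u
    by (auto simp: p_def assoc_index_eq_iff)
  have "determines p d j b \<longleftrightarrow> G d j = b" if d: "d \<in> D" for d j b
  proof
    assume "G d j = b"
    obtain N where "\<forall>d'\<in>D. agree N d d' \<longrightarrow> agree (Suc j) (G d) (G d')"
      using assms[OF d] by blast
    then have "p (assoc_index j b (map d [0..<N]))"
      using \<open>G d j = b\<close> by (auto simp: p agree_iff_map[symmetric]) (auto simp: agree_def)
    then show "determines p d j b" unfolding determines_def by blast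
  qed (use d in \<open>auto simp: determines_def p\<close>)
  then show ?thesis by (intro exI[of _ p]) (auto intro!: apply_nameI)
qed

section \<open>Realizers of lower semicontinuous functions\<close>

definition blocks_word :: "(nat \<Rightarrow> nat) \<Rightarrow> iword" where
  "blocks_word b i \<longleftrightarrow> (\<forall>k. i \<noteq> (\<Sum>j\<le>k. b j) + k)"

text \<open>The zero closing block \<open>k\<close> stands at position \<open>k\<close> or later, so
  letter \<open>i\<close> depends only on blocks up to \<open>i\<close>.\<close>

lemma blocks_word_agree:
  assumes "\<And>j. j < n \<Longrightarrow> b j = b' j"
  shows "agree n (blocks_word b) (blocks_word b')"
proof -
  have "i = (\<Sum>j\<le>k. b j) + k \<longleftrightarrow> i = (\<Sum>j\<le>k. b' j) + k" if "i < n" for i k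
  proof (cases "k \<le> i")
    case True
    then have "(\<Sum>j\<le>k. b j) = (\<Sum>j\<le>k. b' j)" using that assms by (intro sum.cong) auto
    then show ?thesis by simp
  qed auto
  then show ?thesis by (simp add: agree_def blocks_word_def)
qed

lemma infinite_blocks_word: "infinite {i. \<not> blocks_word b i}"
  unfolding infinite_nat_iff_unbounded_le blocks_word_def by auto (metis le_add2)

lemma block_blocks_word: "block (blocks_word b) k = b k"
proof (induction k arbitrary: b)
  have L: "(LEAST i. \<not> blocks_word b i) = b 0" for b
  proof (rule Least_false_eq)
    show "\<not> blocks_word b (b 0)" unfolding blocks_word_def by (auto intro!: exI[of _ 0])
    have "b 0 \<le> (\<Sum>j\<le>k. b j)" for k by (intro member_le_sum) auto
    then show "blocks_word b j" if "j < b 0" for j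
      using that unfolding blocks_word_def by (metis le_add1 not_le order_trans)
  qed
  {
    case 0
    show ?case by (simp add: L)
  next
    case (Suc k)
    have "blocks_word b (i + Suc (b 0)) = blocks_word (\<lambda>j. b (Suc j)) i" for i
    proof -
      have "i + Suc (b 0) = (\<Sum>j\<le>k. b j) + k \<longleftrightarrow> (\<exists>l. k = Suc l \<and> i = (\<Sum>j\<le>l. b (Suc j)) + l)" for k
        by (cases k) (auto simp: sum.atMost_Suc_shift simp del: sum.atMost_Suc)
      then show ?thesis unfolding blocks_word_def by blast
    qed
    then show ?case using Suc[of "\<lambda>j. b (Suc j)"] by (simp add: L)
  }
qed

definition fraction :: "nat \<times> nat \<Rightarrow> ennreal" where
  "fraction z = of_nat (fst z) / of_nat (Suc (snd z))"

lemma fraction_dense: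
  assumes "a < b"
  shows "\<exists>z. a < fraction z \<and> fraction z < b"
proof -
  obtain c where c: "a < c" "c < b" using dense[OF assms] by blast
  obtain a' where a': "a = ennreal a'" "0 \<le> a'" using c(1) by (cases a) auto
  obtain c' where c': "c = ennreal c'" "0 \<le> c'" using c(2) by (cases c) auto
  have "a' < c'" using c(1) a' c' by (simp add: ennreal_less_iff)
  then obtain q where q: "q \<in> \<rat>" "a' < q" "q < c'" using Rats_dense_in_real by blast
  then obtain m n where mn: "n \<noteq> 0" "\<bar>q\<bar> = real m / real n"
    using Rats_abs_nat_div_natE by metis
  then have q': "q = real m / real (Suc (n - 1))" using q(2) a'(2) by simp
  have "fraction (m, n - 1) = ennreal q"
    unfolding q' fraction_def fst_conv snd_conv
    by (simp only: ennreal_of_nat_eq_real_of_nat) (rule divide_ennreal, simp_all)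
  moreover have "a < ennreal q" "ennreal q < b"
    using q a' c' less_trans[OF _ c(2)] by (auto simp: ennreal_less_iff)
  ultimately show ?thesis by metis
qed

text \<open>
  The names of the values of a lower semicontinuous \<open>\<phi>\<close> are found by running through all
  fractions, each infinitely often, and recording the next larger one that is known to be below
  \<open>\<phi>\<close> on the current cylinder.
\<close>

lemma lower_associate:
  assumes lsc: "continuous_map (subtopology cantor D) lower_topology \<phi>"
  shows "\<exists>p. \<forall>d\<in>D. \<exists>r. apply_name p d = Some r \<and> rep_of lower_reals r = Some (\<phi> d)"
proof -
  \<comment> \<open>A fraction \<open>z\<close> is the candidate at every stage
    \<open>prod_encode (prod_encode z, n)\<close>. Such a stage is at least \<open>n\<close>, so it
    inspects a cylinder as small as desired.\<close>
  define cand where "cand k = prod_decode (fst (prod_decode k))" for k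
  define best where "best d = rec_nat (0, 0) (\<lambda>k z.
      if (\<forall>d'\<in>D. agree k d d' \<longrightarrow> fraction (cand k) < \<phi> d') \<and> fraction z < fraction (cand k) then cand k else z)" for d
  define b where "b d i = (if even i then fst (best d (i div 2)) else snd (best d (i div 2)))" for d i
  have best_agree: "best d k = best d' k" if "agree k d d'" for d d' k
    using that
  proof (induction k)
    case (Suc k)
    then have "agree k d d'" by (simp add: agree_mono)
    then have "agree k d e \<longleftrightarrow> agree k d' e" for e
      using agree_trans agree_sym by blast
    then show ?case using Suc.IH[OF \<open>agree k d d'\<close>] by (simp add: best_def)
  qed (simp add: best_def)
  have "agree n (blocks_word (b d)) (blocks_word (b d'))" if "agree n d d'" for n d d'
  proof (rule blocks_word_agree)
    fix j assume "j < n"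
    then have "best d (j div 2) = best d' (j div 2)"
      by (intro best_agree agree_mono[OF that]) simp
    then show "b d j = b d' j" by (simp add: b_def)
  qed
  then obtain p where p: "\<And>d. d \<in> D \<Longrightarrow> apply_name p d = Some (blocks_word (b d))"
    using exists_associate[of D "\<lambda>d. blocks_word (b d)"] by blast
  have "rep_of lower_reals (blocks_word (b d)) = Some (\<phi> d)" if d: "d \<in> D" for d
  proof -
    have approx: "lower_approx (blocks_word (b d)) k = fraction (best d k)" for k
      by (simp only: lower_approx_def block_blocks_word) (simp add: b_def fraction_def)
    have mono: "incseq (\<lambda>k. fraction (best d k))"
      by (rule incseq_SucI) (simp add: best_def less_imp_le)
    have "fraction (best d k) \<le> \<phi> d" for k
    proof (induction k)
      case 0
      show ?case by (simp add: best_def fraction_def)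
    next
      case (Suc k)
      then show ?case
        using d agree_refl[of k d] by (auto simp: best_def intro: less_imp_le)
    qed
    moreover have "\<phi> d \<le> (SUP k. fraction (best d k))"
    proof (rule ccontr)
      assume "\<not> \<phi> d \<le> (SUP k. fraction (best d k))"
      then obtain z where z: "(SUP k. fraction (best d k)) < fraction z" "fraction z < \<phi> d"
        using fraction_dense by (metis not_le)
      obtain n where n: "\<forall>d'\<in>D. agree n d d' \<longrightarrow> fraction z < \<phi> d'"
        using lower_lsc[OF lsc d z(2)] by blast
      define k where "k = prod_encode (prod_encode z, n)"
      have "cand k = z" by (simp add: cand_def k_def)
      moreover have "agree n d d'" if "agree k d d'" for d'
        using that by (rule agree_mono) (simp add: k_def le_prod_encode_2)
      ultimately have "fraction z \<le> fraction (best d (Suc k))"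
        using n by (simp add: best_def not_less)
      also have "\<dots> \<le> (SUP k. fraction (best d k))" by (rule SUP_upper) simp
      finally show False using z(1) by simp
    qed
    ultimately have "(SUP k. fraction (best d k)) = \<phi> d"
      by (intro antisym SUP_least)
    moreover have "lower_approx (blocks_word (b d)) = (\<lambda>k. fraction (best d k))"
      using approx by auto
    ultimately show ?thesis
      using mono by (simp add: lower_reals_def infinite_blocks_word)
  qed
  with p show ?thesis by blast
qed

section \<open>Names in exponentials and subtypes\<close>

lemma exp_rep_SomeD:
  "exp_rep X Y p = Some f \<Longrightarrow> f \<in> cont_funs X Y \<and> realizes X Y p f"
  using theI'[of "\<lambda>f. f \<in> cont_funs X Y \<and> realizes X Y p f"]
  by (simp add: exp_rep_def split: if_splits)

lemma realizesD:
  assumes "realizes X Y p f" "rep_of X q = Some x"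
  shows "\<exists>r. apply_name p q = Some r \<and> rep_of Y r = Some (f x)"
  using assms by (simp add: realizes_def)

lemma realizes_unique:
  assumes "quotient_rep X" "realizes X Y p f" "realizes X Y p g"
    "f \<in> extensional (members X)" "g \<in> extensional (members X)"
  shows "f = g"
proof (rule extensionalityI[OF assms(4,5)])
  fix x assume "x \<in> members X"
  then obtain q where "rep_of X q = Some x" using quotient_rep_surj[OF assms(1)] by blast
  then show "f x = g x" using assms(2,3) unfolding realizes_def by fastforce
qed

text \<open>Since \<open>X\<close> carries the quotient topology, continuity is tested on names,
  where it follows from continuity of application and of decoding.\<close>

lemma realizes_continuous:
  assumes X: "quotient_rep X" and Y: "continuous_rep Y" and f: "realizes X Y p f"
  shows "continuous_map (top_of X) (top_of Y) f"
proof (rule continuous_compose_quotient_map[OF X[unfolded quotient_rep_def]])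
  show "continuous_map (subtopology cantor (dom (rep_of X))) (top_of Y) (f \<circ> (\<lambda>q. the (rep_of X q)))"
    unfolding continuous_map_cantor
  proof (intro conjI allI impI)
    show "(f \<circ> (\<lambda>q. the (rep_of X q))) ` dom (rep_of X) \<subseteq> members Y"
    proof (intro image_subsetI)
      fix q assume "q \<in> dom (rep_of X)"
      then obtain x where x: "rep_of X q = Some x" by blast
      then obtain r where "rep_of Y r = Some (f x)" using realizesD[OF f] by blast
      then show "(f \<circ> (\<lambda>q. the (rep_of X q))) q \<in> members Y"
        using continuous_rep_members[OF Y] x by simp
    qed
    fix U q assume U: "openin (top_of Y) U" and q: "q \<in> dom (rep_of X)"
      "(f \<circ> (\<lambda>q. the (rep_of X q))) q \<in> U"
    then obtain x where x: "rep_of X q = Some x" "f x \<in> U" by auto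
    obtain r where r: "apply_name p q = Some r" "rep_of Y r = Some (f x)"
      using realizesD[OF f x(1)] by blast
    obtain n where n: "\<And>r'. r' \<in> dom (rep_of Y) \<Longrightarrow> agree n r r' \<Longrightarrow> the (rep_of Y r') \<in> U"
      using continuous_map_cantorD(2)[OF Y[unfolded continuous_rep_def] _ U, of r] r(2) x(2) by auto
    obtain N where N: "\<And>p' q' r'. agree N p p' \<Longrightarrow> agree N q q' \<Longrightarrow> apply_name p' q' = Some r' \<Longrightarrow> agree n r r'"
      using apply_name_agree[OF r(1)] by blast
    have "(f \<circ> (\<lambda>q. the (rep_of X q))) q' \<in> U" if q': "q' \<in> dom (rep_of X)" "agree N q q'" for q'
    proof -
      obtain x' where x': "rep_of X q' = Some x'" using q'(1) by auto
      then obtain r' where r': "apply_name p q' = Some r'" "rep_of Y r' = Some (f x')"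
        using realizesD[OF f] by blast
      show ?thesis using n[of r'] N[OF agree_refl q'(2) r'(1)] r'(2) x' by auto
    qed
    then show "\<exists>n. \<forall>q'\<in>dom (rep_of X). agree n q q' \<longrightarrow> (f \<circ> (\<lambda>q. the (rep_of X q))) q' \<in> U"
      by blast
  qed
qed

text \<open>Continuity and uniqueness follow from being realized, so naming a function reduces to
  giving a realizer of its extensional form.\<close>

lemma exp_repI:
  assumes X: "quotient_rep X" and Y: "continuous_rep Y" and f: "realizes X Y p f"
    and ext: "f \<in> extensional (members X)"
  shows "exp_rep X Y p = Some f"
proof -
  have "f \<in> cont_funs X Y"
    using realizes_continuous[OF X Y f] ext by (simp add: cont_funs_def)
  moreover have "g = f" if "g \<in> cont_funs X Y \<and> realizes X Y p g" for g
    using realizes_unique[OF X _ f _ ext] that by (auto simp: cont_funs_def)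
  ultimately have "\<exists>!f. f \<in> cont_funs X Y \<and> realizes X Y p f"
    "(THE f. f \<in> cont_funs X Y \<and> realizes X Y p f) = f"
    using f by (blast, blast intro: the_equality)
  then show ?thesis by (simp add: exp_rep_def)
qed

lemma ran_exp_rep_subset: "ran (exp_rep X Y) \<subseteq> cont_funs X Y"
  using exp_rep_SomeD by (force simp: ran_def)

lemma quotient_rep_exp_type:
  assumes "quotient_rep X" "continuous_rep Y"
    and "\<And>f. f \<in> cont_funs X Y \<Longrightarrow> \<exists>p. realizes X Y p f"
  shows "quotient_rep (exp_type X Y)"
proof (rule quotient_rep_topology)
  have "\<exists>p. exp_rep X Y p = Some f" if "f \<in> cont_funs X Y" for f
    using assms(3)[OF that] exp_repI[OF assms(1,2)] that by (auto simp: cont_funs_def)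
  then show "ran (rep_of (exp_type X Y)) = cont_funs X Y"
    using ran_exp_rep_subset[of X Y] by (fastforce simp: exp_type_def ran_def)
qed (simp add: exp_type_def)

lemma cont_funs_lower_cantor:
  assumes "quotient_rep X" "f \<in> cont_funs X lower_reals"
  shows "continuous_map (subtopology cantor (dom (rep_of X))) lower_topology (\<lambda>q. f (the (rep_of X q)))"
  using continuous_map_compose[OF quotient_imp_continuous_map[OF assms(1)[unfolded quotient_rep_def]], of lower_topology f]
    assms(2) by (simp add: cont_funs_def lower_reals_def comp_def)

lemma quotient_rep_observables:
  assumes "quotient_rep X"
  shows "quotient_rep (exp_type X lower_reals)"
proof (rule quotient_rep_exp_type[OF assms continuous_rep_lower])
  fix f assume "f \<in> cont_funs X lower_reals"
  then show "\<exists>p. realizes X lower_reals p f"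
    using lower_associate[OF cont_funs_lower_cantor[OF assms]] unfolding realizes_def by fastforce
qed

lemma sub_rep_eq_Some: "sub_rep X S p = Some x \<longleftrightarrow> rep_of X p = Some x \<and> x \<in> S"
  by (auto simp: sub_rep_def split: option.splits)

lemma rep_subtype: "rep_of (subtype X S) = sub_rep X S"
  by (simp add: subtype_def)

lemma members_subtype:
  assumes "quotient_rep X"
  shows "members (subtype X S) = members X \<inter> S"
proof -
  have "ran (sub_rep X S) \<subseteq> members X \<inter> S"
    using quotient_rep_members[OF assms] by (auto simp: ran_def sub_rep_eq_Some)
  then show ?thesis by (simp add: subtype_def topspace_rep_topology)
qed

lemma quotient_rep_subtype:
  assumes "quotient_rep X"
  shows "quotient_rep (subtype X S)"
proof (rule quotient_rep_topology)
  show "ran (rep_of (subtype X S)) = members X \<inter> S"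
    using quotient_rep_members[OF assms] quotient_rep_surj[OF assms]
    by (fastforce simp: rep_subtype ran_def sub_rep_eq_Some)
qed (simp add: subtype_def)

lemma eval_lsc:
  assumes "exp_rep B lower_reals p = Some f" "rep_of B k = Some y" "a < f y"
  shows "\<exists>n. \<forall>p' f' k' y'. agree n p p' \<longrightarrow> agree n k k' \<longrightarrow> exp_rep B lower_reals p' = Some f' \<longrightarrow>
     rep_of B k' = Some y' \<longrightarrow> a < f' y'"
proof -
  obtain r where r: "apply_name p k = Some r" "rep_of lower_reals r = Some (f y)"
    using realizesD[OF exp_rep_SomeD[OF assms(1), THEN conjunct2] assms(2)] by blast
  obtain n where n: "\<And>r' v'. agree n r r' \<Longrightarrow> rep_of lower_reals r' = Some v' \<Longrightarrow> a < v'"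
    using lower_rep_lsc[OF r(2) assms(3)] by blast
  obtain N where N: "\<And>p' q' r'. agree N p p' \<Longrightarrow> agree N k q' \<Longrightarrow> apply_name p' q' = Some r' \<Longrightarrow> agree n r r'"
    using apply_name_agree[OF r(1)] by blast
  have "a < f' y'" if "agree N p p'" "agree N k k'" "exp_rep B lower_reals p' = Some f'"
    "rep_of B k' = Some y'" for p' f' k' y'
    using realizesD[OF exp_rep_SomeD[OF that(3), THEN conjunct2] that(4)] N[OF that(1,2)] n by blast
  then show ?thesis by blast
qed

text \<open>
  The exponential topology makes evaluation jointly lower semicontinuous along sequences: the
  observables exceeding \<open>a\<close> on a convergent sequence together with its limit form an open set.
\<close>

lemma uncurry_lsc:
  assumes B: "quotient_rep B"
    and \<phi>: "continuous_map (subtopology cantor D) (top_of (subtype (exp_type B lower_reals) S)) \<phi>"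
    and d: "d \<in> D" and k: "rep_of B k = Some y" and a: "a < \<phi> d y"
  shows "\<exists>n. \<forall>d'\<in>D. \<forall>k' y'. agree n d d' \<longrightarrow> agree n k k' \<longrightarrow> rep_of B k' = Some y' \<longrightarrow> a < \<phi> d' y'"
proof (rule ccontr)
  assume "\<not> ?thesis"
  then have "\<forall>n. \<exists>d' k' y'. d' \<in> D \<and> agree n d d' \<and> agree n k k' \<and> rep_of B k' = Some y' \<and> \<not> a < \<phi> d' y'"
    by blast
  then obtain dn kn yn where s: "\<And>n. dn n \<in> D" "\<And>n. agree n d (dn n)" "\<And>n. agree n k (kn n)"
    "\<And>n. rep_of B (kn n) = Some (yn n)" "\<And>n. \<not> a < \<phi> (dn n) (yn n)" by metis
  let ?T = "subtype (exp_type B lower_reals) S"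
  have mem: "members ?T = cont_funs B lower_reals \<inter> S"
    using members_subtype[OF quotient_rep_observables[OF B], of S] by (simp add: members_exp_type)
  have \<phi>d: "\<phi> d \<in> cont_funs B lower_reals"
    using continuous_map_cantorD(1)[OF \<phi> d] mem by blast
  \<comment> \<open>\<open>\<phi> d\<close> is known to exceed \<open>a\<close> only near
    \<open>k\<close>; conditions on the sequence are imposed from this \<open>N\<close> on, so that
    \<open>\<phi> d\<close> lies in \<open>U\<close>.\<close>
  obtain N where N: "\<And>k'. k' \<in> dom (rep_of B) \<Longrightarrow> agree N k k' \<Longrightarrow> a < \<phi> d (the (rep_of B k'))"
    using lower_lsc[OF cont_funs_lower_cantor[OF B \<phi>d], of k a] k a by auto
  define U where "U = {h \<in> members ?T. a < h y \<and> (\<forall>n\<ge>N. a < h (yn n))}"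
  have U: "openin (top_of ?T) U"
  proof -
    have "\<exists>M. \<forall>q\<in>dom (sub_rep (exp_type B lower_reals) S). agree M p q \<longrightarrow> the (sub_rep (exp_type B lower_reals) S q) \<in> U"
      if p: "p \<in> dom (sub_rep (exp_type B lower_reals) S)" "the (sub_rep (exp_type B lower_reals) S p) \<in> U" for p
    proof -
      obtain h where hs: "sub_rep (exp_type B lower_reals) S p = Some h" using domD[OF p(1)] by blast
      have h: "exp_rep B lower_reals p = Some h" "h \<in> U"
        using hs p(2) sub_rep_eq_Some[of "exp_type B lower_reals" S p h] by (simp_all add: exp_type_def)
      have ahy: "a < h y" using h(2) by (simp add: U_def)
      obtain M0 where M0: "\<And>p' f' k' y'. agree M0 p p' \<Longrightarrow> agree M0 k k' \<Longrightarrow>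
          exp_rep B lower_reals p' = Some f' \<Longrightarrow> rep_of B k' = Some y' \<Longrightarrow> a < f' y'"
        using eval_lsc[OF h(1) k ahy] by blast
      have "\<forall>n. \<exists>M. N \<le> n \<longrightarrow> (\<forall>p' f'. agree M p p' \<longrightarrow> exp_rep B lower_reals p' = Some f' \<longrightarrow> a < f' (yn n))"
      proof
        fix n
        show "\<exists>M. N \<le> n \<longrightarrow> (\<forall>p' f'. agree M p p' \<longrightarrow> exp_rep B lower_reals p' = Some f' \<longrightarrow> a < f' (yn n))"
        proof (cases "N \<le> n")
          case True
          then have "a < h (yn n)" using h(2) by (simp add: U_def)
          from eval_lsc[OF h(1) s(4) this] obtain M where M: "\<And>p' f' k' y'. agree M p p' \<Longrightarrow>
            agree M (kn n) k' \<Longrightarrow> exp_rep B lower_reals p' = Some f' \<Longrightarrow> rep_of B k' = Some y' \<Longrightarrow> a < f' y'"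
            by blast
          show ?thesis by (intro exI[of _ M] impI allI) (rule M[OF _ agree_refl _ s(4)])
        qed simp
      qed
      from choice[OF this] obtain M where M: "\<And>n p' f'. N \<le> n \<Longrightarrow> agree (M n) p p' \<Longrightarrow>
          exp_rep B lower_reals p' = Some f' \<Longrightarrow> a < f' (yn n)" by blast
      \<comment> \<open>Compactness of a convergent sequence: \<open>M0\<close> serves
        \<open>y\<close> and all \<open>yn n\<close> with \<open>n \<ge> M0\<close>, whose names
        share \<open>M0\<close> letters with \<open>k\<close>; finitely many indices are
        left.\<close>
      define M' where "M' = Max (insert M0 (M ` {..<M0}))"
      have M': "M0 \<le> M'" "\<And>n. n < M0 \<Longrightarrow> M n \<le> M'" by (auto simp: M'_def)
      have in_U: "f' \<in> U" if "agree M' p q" "exp_rep B lower_reals q = Some f'" "f' \<in> S" for q f'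
      proof -
        have 0: "agree M0 p q" using that(1) M'(1) by (rule agree_mono)
        have "a < f' (yn n)" if "n \<ge> N" for n
        proof (cases "n < M0")
          case True
          then show ?thesis
            using M[OF that agree_mono[OF \<open>agree M' p q\<close> M'(2)]] \<open>exp_rep B lower_reals q = Some f'\<close> by blast
        next
          case False
          then have "agree M0 k (kn n)" using s(3)[of n] by (simp add: agree_mono)
          then show ?thesis using M0[OF 0 _ \<open>exp_rep B lower_reals q = Some f'\<close> s(4)] by blast
        qed
        moreover have "a < f' y" using M0[OF 0 agree_refl that(2) k] .
        ultimately show ?thesis
          using exp_rep_SomeD[OF that(2)] that(3) by (simp add: U_def mem)
      qed
      have "the (sub_rep (exp_type B lower_reals) S q) \<in> U"
        if q: "q \<in> dom (sub_rep (exp_type B lower_reals) S)" "agree M' p q" for q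
      proof -
        obtain f' where "sub_rep (exp_type B lower_reals) S q = Some f'" using domD[OF q(1)] by blast
        then show ?thesis
          using in_U[OF q(2), of f'] sub_rep_eq_Some[of "exp_type B lower_reals" S q f']
          by (simp add: exp_type_def)
      qed
      then show ?thesis by blast
    qed
    moreover have "U \<subseteq> members (exp_type B lower_reals) \<inter> S"
      by (auto simp: U_def mem members_exp_type)
    ultimately show ?thesis
      by (simp add: subtype_def openin_rep_topology openin_subtopology_cantor)
  qed
  have "a < \<phi> d (yn n)" if "n \<ge> N" for n
    using N[OF _ agree_mono[OF s(3) that]] s(4)[of n] by auto
  then have "\<phi> d \<in> U"
    using a continuous_map_cantorD(1)[OF \<phi> d] by (simp add: U_def)
  then obtain n where n: "\<And>d'. d' \<in> D \<Longrightarrow> agree n d d' \<Longrightarrow> \<phi> d' \<in> U"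
    using continuous_map_cantorD(2)[OF \<phi> d U] by blast
  have "\<phi> (dn (max n N)) \<in> U"
    using s(1) agree_mono[OF s(2)] by (intro n) auto
  then show False using s(5)[of "max n N"] by (simp add: U_def)
qed

text \<open>Uncurrying gives a lower semicontinuous function of an interleaved pair, which has a
  realizer. Its values \<open>g d k\<close> are then recast, for each \<open>d\<close>, as an
  associate \<open>r d\<close> that depends continuously on \<open>d\<close>.\<close>

lemma sub_exp_associate:
  assumes B: "quotient_rep B"
    and \<phi>: "continuous_map (subtopology cantor D) (top_of (subtype (exp_type B lower_reals) S)) \<phi>"
  shows "\<exists>p. \<forall>d\<in>D. \<exists>r. apply_name p d = Some r \<and>
     rep_of (subtype (exp_type B lower_reals) S) r = Some (\<phi> d)"
proof -
  let ?K = "dom (rep_of B)" and ?pair = "interleave 1"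
  define D2 where "D2 = {w. component 2 0 w \<in> D \<and> component 2 1 w \<in> ?K}"
  define \<Phi> where "\<Phi> w = \<phi> (component 2 0 w) (the (rep_of B (component 2 1 w)))" for w
  have pair: "component 2 0 (?pair d k) = d" "component 2 1 (?pair d k) = k" for d k
    using component_interleave(1)[of 0 1 d k] component_interleave(2)[of 1 d k]
    by (simp_all add: component_def numeral_2_eq_2)
  have "continuous_map (subtopology cantor D2) lower_topology \<Phi>"
    unfolding continuous_map_lower openin_subtopology_cantor
  proof (intro allI conjI ballI)
    fix a w assume w: "w \<in> {x \<in> topspace (subtopology cantor D2). a < \<Phi> x}"
    then obtain y where y: "rep_of B (component 2 1 w) = Some y" by (auto simp: D2_def)
    obtain n where n: "\<forall>d'\<in>D. \<forall>k' y'. agree n (component 2 0 w) d' \<longrightarrow> agree n (component 2 1 w) k' \<longrightarrow>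
        rep_of B k' = Some y' \<longrightarrow> a < \<phi> d' y'"
      using uncurry_lsc[OF B \<phi> _ y, of "component 2 0 w" a] w y by (auto simp: D2_def \<Phi>_def)
    have "a < \<Phi> w'" if "w' \<in> D2" "agree (2 * n) w w'" for w'
      using n that agree_component[OF that(2), of 0] agree_component[OF that(2), of 1]
      by (auto simp: D2_def \<Phi>_def)
    then show "\<exists>n. \<forall>q\<in>D2. agree n w q \<longrightarrow> q \<in> {x \<in> topspace (subtopology cantor D2). a < \<Phi> x}"
      by auto
  qed auto
  then obtain p2 where p2: "\<And>w. w \<in> D2 \<Longrightarrow> \<exists>r. apply_name p2 w = Some r \<and> rep_of lower_reals r = Some (\<Phi> w)"
    using lower_associate by blast
  define g where "g d k = the (apply_name p2 (?pair d k))" for d k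
  have g: "apply_name p2 (?pair d k) = Some (g d k)" "rep_of lower_reals (g d k) = Some (\<phi> d (the (rep_of B k)))"
    if "d \<in> D" "k \<in> ?K" for d k
  proof -
    have "?pair d k \<in> D2" unfolding D2_def mem_Collect_eq pair using that ..
    moreover have "\<Phi> (?pair d k) = \<phi> d (the (rep_of B k))" unfolding \<Phi>_def pair ..
    ultimately show "apply_name p2 (?pair d k) = Some (g d k)"
      "rep_of lower_reals (g d k) = Some (\<phi> d (the (rep_of B k)))"
      using p2[of "?pair d k"] unfolding g_def by auto
  qed
  have g_cont: "\<exists>N. \<forall>d'\<in>D. \<forall>k'\<in>?K. agree N d d' \<longrightarrow> agree N k k' \<longrightarrow> agree n (g d k) (g d' k')"
    if dk: "d \<in> D" "k \<in> ?K" for d k n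
  proof -
    obtain N where N: "\<And>p' q' r'. agree N p2 p' \<Longrightarrow> agree N (?pair d k) q' \<Longrightarrow> apply_name p' q' = Some r' \<Longrightarrow>
        agree n (g d k) r'"
      using apply_name_agree[OF g(1)[OF dk]] by blast
    have pair_agree: "agree N (?pair d k) (?pair d' k')" if "agree N d d'" "agree N k k'" for d' k'
      using nonexpansive2_interleave[of 1] that unfolding nonexpansive2_def by blast
    show ?thesis
    proof (intro exI[of _ N] ballI impI)
      fix d' k' assume "d' \<in> D" "k' \<in> ?K" "agree N d d'" "agree N k k'"
      then show "agree n (g d k) (g d' k')" by (intro N[OF agree_refl pair_agree g(1)])
    qed
  qed
  \<comment> \<open>The entry for \<open>v\<close> inspects \<open>d\<close> only up to
    \<open>length v\<close>, which is at most the index of the entry; this makes \<open>r\<close>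
    non-expansive in \<open>d\<close>.\<close>
  define r where "r d l \<longleftrightarrow> (\<exists>i c v. l = assoc_index i c v \<and>
      (\<forall>d'\<in>D. \<forall>k\<in>?K. agree (length v) d d' \<longrightarrow> map k [0..<length v] = v \<longrightarrow> g d' k i = c))" for d l
  have r: "r d (assoc_index i c v) \<longleftrightarrow>
      (\<forall>d'\<in>D. \<forall>k\<in>?K. agree (length v) d d' \<longrightarrow> map k [0..<length v] = v \<longrightarrow> g d' k i = c)" for d i c v
    by (auto simp: r_def assoc_index_eq_iff)
  have "determines (r d) k i c \<longleftrightarrow> g d k i = c" if dk: "d \<in> D" "k \<in> ?K" for d k i c
  proof
    assume "g d k i = c"
    obtain N where N: "\<forall>d'\<in>D. \<forall>k'\<in>?K. agree N d d' \<longrightarrow> agree N k k' \<longrightarrow> agree (Suc i) (g d k) (g d' k')"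
      using g_cont[OF dk] by blast
    have "r d (assoc_index i c (map k [0..<N]))"
      unfolding r length_map length_upt diff_zero agree_iff_map[symmetric]
    proof (intro ballI impI)
      fix d' k' assume "d' \<in> D" "k' \<in> ?K" "agree N d d'" "agree N k k'"
      with N have "agree (Suc i) (g d k) (g d' k')" by blast
      then show "g d' k' i = c" using \<open>g d k i = c\<close> by (simp add: agree_def)
    qed
    then show "determines (r d) k i c" unfolding determines_def by blast
  next
    assume "determines (r d) k i c"
    then obtain n where "r d (assoc_index i c (map k [0..<n]))" by (auto simp: determines_def)
    then show "g d k i = c" using dk agree_refl unfolding r by auto
  qed
  then have app: "apply_name (r d) k = Some (g d k)" if "d \<in> D" "k \<in> ?K" for d k
    using that by (intro apply_nameI)
  have "agree n (r d) (r d')" if "agree n d d'" for n d d'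
    unfolding agree_def
  proof (intro allI impI)
    fix l assume "l < n"
    have "agree (length v) d e \<longleftrightarrow> agree (length v) d' e" if "l = assoc_index i c v" for i c v e
    proof -
      have "agree (length v) d d'"
        using \<open>agree n d d'\<close> by (rule agree_mono) (use that \<open>l < n\<close> length_le_assoc_index[of v i c] in simp)
      then show ?thesis using agree_trans agree_sym by blast
    qed
    then have "(l = assoc_index i c v \<and>
        (\<forall>e\<in>D. \<forall>k\<in>?K. agree (length v) d e \<longrightarrow> map k [0..<length v] = v \<longrightarrow> g e k i = c)) \<longleftrightarrow>
      (l = assoc_index i c v \<and>
        (\<forall>e\<in>D. \<forall>k\<in>?K. agree (length v) d' e \<longrightarrow> map k [0..<length v] = v \<longrightarrow> g e k i = c))" for i c v
      by (simp cong: conj_cong)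
    then show "r d l = r d' l" unfolding r_def by simp
  qed
  then obtain p where p: "\<And>d. d \<in> D \<Longrightarrow> apply_name p d = Some (r d)"
    using exists_associate[of D r] by blast
  have "rep_of (subtype (exp_type B lower_reals) S) (r d) = Some (\<phi> d)" if d: "d \<in> D" for d
  proof -
    have mem: "\<phi> d \<in> cont_funs B lower_reals \<inter> S"
    proof -
      have "\<phi> d \<in> members (subtype (exp_type B lower_reals) S)"
        by (rule continuous_map_cantorD(1)[OF \<phi> d])
      then show ?thesis
        by (simp add: members_subtype[OF quotient_rep_observables[OF B]] members_exp_type)
    qed
    have "realizes B lower_reals (r d) (\<phi> d)"
      unfolding realizes_def
    proof (intro allI impI)
      fix k y assume k: "rep_of B k = Some y"
      then have "k \<in> ?K" by blast
      then show "\<exists>s. apply_name (r d) k = Some s \<and> rep_of lower_reals s = Some (\<phi> d y)"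
        using app[OF d] g(2)[OF d, of k] k by auto
    qed
    then have "exp_rep B lower_reals (r d) = Some (\<phi> d)"
      using mem by (intro exp_repI[OF B continuous_rep_lower]) (auto simp: cont_funs_def)
    then show ?thesis using mem by (simp add: rep_subtype sub_rep_eq_Some exp_type_def)
  qed
  with p show ?thesis by blast
qed

lemma quotient_rep_prob_type:
  assumes "quotient_rep X"
  shows "quotient_rep (prob_type X)"
  unfolding prob_type_def by (intro quotient_rep_subtype quotient_rep_observables assms)

text \<open>Distributions form a subtype of the functionals on observables, so kernels get realizers
  from \<open>sub_exp_associate\<close>, with the type of observables as \<open>B\<close>.\<close>

lemma quotient_rep_markov_type:
  assumes X: "quotient_rep X"
  shows "quotient_rep (markov_type X)"
proof (rule quotient_rep_exp_type[OF X quotient_rep_continuous[OF quotient_rep_prob_type[OF X]]])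
  fix F assume F: "F \<in> cont_funs X (prob_type X)"
  have "continuous_map (subtopology cantor (dom (rep_of X))) (top_of (prob_type X)) (\<lambda>q. F (the (rep_of X q)))"
    using continuous_map_compose[OF quotient_imp_continuous_map[OF X[unfolded quotient_rep_def]], of _ F] F
    by (simp add: cont_funs_def comp_def)
  from sub_exp_associate[OF quotient_rep_observables[OF X] this[unfolded prob_type_def]]
  show "\<exists>p. realizes X (prob_type X) p F"
    unfolding realizes_def prob_type_def by fastforce
qed

lemma quotient_rep_power_type:
  assumes X: "quotient_rep X" and m: "0 < m"
  shows "quotient_rep (power_type X m)"
proof (rule quotient_rep_topology)
  have "t \<in> ran (power_rep X m)" if t: "t \<in> tuples X m" for t
  proof -
    have "\<forall>i<m. \<exists>q. rep_of X q = Some (t i)"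
      using t quotient_rep_surj[OF X] by (auto simp: tuples_def PiE_iff)
    then obtain q where q: "\<And>i. i < m \<Longrightarrow> rep_of X (q i) = Some (t i)" by metis
    define w where "w j = q (j mod m) (j div m)" for j
    have w: "component m i w = q i" if "i < m" for i
      using that by (auto simp: component_def w_def fun_eq_iff)
    have "(\<lambda>i\<in>{..<m}. the (rep_of X (component m i w))) = t"
      using t q w by (intro extensionalityI[of _ "{..<m}"]) (auto simp: tuples_def PiE_iff)
    then have "power_rep X m w = Some t"
      using q w by (auto simp: power_rep_def)
    then show ?thesis by (auto simp: ran_def)
  qed
  moreover have "t \<in> tuples X m" if "power_rep X m w = Some t" for w t
    using that quotient_rep_members[OF X] by (fastforce simp: power_rep_def tuples_def split: if_splits)
  ultimately show "ran (rep_of (power_type X m)) = tuples X m"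
    by (auto simp: power_type_def ran_def)
qed (simp add: power_type_def)


section \<open>Distributions\<close>

text \<open>If neither summand exceeds \<open>a\<close>, then \<open>a < u + v\<close> is witnessed
  by splitting \<open>a\<close> below both. A summand exceeding \<open>a\<close> alone is a separate
  case, as the other may be \<open>0\<close> with nothing strictly below it.\<close>

lemma lower_add:
  assumes f: "continuous_map X lower_topology f" and g: "continuous_map X lower_topology g"
  shows "continuous_map X lower_topology (\<lambda>x. f x + g x)"
  unfolding continuous_map_lower
proof
  fix a :: ennreal
  have split: "\<exists>b c. a \<le> b + c \<and> b < u \<and> c < v" if uv: "a < u + v" "u \<le> a" "v \<le> a" for u v
  proof -
    obtain a' where a': "a = ennreal a'" "0 \<le> a'" using uv(1) by (cases a) auto
    obtain u' where u': "u = ennreal u'" "0 \<le> u'" using uv(2) a' by (cases u) (auto simp: top_unique)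
    obtain v' where v': "v = ennreal v'" "0 \<le> v'" using uv(3) a' by (cases v) (auto simp: top_unique)
    have "a' < u' + v'" "u' \<le> a'" "v' \<le> a'"
      using uv a' u' v' by (simp_all add: ennreal_less_iff ennreal_le_iff flip: ennreal_plus)
    \<comment> \<open>Half of the surplus. It is at most half of either summand because the other
      one is at most \<open>a'\<close>, so both differences stay non-negative.\<close>
    define e where "e = (u' + v' - a') / 2"
    have e: "0 < e" "0 \<le> u' - e" "0 \<le> v' - e" "a' = (u' - e) + (v' - e)"
      using \<open>a' < u' + v'\<close> \<open>u' \<le> a'\<close> \<open>v' \<le> a'\<close> u'(2) v'(2) by (auto simp: e_def field_simps)
    have "a = ennreal (u' - e) + ennreal (v' - e)"
      unfolding a'(1) by (subst e(4)) (rule ennreal_plus[OF e(2,3)])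
    moreover have "ennreal (u' - e) < u" "ennreal (v' - e) < v"
      using e u' v' by (simp_all add: ennreal_less_iff)
    ultimately show ?thesis by (metis order_refl)
  qed
  have strict: "a < u + v" if "a \<le> b + c" "b < u" "c < v" for b c u v
  proof -
    have "b + c < b + v" using that(2,3) by (auto simp: ennreal_add_left_cancel_less)
    also have "\<dots> \<le> u + v" using that(2) by (intro add_right_mono less_imp_le)
    finally show ?thesis using that(1) by (rule le_less_trans[rotated])
  qed
  have "{x \<in> topspace X. a < f x + g x} =
      {x \<in> topspace X. a < f x} \<union> {x \<in> topspace X. a < g x} \<union>
      (\<Union>(b, c)\<in>{(b, c). a \<le> b + c}. {x \<in> topspace X. b < f x} \<inter> {x \<in> topspace X. c < g x})"
    (is "?A = ?B")
  proof
    show "?A \<subseteq> ?B" using split by (fastforce simp: not_less)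
    show "?B \<subseteq> ?A" using strict by (auto intro: less_le_trans add_increasing add_increasing2)
  qed
  moreover have "openin X ?B"
    using f g unfolding continuous_map_lower by (intro openin_Un openin_Union) auto
  ultimately show "openin X ?A" by simp
qed

text \<open>Multiplication by \<open>c\<close> preserves suprema, also for \<open>c\<close> zero or
  infinite, so \<open>Sup A\<close> is the greatest \<open>u\<close> with
  \<open>c * u \<le> a\<close> and the preimage is again a ray.\<close>

lemma lower_mult:
  assumes f: "continuous_map X lower_topology f"
  shows "continuous_map X lower_topology (\<lambda>x. c * f x)"
  unfolding continuous_map_lower
proof
  fix a
  define A where "A = {u. c * u \<le> a}"
  have "0 \<in> A" by (simp add: A_def)
  then have "c * Sup A = (SUP u\<in>A. c * u)"
    using SUP_mult_left_ennreal[of c "\<lambda>u. u" A] by simp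
  also have "\<dots> \<le> a" by (rule SUP_least) (simp add: A_def)
  finally have "c * Sup A \<le> a" .
  then have "a < c * u \<longleftrightarrow> Sup A < u" for u
    using mult_left_mono[of u "Sup A" c] Sup_upper[of u A] by (auto simp: A_def not_le[symmetric])
  then show "openin X {x \<in> topspace X. a < c * f x}"
    using f by (simp add: continuous_map_lower)
qed

lemma observables_eq:
  "observables X = {f \<in> extensional (members X). continuous_map (top_of X) lower_topology f}"
  by (simp add: members_exp_type cont_funs_def lower_reals_def)

lemma observables_linear:
  assumes "\<psi>1 \<in> observables X" "\<psi>2 \<in> observables X"
  shows "(\<lambda>x\<in>members X. a1 * \<psi>1 x + a2 * \<psi>2 x) \<in> observables X"
proof -
  have "continuous_map (top_of X) lower_topology (\<lambda>x. a1 * \<psi>1 x + a2 * \<psi>2 x)"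
    using assms by (intro lower_add lower_mult) (auto simp: observables_eq)
  then have "continuous_map (top_of X) lower_topology (\<lambda>x\<in>members X. a1 * \<psi>1 x + a2 * \<psi>2 x)"
    by (rule continuous_map_eq) simp
  then show ?thesis by (simp add: observables_eq)
qed

lemma observables_one: "(\<lambda>x\<in>members X. 1) \<in> observables X"
proof -
  have "openin (top_of X) {x \<in> members X. a < (1::ennreal)}" for a
    by (cases "a < 1") auto
  then have "continuous_map (top_of X) lower_topology (\<lambda>_. 1)"
    unfolding continuous_map_lower by blast
  then have "continuous_map (top_of X) lower_topology (\<lambda>x\<in>members X. 1)"
    by (rule continuous_map_eq) simp
  then show ?thesis by (simp add: observables_eq)
qed

section \<open>Transport of distributions on the level of names\<close>

lemma rep_prob_type:
  "rep_of (prob_type X) r = Some \<mu> \<longleftrightarrow>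
     exp_rep (exp_type X lower_reals) lower_reals r = Some \<mu> \<and>
     linear_functional X \<mu> \<and> \<mu> (\<lambda>x\<in>members X. 1) = 1"
  by (simp add: prob_type_def rep_subtype sub_rep_eq_Some) (simp add: exp_type_def)

lemma rep_observables: "rep_of (exp_type X lower_reals) = exp_rep X lower_reals"
  by (simp add: exp_type_def)

lemma observable_name:
  assumes "quotient_rep X" "\<psi> \<in> observables X"
  shows "\<exists>s. exp_rep X lower_reals s = Some \<psi>"
  using quotient_rep_surj[OF quotient_rep_observables[OF assms(1)] assms(2)] by (simp add: rep_observables)

lemma name_observable:
  assumes "exp_rep X lower_reals s = Some \<psi>"
  shows "\<psi> \<in> observables X"
  using exp_rep_SomeD[OF assms] by (simp add: members_exp_type)

lemma exp_rep_apply: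
  assumes "exp_rep X Y p = Some f" "rep_of X q = Some x"
  shows "\<exists>r. apply_name p q = Some r \<and> rep_of Y r = Some (f x)"
  using realizesD[OF conjunct2[OF exp_rep_SomeD[OF assms(1)]] assms(2)] .

text \<open>\<open>Tr\<close> carries observables on \<open>A'\<close> back to \<open>A\<close>.
  Since \<open>G\<close> realizes it on names, \<open>dpre\<close> yields a realizer of the
  composite, which inherits linearity and mass one through \<open>lin\<close> and
  \<open>one\<close>.\<close>

lemma prob_transport:
  assumes A: "quotient_rep A" and A': "quotient_rep A'"
    and \<gamma>: "rep_of (prob_type A) r = Some \<gamma>"
    and G: "nonexpansive G"
    and tr: "\<And>s \<psi>. exp_rep A' lower_reals s = Some \<psi> \<Longrightarrow> exp_rep A lower_reals (G s) = Some (Tr \<psi>)"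
    and lin: "\<And>a1 a2 \<psi>1 \<psi>2. \<psi>1 \<in> observables A' \<Longrightarrow> \<psi>2 \<in> observables A' \<Longrightarrow>
      Tr (\<lambda>x\<in>members A'. a1 * \<psi>1 x + a2 * \<psi>2 x) = (\<lambda>x\<in>members A. a1 * Tr \<psi>1 x + a2 * Tr \<psi>2 x)"
    and one: "Tr (\<lambda>x\<in>members A'. 1) = (\<lambda>x\<in>members A. 1)"
  shows "rep_of (prob_type A') (dpre r G) = Some (\<lambda>\<psi>\<in>observables A'. \<gamma> (Tr \<psi>))"
proof -
  have \<gamma>': "exp_rep (exp_type A lower_reals) lower_reals r = Some \<gamma>" "linear_functional A \<gamma>"
    "\<gamma> (\<lambda>x\<in>members A. 1) = 1"
    using \<gamma> by (simp_all add: rep_prob_type)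
  have Tr: "Tr \<psi> \<in> observables A" if \<psi>: "\<psi> \<in> observables A'" for \<psi>
    using observable_name[OF A' \<psi>] tr name_observable by blast
  have "realizes (exp_type A' lower_reals) lower_reals (dpre r G) (\<lambda>\<psi>\<in>observables A'. \<gamma> (Tr \<psi>))"
    unfolding realizes_def
  proof (intro allI impI)
    fix s \<psi> assume "rep_of (exp_type A' lower_reals) s = Some \<psi>"
    then have s: "exp_rep A' lower_reals s = Some \<psi>" by (simp add: rep_observables)
    have "rep_of (exp_type A lower_reals) (G s) = Some (Tr \<psi>)" using tr[OF s] by (simp add: rep_observables)
    from exp_rep_apply[OF \<gamma>'(1) this]
    show "\<exists>t. apply_name (dpre r G) s = Some t \<and>
        rep_of lower_reals t = Some ((\<lambda>\<psi>\<in>observables A'. \<gamma> (Tr \<psi>)) \<psi>)"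
      using name_observable[OF s] by (simp add: apply_name_dpre[OF G])
  qed
  then have "exp_rep (exp_type A' lower_reals) lower_reals (dpre r G) = Some (\<lambda>\<psi>\<in>observables A'. \<gamma> (Tr \<psi>))"
    by (rule exp_repI[OF quotient_rep_observables[OF A'] continuous_rep_lower]) simp
  moreover have "linear_functional A' (\<lambda>\<psi>\<in>observables A'. \<gamma> (Tr \<psi>))"
    unfolding linear_functional_def
  proof (intro allI ballI)
    fix a1 a2 \<psi>1 \<psi>2 assume \<psi>: "\<psi>1 \<in> observables A'" "\<psi>2 \<in> observables A'"
    have "\<gamma> (Tr (\<lambda>x\<in>members A'. a1 * \<psi>1 x + a2 * \<psi>2 x)) = a1 * \<gamma> (Tr \<psi>1) + a2 * \<gamma> (Tr \<psi>2)"
      unfolding lin[OF \<psi>] using \<gamma>'(2) Tr \<psi> unfolding linear_functional_def by blast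
    then show "(\<lambda>\<psi>\<in>observables A'. \<gamma> (Tr \<psi>)) (\<lambda>x\<in>members A'. a1 * \<psi>1 x + a2 * \<psi>2 x) =
        a1 * (\<lambda>\<psi>\<in>observables A'. \<gamma> (Tr \<psi>)) \<psi>1 + a2 * (\<lambda>\<psi>\<in>observables A'. \<gamma> (Tr \<psi>)) \<psi>2"
      using \<psi> observables_linear[OF \<psi>] by simp
  qed
  moreover have "(\<lambda>\<psi>\<in>observables A'. \<gamma> (Tr \<psi>)) (\<lambda>x\<in>members A'. 1) = 1"
    using observables_one[of A'] \<gamma>'(3) one by simp
  ultimately show ?thesis by (simp add: rep_prob_type)
qed

text \<open>\<open>c\<close> extracts the current state and \<open>e\<close> adjoins the next one.
  Here \<open>Tr\<close> integrates \<open>\<psi>\<close> over the next state; \<open>bindw\<close>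
  realizes it by feeding the name of the inner observable to the name of \<open>F (c a)\<close>
  produced by \<open>p\<close>.\<close>

lemma kernel_transport:
  assumes X: "quotient_rep X" and A: "quotient_rep A" and A': "quotient_rep A'"
    and F: "rep_of (markov_type X) p = Some F" and i: "i < m"
    and c: "\<And>x a. rep_of A x = Some a \<Longrightarrow> rep_of X (component m i x) = Some (c a)"
    and e: "\<And>x y a b. rep_of A x = Some a \<Longrightarrow> rep_of X y = Some b \<Longrightarrow> rep_of A' (J x y) = Some (e a b)"
    and J: "nonexpansive2 J"
    and \<gamma>: "rep_of (prob_type A) r = Some \<gamma>"
  shows "rep_of (prob_type A') (kernel_word m i J p r) =
    Some (\<lambda>\<psi>\<in>observables A'. \<gamma> (\<lambda>a\<in>members A. F (c a) (\<lambda>b\<in>members X. \<psi> (e a b))))"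
  unfolding kernel_word_def
proof (rule prob_transport[OF A A' \<gamma> nonexpansive_kernel_arg(3)[OF J]])
  have F': "exp_rep X (prob_type X) p = Some F" using F by (simp add: exp_type_def)
  have inner: "exp_rep X lower_reals (dpre s (J x)) = Some (\<lambda>b\<in>members X. \<psi> (e a b))"
    if s: "exp_rep A' lower_reals s = Some \<psi>" and x: "rep_of A x = Some a" for s \<psi> x a
  proof (rule exp_repI[OF X continuous_rep_lower])
    show "realizes X lower_reals (dpre s (J x)) (\<lambda>b\<in>members X. \<psi> (e a b))"
      unfolding realizes_def
    proof (intro allI impI)
      fix y b assume y: "rep_of X y = Some b"
      from exp_rep_apply[OF s e[OF x y]] quotient_rep_members[OF X y]
      show "\<exists>t. apply_name (dpre s (J x)) y = Some t \<and>
          rep_of lower_reals t = Some ((\<lambda>b\<in>members X. \<psi> (e a b)) b)"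
        by (simp add: apply_name_dpre[OF nonexpansive_kernel_arg(1)[OF J]])
    qed
  qed simp
  show "exp_rep A lower_reals (bindw p m i (\<lambda>x. dpre s (J x))) =
      Some (\<lambda>a\<in>members A. F (c a) (\<lambda>b\<in>members X. \<psi> (e a b)))"
    if s: "exp_rep A' lower_reals s = Some \<psi>" for s \<psi>
  proof (rule exp_repI[OF A continuous_rep_lower])
    show "realizes A lower_reals (bindw p m i (\<lambda>x. dpre s (J x)))
        (\<lambda>a\<in>members A. F (c a) (\<lambda>b\<in>members X. \<psi> (e a b)))"
      unfolding realizes_def
    proof (intro allI impI)
      fix x a assume x: "rep_of A x = Some a"
      obtain y where y: "apply_name p (component m i x) = Some y" "rep_of (prob_type X) y = Some (F (c a))"
        using exp_rep_apply[OF F' c[OF x]] by blast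
      have y': "exp_rep (exp_type X lower_reals) lower_reals y = Some (F (c a))"
        using y(2) by (simp add: rep_prob_type)
      have "rep_of (exp_type X lower_reals) (dpre s (J x)) = Some (\<lambda>b\<in>members X. \<psi> (e a b))"
        using inner[OF s x] by (simp add: rep_observables)
      from exp_rep_apply[OF y' this] quotient_rep_members[OF A x]
      show "\<exists>t. apply_name (bindw p m i (\<lambda>x. dpre s (J x))) x = Some t \<and> rep_of lower_reals t =
          Some ((\<lambda>a\<in>members A. F (c a) (\<lambda>b\<in>members X. \<psi> (e a b))) a)"
        by (simp add: apply_name_bindw[OF nonexpansive_kernel_arg(2)[OF J] i y(1)])
    qed
  qed simp
  have mem: "e a b \<in> members A'" if a: "a \<in> members A" and b: "b \<in> members X" for a b
    using quotient_rep_surj[OF A a] quotient_rep_surj[OF X b] e quotient_rep_members[OF A'] by blast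
  have Fc: "linear_functional X (F (c a))" "F (c a) (\<lambda>x\<in>members X. 1) = 1" if a: "a \<in> members A" for a
  proof -
    obtain x where "rep_of A x = Some a" using quotient_rep_surj[OF A a] by blast
    from exp_rep_apply[OF F' c[OF this]]
    show "linear_functional X (F (c a))" "F (c a) (\<lambda>x\<in>members X. 1) = 1"
      by (auto simp: rep_prob_type)
  qed
  have obs: "(\<lambda>b\<in>members X. \<psi> (e a b)) \<in> observables X"
    if \<psi>: "\<psi> \<in> observables A'" and a: "a \<in> members A" for \<psi> a
    using observable_name[OF A' \<psi>] quotient_rep_surj[OF A a] inner name_observable by blast
  show "(\<lambda>a\<in>members A. F (c a) (\<lambda>b\<in>members X. (\<lambda>x\<in>members A'. a1 * \<psi>1 x + a2 * \<psi>2 x) (e a b))) =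
      (\<lambda>x\<in>members A. a1 * (\<lambda>a\<in>members A. F (c a) (\<lambda>b\<in>members X. \<psi>1 (e a b))) x +
                       a2 * (\<lambda>a\<in>members A. F (c a) (\<lambda>b\<in>members X. \<psi>2 (e a b))) x)"
    if \<psi>: "\<psi>1 \<in> observables A'" "\<psi>2 \<in> observables A'" for a1 a2 \<psi>1 \<psi>2
  proof (rule restrict_ext)
    fix a assume a: "a \<in> members A"
    \<comment> \<open>The combination on \<open>A'\<close> must first take the literal form of one
      on \<open>X\<close>, to which linearity of \<open>F (c a)\<close> applies.\<close>
    have "(\<lambda>b\<in>members X. (\<lambda>x\<in>members A'. a1 * \<psi>1 x + a2 * \<psi>2 x) (e a b)) =
      (\<lambda>b\<in>members X. a1 * (\<lambda>b\<in>members X. \<psi>1 (e a b)) b + a2 * (\<lambda>b\<in>members X. \<psi>2 (e a b)) b)"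
      by (rule restrict_ext) (simp add: mem[OF a])
    note eq = this
    show "F (c a) (\<lambda>b\<in>members X. (\<lambda>x\<in>members A'. a1 * \<psi>1 x + a2 * \<psi>2 x) (e a b)) =
        a1 * (\<lambda>a\<in>members A. F (c a) (\<lambda>b\<in>members X. \<psi>1 (e a b))) a +
        a2 * (\<lambda>a\<in>members A. F (c a) (\<lambda>b\<in>members X. \<psi>2 (e a b))) a"
      unfolding eq restrict_apply'[OF a]
      using Fc(1)[OF a] obs[OF \<psi>(1) a] obs[OF \<psi>(2) a] unfolding linear_functional_def by blast
  qed
  show "(\<lambda>a\<in>members A. F (c a) (\<lambda>b\<in>members X. (\<lambda>x\<in>members A'. 1) (e a b))) = (\<lambda>x\<in>members A. 1)"
  proof (rule restrict_ext)
    fix a assume a: "a \<in> members A"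
    have "(\<lambda>b\<in>members X. (\<lambda>x\<in>members A'. 1::ennreal) (e a b)) = (\<lambda>b\<in>members X. 1)"
      by (rule restrict_ext) (simp add: mem[OF a])
    then show "F (c a) (\<lambda>b\<in>members X. (\<lambda>x\<in>members A'. 1) (e a b)) = 1"
      using Fc(2)[OF a] by simp
  qed
qed

lemma rep_power_type:
  "rep_of (power_type X m) x = Some t \<longleftrightarrow>
     t \<in> extensional {..<m} \<and> (\<forall>i<m. rep_of X (component m i x) = Some (t i))"
  by (auto simp: power_type_def power_rep_def fun_eq_iff extensional_def domIff) (metis option.sel)

text \<open>The past is forgotten: the tuple has length one, \<open>component 1 0\<close> leaves
  words unchanged, and adjoining the next state means replacing the current one.\<close>

lemma state_name:
  assumes X: "quotient_rep X" and F: "rep_of (markov_type X) p = Some F"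
    and \<mu>: "rep_of (prob_type X) q = Some \<mu>"
  shows "rep_of (prob_type X) (kernel_iterate (\<lambda>_. 0) (\<lambda>_ x y. y) p q n) =
    Some (state_distribution X F \<mu> n)"
proof (induction n)
  case (Suc n)
  have "rep_of (prob_type X) (kernel_iterate (\<lambda>_. 0) (\<lambda>_ x y. y) p q (Suc n)) =
    Some (\<lambda>\<psi>\<in>observables X. state_distribution X F \<mu> n
      (\<lambda>x\<in>members X. F x (\<lambda>y\<in>members X. \<psi> y)))"
    unfolding kernel_iterate.simps
    by (rule kernel_transport[OF X X X F _ _ _ _ Suc]) (auto simp: component_def nonexpansive2_def)
  also have "(\<lambda>\<psi>\<in>observables X. state_distribution X F \<mu> n
      (\<lambda>x\<in>members X. F x (\<lambda>y\<in>members X. \<psi> y))) = state_distribution X F \<mu> (Suc n)"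
    unfolding state_distribution.simps
    by (rule restrict_ext) (simp add: observables_eq extensional_restrict)
  finally show ?case .
qed (simp add: \<mu>)

text \<open>A \<open>1\<close>-tuple has the same names as its only entry, so realizers of
  observables serve unchanged and \<open>id\<close> starts the iteration. Histories are then
  extended by interleaving.\<close>

lemma joint_name:
  assumes X: "quotient_rep X" and F: "rep_of (markov_type X) p = Some F"
    and \<mu>: "rep_of (prob_type X) q = Some \<mu>"
  shows "rep_of (prob_type (power_type X (Suc n)))
     (kernel_iterate (\<lambda>n. n) (\<lambda>n. interleave (Suc n)) p (dpre q id) n) =
    Some (joint_distribution X F \<mu> n)"
proof (induction n)
  case 0
  have X1: "quotient_rep (power_type X 1)" by (rule quotient_rep_power_type[OF X]) simp
  have mem: "(\<lambda>i\<in>{..<1}. x) \<in> members (power_type X 1)" if x: "x \<in> members X" for x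
  proof -
    obtain w where "rep_of X w = Some x" using quotient_rep_surj[OF X x] by blast
    then have "rep_of (power_type X 1) w = Some (\<lambda>i\<in>{..<1}. x)"
      by (simp add: rep_power_type component_def)
    then show ?thesis by (rule quotient_rep_members[OF X1])
  qed
  have "rep_of (prob_type (power_type X 1)) (dpre q id) =
      Some (\<lambda>\<psi>\<in>observables (power_type X 1). \<mu> (\<lambda>x\<in>members X. \<psi> (\<lambda>i\<in>{..<1}. x)))"
  proof (rule prob_transport[OF X X1 \<mu>])
    show "exp_rep X lower_reals (id s) = Some (\<lambda>x\<in>members X. \<psi> (\<lambda>i\<in>{..<1}. x))"
      if s: "exp_rep (power_type X 1) lower_reals s = Some \<psi>" for s \<psi>
    proof (rule exp_repI[OF X continuous_rep_lower])
      show "realizes X lower_reals (id s) (\<lambda>x\<in>members X. \<psi> (\<lambda>i\<in>{..<1}. x))"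
        unfolding realizes_def
      proof (intro allI impI)
        fix w x assume w: "rep_of X w = Some x"
        then have "rep_of (power_type X 1) w = Some (\<lambda>i\<in>{..<1}. x)"
          by (simp add: rep_power_type component_def)
        from exp_rep_apply[OF s this] quotient_rep_members[OF X w]
        show "\<exists>r. apply_name (id s) w = Some r \<and>
            rep_of lower_reals r = Some ((\<lambda>x\<in>members X. \<psi> (\<lambda>i\<in>{..<1}. x)) x)" by simp
      qed
    qed simp
  qed (use mem in \<open>auto simp: nonexpansive_def intro!: restrict_ext\<close>)
  then show ?case by (simp only: joint_distribution.simps kernel_iterate.simps One_nat_def)
next
  case (Suc n)
  have "rep_of (prob_type (power_type X (Suc (Suc n))))
      (kernel_word (Suc n) n (interleave (Suc n)) p
        (kernel_iterate (\<lambda>n. n) (\<lambda>n. interleave (Suc n)) p (dpre q id) n)) =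
    Some (\<lambda>\<psi>\<in>observables (power_type X (Suc (Suc n))). joint_distribution X F \<mu> n
      (\<lambda>x\<in>members (power_type X (Suc n)). F (x n) (\<lambda>y\<in>members X. \<psi> (x(Suc n := y)))))"
  proof (rule kernel_transport[OF X _ _ F _ _ _ nonexpansive2_interleave Suc])
    show "quotient_rep (power_type X (Suc n))" "quotient_rep (power_type X (Suc (Suc n)))"
      by (intro quotient_rep_power_type[OF X], simp)+
    show "rep_of X (component (Suc n) n x) = Some (a n)"
      if "rep_of (power_type X (Suc n)) x = Some a" for x a
      using that by (simp add: rep_power_type)
    show "rep_of (power_type X (Suc (Suc n))) (interleave (Suc n) x y) = Some (a(Suc n := b))"
      if x: "rep_of (power_type X (Suc n)) x = Some a" and y: "rep_of X y = Some b" for x y a b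
      unfolding rep_power_type
    proof (intro conjI allI impI)
      show "a(Suc n := b) \<in> extensional {..<Suc (Suc n)}"
        using x by (auto simp: rep_power_type extensional_def)
      fix i assume "i < Suc (Suc n)"
      then consider "i < Suc n" | "i = Suc n" by linarith
      then show "rep_of X (component (Suc (Suc n)) i (interleave (Suc n) x y)) = Some ((a(Suc n := b)) i)"
        using x y by cases (auto simp: component_interleave rep_power_type)
    qed
  qed simp
  then show ?case by (simp only: joint_distribution.simps kernel_iterate.simps)
qed

text \<open>One word function gives both parts: it is what the machine computes, and, since all
  members have names, it also shows that values at members are members.\<close>

lemma computable_op2I:
  assumes "quotient_rep A" "quotient_rep B" "quotient_rep C"
    and "\<exists>M. is_machine 2 M \<and> (\<forall>p q. computes M [p, q] (W p q))"
    and W: "\<And>p q x y. rep_of A p = Some x \<Longrightarrow> rep_of B q = Some y \<Longrightarrow> rep_of C (W p q) = Some (f x y)"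
  shows "computable_op2 A B C f"
  unfolding computable_op2_def
proof (intro conjI ballI)
  fix x y assume "x \<in> members A" "y \<in> members B"
  then show "f x y \<in> members C"
    using quotient_rep_surj[OF assms(1)] quotient_rep_surj[OF assms(2)] W quotient_rep_members[OF assms(3)]
    by blast
next
  show "\<exists>M. is_machine 2 M \<and> (\<forall>p q x y. rep_of A p = Some x \<longrightarrow> rep_of B q = Some y \<longrightarrow>
           (\<exists>r. computes M [p, q] r \<and> rep_of C r = Some (f x y)))"
    using assms(4) W by blast
qed

theorem theorem53:
  fixes X :: "'a ctype" and n :: nat
  assumes "computable_type X"
  shows "computable_op2 (markov_type X) (prob_type X) (prob_type X)
           (\<lambda>F \<mu>0. state_distribution X F \<mu>0 n) \<and>
         computable_op2 (markov_type X) (prob_type X) (prob_type (power_type X (n + 1)))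
           (\<lambda>F \<mu>0. joint_distribution X F \<mu>0 n)"
proof
  have X: "quotient_rep X"
    using assms by (simp add: computable_type_def quotient_rep_def)
  show "computable_op2 (markov_type X) (prob_type X) (prob_type X)
           (\<lambda>F \<mu>0. state_distribution X F \<mu>0 n)"
  proof (rule computable_op2I[OF quotient_rep_markov_type[OF X] quotient_rep_prob_type[OF X]
        quotient_rep_prob_type[OF X] _ state_name[OF X]])
    show "\<exists>M. is_machine 2 M \<and> (\<forall>p q. computes M [p, q] (kernel_iterate (\<lambda>_. 0) (\<lambda>_ x y. y) p q n))"
      by (intro kernel_iterate_machine word_pr_query word_pr_wordc pr_var) simp
  qed
  show "computable_op2 (markov_type X) (prob_type X) (prob_type (power_type X (n + 1)))
           (\<lambda>F \<mu>0. joint_distribution X F \<mu>0 n)"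
    unfolding Suc_eq_plus1[symmetric]
  proof (rule computable_op2I[OF quotient_rep_markov_type[OF X] quotient_rep_prob_type[OF X]
        quotient_rep_prob_type[OF quotient_rep_power_type[OF X]] _ joint_name[OF X]])
    show "\<exists>M. is_machine 2 M \<and> (\<forall>p q. computes M [p, q]
        (kernel_iterate (\<lambda>n. n) (\<lambda>n. interleave (Suc n)) p (dpre q id) n))"
      by (intro kernel_iterate_machine word_pr_dpre word_pr_interleave word_pr_query word_pr_wordc pr_var)
        (simp_all add: word_pr_wordc pr_var)
  qed simp
qed

end
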